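(* Let $k$ be an algebraically closed field whose characteristic is not $2$, $3$, or $5$, and let $R=k\llbracket x,y,z\rrbracket/(z^2+x^3+y^4)$. Then $\tau_{MCM}(R)=(x,y^2,z)$.
   Context: All rings are commutative, unital, Noetherian and local. A maximal Cohen-Macaulay (MCM) module over a ring $R$ is a finitely generated (nonzero) $R$-module $M$ such that the length of the longest regular sequence on $M$ equals the Krull dimension of $R$; a sequence $x_1,\ldots,x_n$ in $R$ is regular on $M$ if $(x_1,\ldots,x_n)M\ne M$, $x_1$ is a non-zerodivisor on $M$, and $x_i$ is a non-zerodivisor on $M/(x_1,\ldots,x_{i-1})M$ for $2\le i\le n$. For an $R$-module $M$ and $R$-modules $A\subseteq B$, let $A_B^{\mathrm{cl}_M}=\{b\in B : x\otimes b\in \operatorname{im}(M\otimes_R A\to M\otimes_R B)\text{ for all }x\in M\}$. The test ideal of $R$ associated to $M$ is $\tau_M(R)=\bigcap_{A\subseteq B}(A:_R A_B^{\mathrm{cl}_M})$, the intersection over all pairs of $R$-modules $A\subseteq B$. By a known theorem, when $R$ is local and $M$ is finitely generated, $\tau_M(R)$ equals the trace ideal $\sum_{f\in\operatorname{Hom}_R(M,R)}f(M)$, and $\tau_M(R)$ denotes this common ideal. $\tau_{MCM}(R)=\bigcap_M \tau_M(R)$, the intersection over all isomorphism classes of maximal Cohen-Macaulay $R$-modules $M$. *)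

theory Defs
  imports
    "HOL-Algebra.Algebra"
    "HOL-Algebra.Algebraic_Closure_Type"
    "HOL-Computational_Algebra.Computational_Algebra"
    "HOL-Library.Extended_Nat"
    "HOL-Library.Equipollence"
begin

section \<open>Submodules, dimension and depth\<close>

definition submodule_span ::
    "('a, 'c) ring_scheme \<Rightarrow> ('a, 'b) module \<Rightarrow> 'b set \<Rightarrow> 'b set" where
  "submodule_span R M S = \<Inter>{N. submodule N R M \<and> S \<subseteq> N}"

definition fin_gen_module :: "('a, 'c) ring_scheme \<Rightarrow> ('a, 'b) module \<Rightarrow> bool" where
  "fin_gen_module R M \<longleftrightarrow>
     module R M \<and> (\<exists>S \<subseteq> carrier M. finite S \<and> submodule_span R M S = carrier M)"

definition ideal_smult ::
    "('a, 'c) ring_scheme \<Rightarrow> 'a set \<Rightarrow> ('a, 'b) module \<Rightarrow> 'b set" where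
  "ideal_smult R I M = submodule_span R M {r \<odot>\<^bsub>M\<^esub> m | r m. r \<in> I \<and> m \<in> carrier M}"

definition krull_dim :: "('a, 'c) ring_scheme \<Rightarrow> enat" where
  "krull_dim R = Sup {enat n | n. \<exists>P :: nat \<Rightarrow> 'a set.
     (\<forall>i\<le>n. primeideal (P i) R) \<and> (\<forall>i<n. P i \<subset> P (Suc i))}"

text \<open>
  The condition below says that \<open>r\<close> is a non-zerodivisor on the quotient \<open>M/N\<close>, written in
  terms of representatives: \<open>r (m + N) = 0\<close> means that \<open>r m\<close> lies in \<open>N\<close>.
\<close>

definition nonzerodivisor_mod ::
    "('a, 'c) ring_scheme \<Rightarrow> ('a, 'b) module \<Rightarrow> 'b set \<Rightarrow> 'a \<Rightarrow> bool" where
  "nonzerodivisor_mod R M N r \<longleftrightarrow>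
     r \<in> carrier R \<and> (\<forall>m \<in> carrier M. r \<odot>\<^bsub>M\<^esub> m \<in> N \<longrightarrow> m \<in> N)"

definition regular_sequence ::
    "('a, 'c) ring_scheme \<Rightarrow> ('a, 'b) module \<Rightarrow> 'a list \<Rightarrow> bool" where
  "regular_sequence R M xs \<longleftrightarrow>
     set xs \<subseteq> carrier R \<and>
     ideal_smult R (Idl\<^bsub>R\<^esub> (set xs)) M \<noteq> carrier M \<and>
     (\<forall>i < length xs.
        nonzerodivisor_mod R M (ideal_smult R (Idl\<^bsub>R\<^esub> (set (take i xs))) M) (xs ! i))"

definition module_depth :: "('a, 'c) ring_scheme \<Rightarrow> ('a, 'b) module \<Rightarrow> enat" where
  "module_depth R M = Sup {enat (length xs) | xs. regular_sequence R M xs}"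

definition MCM_module :: "('a, 'c) ring_scheme \<Rightarrow> ('a, 'b) module \<Rightarrow> bool" where
  "MCM_module R M \<longleftrightarrow>
     fin_gen_module R M \<and> carrier M \<noteq> {\<zero>\<^bsub>M\<^esub>} \<and> module_depth R M = krull_dim R"


section \<open>Tensor products\<close>

text \<open>
  The (underlying abelian group of the) tensor product of \<open>M\<close> and \<open>N\<close> over \<open>R\<close> is the free
  abelian group on the pairs, modulo biadditivity and the balancing relations
  \<open>(r m, n) = (m, r n)\<close>. The module structure is not needed for the closure operation.
\<close>

definition tensor_relators ::
    "('a, 'c) ring_scheme \<Rightarrow> ('a, 'm) module \<Rightarrow> ('a, 'n) module \<Rightarrow> ('m \<times> 'n \<Rightarrow>\<^sub>0 int) set" where
  "tensor_relators R M N =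
     {frag_of (m \<oplus>\<^bsub>M\<^esub> m', n) - frag_of (m, n) - frag_of (m', n) | m m' n.
        m \<in> carrier M \<and> m' \<in> carrier M \<and> n \<in> carrier N} \<union>
     {frag_of (m, n \<oplus>\<^bsub>N\<^esub> n') - frag_of (m, n) - frag_of (m, n') | m n n'.
        m \<in> carrier M \<and> n \<in> carrier N \<and> n' \<in> carrier N} \<union>
     {frag_of (r \<odot>\<^bsub>M\<^esub> m, n) - frag_of (m, r \<odot>\<^bsub>N\<^esub> n) | r m n.
        r \<in> carrier R \<and> m \<in> carrier M \<and> n \<in> carrier N}"

abbreviation free_on_pairs ::
    "('a, 'm) module \<Rightarrow> ('a, 'n) module \<Rightarrow> ('m \<times> 'n \<Rightarrow>\<^sub>0 int) monoid" where
  "free_on_pairs M N \<equiv> free_Abelian_group (carrier M \<times> carrier N)"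

definition tensor_kernel ::
    "('a, 'c) ring_scheme \<Rightarrow> ('a, 'm) module \<Rightarrow> ('a, 'n) module \<Rightarrow> ('m \<times> 'n \<Rightarrow>\<^sub>0 int) set" where
  "tensor_kernel R M N = generate (free_on_pairs M N) (tensor_relators R M N)"

definition tensor_product ::
    "('a, 'c) ring_scheme \<Rightarrow> ('a, 'm) module \<Rightarrow> ('a, 'n) module \<Rightarrow>
     ('m \<times> 'n \<Rightarrow>\<^sub>0 int) set monoid" where
  "tensor_product R M N = free_on_pairs M N Mod tensor_kernel R M N"

definition pure_tensor ::
    "('a, 'c) ring_scheme \<Rightarrow> ('a, 'm) module \<Rightarrow> ('a, 'n) module \<Rightarrow> 'm \<Rightarrow> 'n \<Rightarrow>
     ('m \<times> 'n \<Rightarrow>\<^sub>0 int) set" where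
  "pure_tensor R M N m n = tensor_kernel R M N #>\<^bsub>free_on_pairs M N\<^esub> frag_of (m, n)"

text \<open>
  For a submodule \<open>A\<close> of \<open>B\<close>, the map from the tensor product of \<open>M\<close> and \<open>A\<close> to that of \<open>M\<close>
  and \<open>B\<close> induced by the inclusion. It sends the class of a formal sum of pairs in \<open>M \<times> A\<close> to
  the class of the same formal sum; see the lemma \<open>tensor_inclusion_class\<close>.
\<close>

definition tensor_inclusion ::
    "('a, 'c) ring_scheme \<Rightarrow> ('a, 'm) module \<Rightarrow> ('a, 'n) module \<Rightarrow>
     ('m \<times> 'n \<Rightarrow>\<^sub>0 int) set \<Rightarrow> ('m \<times> 'n \<Rightarrow>\<^sub>0 int) set" where
  "tensor_inclusion R M B t = (\<Union>c\<in>t. tensor_kernel R M B #>\<^bsub>free_on_pairs M B\<^esub> c)"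

lemma tensor_relators_carrier:
  assumes "module R M" "module R N"
  shows "tensor_relators R M N \<subseteq> carrier (free_on_pairs M N)"
proof -
  interpret M: module R M by fact
  interpret N: module R N by fact
  have *: "a - b \<in> carrier (free_Abelian_group S)"
    if "a \<in> carrier (free_Abelian_group S)" "b \<in> carrier (free_Abelian_group S)"
    for a b :: "'c \<times> 'd \<Rightarrow>\<^sub>0 int" and S
    using that keys_diff[of a b] by auto
  have "frag_of (m, n) \<in> carrier (free_on_pairs M N)" if "m \<in> carrier M" "n \<in> carrier N" for m n
    using that by simp
  then show ?thesis
    unfolding tensor_relators_def by (auto simp del: carrier_free_Abelian_group_iff intro!: *)
qed

lemma tensor_inclusion_class:
  fixes M :: "('a, 'm) module" and B :: "('a, 'n) module"
  assumes M: "module R M" and B: "module R B" and A: "submodule A R B"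
    and c: "c \<in> carrier (free_on_pairs M (B\<lparr>carrier := A\<rparr>))"
  shows "tensor_inclusion R M B
           (tensor_kernel R M (B\<lparr>carrier := A\<rparr>) #>\<^bsub>free_on_pairs M (B\<lparr>carrier := A\<rparr>)\<^esub> c)
         = tensor_kernel R M B #>\<^bsub>free_on_pairs M B\<^esub> c"
proof -
  let ?A = "B\<lparr>carrier := A\<rparr>"
  let ?F = "free_on_pairs M B" and ?G = "free_on_pairs M ?A"
  let ?K = "tensor_kernel R M B" and ?L = "tensor_kernel R M ?A"
  have AB: "A \<subseteq> carrier B"
    using A by (simp add: module.submoduleE(1)[OF B])
  have GF: "carrier ?G \<subseteq> carrier ?F"
    using AB by (auto simp: subset_iff)
  have rel: "tensor_relators R M ?A \<subseteq> tensor_relators R M B"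
    using AB unfolding tensor_relators_def by auto blast+
  have modA: "module R ?A"
    using submodule.submodule_is_module[OF A B] .
  have relG: "tensor_relators R M ?A \<subseteq> carrier ?G"
    by (rule tensor_relators_carrier[OF M modA])
  have relF: "tensor_relators R M B \<subseteq> carrier ?F"
    by (rule tensor_relators_carrier[OF M B])
  have K: "subgroup ?K ?F"
    unfolding tensor_kernel_def by (rule group.generate_is_subgroup[OF group_free_Abelian_group relF])
  have L: "subgroup ?L ?G"
    unfolding tensor_kernel_def by (rule group.generate_is_subgroup[OF group_free_Abelian_group relG])
  have LK: "?L \<subseteq> ?K"
  proof
    fix u assume "u \<in> ?L"
    then show "u \<in> ?K"
      unfolding tensor_kernel_def
    proof (induction rule: generate.induct)
      case one
      show ?case using generate.one[of ?F] by simp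
    next
      case (incl h)
      then show ?case using rel by (blast intro: generate.incl)
    next
      case (inv h)
      have "Poly_Mapping.keys h \<subseteq> carrier M \<times> A"
        using subsetD[OF relG inv] by simp
      moreover have "Poly_Mapping.keys h \<subseteq> carrier M \<times> carrier B"
        using calculation AB by blast
      moreover have "inv\<^bsub>?F\<^esub> h \<in> generate ?F (tensor_relators R M B)"
        using inv rel by (blast intro: generate.inv)
      ultimately show ?case by simp
    next
      case (eng h1 h2)
      then show ?case using generate.eng[of h1 ?F _ h2] by simp
    qed
  qed
  have cF: "c \<in> carrier ?F" using c GF by blast
  have "?K #>\<^bsub>?F\<^esub> d = ?K #>\<^bsub>?F\<^esub> c" if d: "d \<in> ?L #>\<^bsub>?G\<^esub> c" for d
  proof -
    obtain l where "l \<in> ?L" "d = l \<otimes>\<^bsub>?G\<^esub> c"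
      using d unfolding r_coset_def by blast
    then have "l \<in> ?K" "d = l \<otimes>\<^bsub>?F\<^esub> c"
      using LK by auto
    then have "d \<in> ?K #>\<^bsub>?F\<^esub> c"
      unfolding r_coset_def by blast
    from group.repr_independence[OF group_free_Abelian_group this cF K]
    show ?thesis by (rule sym)
  qed
  moreover have "c \<in> ?L #>\<^bsub>?G\<^esub> c"
    using group.rcos_self[OF group_free_Abelian_group c L] .
  ultimately show ?thesis
    unfolding tensor_inclusion_def by blast
qed


section \<open>Test ideals\<close>

definition module_closure ::
    "('a, 'c) ring_scheme \<Rightarrow> ('a, 'm) module \<Rightarrow> 'n set \<Rightarrow> ('a, 'n) module \<Rightarrow> 'n set" where
  "module_closure R M A B =
     {b \<in> carrier B. \<forall>x \<in> carrier M.
        pure_tensor R M B x b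
          \<in> tensor_inclusion R M B ` carrier (tensor_product R M (B\<lparr>carrier := A\<rparr>))}"

definition module_colon ::
    "('a, 'c) ring_scheme \<Rightarrow> ('a, 'n) module \<Rightarrow> 'n set \<Rightarrow> 'n set \<Rightarrow> 'a set" where
  "module_colon R B A C = {r \<in> carrier R. \<forall>c \<in> C. r \<odot>\<^bsub>B\<^esub> c \<in> A}"

text \<open>
  HOL cannot quantify over all modules at once, only over those whose elements are taken from
  a given type. The type argument \<open>'u\<close> is this universe. If \<open>R\<close> is infinite, a universe with
  at least as many elements as \<open>R\<close> contains a copy of every finitely generated \<open>R\<close>-module, so it
  is large enough for the maximal Cohen-Macaulay modules.
\<close>

definition test_ideal ::
    "'u itself \<Rightarrow> ('a, 'c) ring_scheme \<Rightarrow> ('a, 'm) module \<Rightarrow> 'a set" where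
  "test_ideal _ R M =
     {r \<in> carrier R. \<forall>(B :: ('a, 'u) module) A. module R B \<and> submodule A R B \<longrightarrow>
        r \<in> module_colon R B A (module_closure R M A B)}"

definition MCM_test_ideal :: "'u itself \<Rightarrow> ('a, 'c) ring_scheme \<Rightarrow> 'a set" where
  "MCM_test_ideal U R =
     {r \<in> carrier R. \<forall>M :: ('a, 'u) module. MCM_module R M \<longrightarrow> r \<in> test_ideal U R M}"


section \<open>The hypersurface ring\<close>

text \<open>
  Power series in three variables are iterated univariate ones: the type \<open>'k fps fps fps\<close> is
  \<open>k[[x]][[y]][[z]]\<close>, the last variable being the outermost one.
\<close>

definition ps_x :: "'k::comm_ring_1 fps fps fps" where
  "ps_x = fps_const (fps_const fps_X)"

definition ps_y :: "'k::comm_ring_1 fps fps fps" where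
  "ps_y = fps_const fps_X"

definition ps_z :: "'k::comm_ring_1 fps fps fps" where
  "ps_z = fps_X"

definition hypersurface_ideal :: "'k::comm_ring_1 fps fps fps set" where
  "hypersurface_ideal = Idl\<^bsub>ring_of_type_algebra\<^esub> {ps_z ^ 2 + ps_x ^ 3 + ps_y ^ 4}"

definition hypersurface_ring :: "'k::comm_ring_1 fps fps fps set ring" where
  "hypersurface_ring = ring_of_type_algebra Quot hypersurface_ideal"

definition residue_class :: "'k::comm_ring_1 fps fps fps \<Rightarrow> 'k fps fps fps set" where
  "residue_class p = hypersurface_ideal +>\<^bsub>ring_of_type_algebra\<^esub> p"

end

theory Submission
  imports Defs
begin

text \<open>
  Let \<open>S = k[[x, y]]\<close> and \<open>g = x\<^sup>3 + y\<^sup>4\<close>, so that \<open>R\<close> is free over \<open>S\<close> with basis \<open>1, z\<close>, and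
  \<open>z\<^sup>2 = -g\<close>. The theorem follows without the classification of the maximal Cohen-Macaulay modules
  over \<open>R\<close>, from what such a module is over \<open>S\<close>.

  Every test ideal contains \<open>x\<close>, \<open>y\<^sup>2\<close> and \<open>z\<close>. The values of the linear forms on \<open>M\<close> belong to the
  test ideal of \<open>M\<close> (\<open>linear_form_value_in_test_ideal\<close>). A maximal Cohen-Macaulay module is free over
  \<open>S\<close> (\<open>MCM_free\<close>), hence it is given by the matrix \<open>\<phi>\<close> of the multiplication by \<open>z\<close>, which satisfies
  \<open>\<phi>\<^sup>2 = -g\<close>. The coordinates with respect to a basis provide linear forms with the values
  \<open>\<phi>\<^sub>i\<^sub>j + \<delta>\<^sub>i\<^sub>j z\<close>. An ideal \<open>J\<close> containing these elements contains \<open>x\<close>, \<open>y\<^sup>2\<close> and \<open>z\<close>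
  (\<open>ideal_of_matrix_factorization\<close>): by Nakayama's lemma, this can be checked modulo
  \<open>(x, y, z) (x, y\<^sup>2, z)\<close>, where it becomes a statement of linear algebra about the coefficient matrices of
  \<open>\<phi>\<close>. The equation \<open>\<phi>\<^sup>2 = -g\<close> prescribes their anticommutators. As \<open>2 \<noteq> 0\<close> in \<open>k\<close>, this leaves no room
  for a linear relation.

  Conversely, choose \<open>i\<close> with \<open>i\<^sup>2 = -1\<close>. The ideal \<open>M = (x, z + i y\<^sup>2)\<close> is maximal Cohen-Macaulay
  (\<open>module_xw_MCM\<close>). As \<open>y\<^sup>2 M \<subseteq> (x, z) M\<close>, the element \<open>y\<^sup>2\<close> lies in the closure of \<open>(x, z)\<close> in \<open>R\<close> with
  respect to \<open>M\<close>. So an element \<open>r\<close> of the test ideal of \<open>M\<close> satisfies \<open>r y\<^sup>2 \<in> (x, z)\<close>. The quotient of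
  \<open>R\<close> by \<open>(x, z)\<close> is \<open>k[y]/(y\<^sup>4)\<close>, and it follows that \<open>r \<in> (x, y\<^sup>2, z)\<close>.

  Both parts require the dimension of \<open>R\<close>, which is two. A regular sequence of length two on \<open>M\<close> gives the
  lower bound, because the length of a regular sequence on any module is at most the dimension
  (\<open>regular_sequence_length_le_krull_dim\<close>). For the upper bound, primes are contracted to \<open>S\<close>, and
  division with remainder in \<open>k[[x]][[y]]\<close> shows that a prime strictly above a nonzero prime of \<open>S\<close>
  contains \<open>x\<close> and \<open>y\<close>. The same division proves that the ideals of \<open>S\<close> are finitely generated. This
  enters through Nakayama's lemma in the proof that a module of depth two is free over \<open>S\<close>.
\<close>

section \<open>Regular sequences and chains of primes\<close>

lemma (in cring) ideal_of_closed:
  assumes sub: "I \<subseteq> carrier R" and zero: "\<zero> \<in> I"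
    and add: "\<And>a b. a \<in> I \<Longrightarrow> b \<in> I \<Longrightarrow> a \<oplus> b \<in> I"
    and mult: "\<And>a r. a \<in> I \<Longrightarrow> r \<in> carrier R \<Longrightarrow> r \<otimes> a \<in> I"
  shows "ideal I R"
proof (rule idealI)
  show "ring R" by (rule ring_axioms)
  show "subgroup I (add_monoid R)"
  proof (rule subgroup.intro)
    fix a assume a: "a \<in> I"
    then have aR: "a \<in> carrier R" using sub by blast
    have "(\<ominus> \<one>) \<otimes> a \<in> I" using mult[OF a] by simp
    moreover have "(\<ominus> \<one>) \<otimes> a = \<ominus> a" using aR by (simp add: l_minus)
    ultimately show "inv\<^bsub>add_monoid R\<^esub> a \<in> I" by (simp add: a_inv_def)
  qed (use assms in auto)
  show "r \<otimes> a \<in> I" if "a \<in> I" "r \<in> carrier R" for a r by (rule mult[OF that])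
  show "a \<otimes> r \<in> I" if "a \<in> I" "r \<in> carrier R" for a r
    using mult[OF that] that sub m_comm by (metis subsetD)
qed

text \<open>Krull's construction: an ideal that is maximal among those containing \<open>I\<close> and missing the
  multiplicative set \<open>T\<close> is prime, because two larger ideals would each meet \<open>T\<close>, and the product
  of the two common elements would lie in \<open>T\<close> as well as in the ideal.\<close>

lemma (in cring) primeideal_avoiding:
  assumes I: "ideal I R" and T: "T \<subseteq> carrier R" "\<one> \<in> T"
    and Tm: "\<And>s t. s \<in> T \<Longrightarrow> t \<in> T \<Longrightarrow> s \<otimes> t \<in> T"
    and dis: "I \<inter> T = {}"
  obtains P where "primeideal P R" "I \<subseteq> P" "P \<inter> T = {}"
proof -
  define F where "F = {J. ideal J R \<and> I \<subseteq> J \<and> J \<inter> T = {}}"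
  have "\<exists>P\<in>F. \<forall>J\<in>F. P \<subseteq> J \<longrightarrow> J = P"
  proof (rule subset_Zorn)
    fix C assume C: "subset.chain F C"
    show "\<exists>U\<in>F. \<forall>J\<in>C. J \<subseteq> U"
    proof (cases "C = {}")
      case True
      then show ?thesis using I dis by (auto simp: F_def)
    next
      case False
      have CF: "C \<subseteq> F" using C by (simp add: pred_on.chain_def)
      have "subset.chain {J. ideal J R} C"
        using C unfolding pred_on.chain_def F_def by auto
      then have "ideal (\<Union>C) R" using chain_Union_is_ideal[of C] False by simp
      moreover have "I \<subseteq> \<Union>C" using False CF by (fastforce simp: F_def)
      moreover have "\<Union>C \<inter> T = {}" using CF by (fastforce simp: F_def)
      ultimately show ?thesis by (auto simp: F_def)
    qed
  qed
  then obtain P where P: "ideal P R" "I \<subseteq> P" "P \<inter> T = {}"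
    and mx: "\<And>J. ideal J R \<Longrightarrow> P \<subseteq> J \<Longrightarrow> J \<inter> T = {} \<Longrightarrow> J = P"
    unfolding F_def by (auto 0 4)
  interpret P: ideal P R by fact
  have meet: "\<exists>p\<in>P. \<exists>r\<in>carrier R. p \<oplus> r \<otimes> a \<in> T" if a: "a \<in> carrier R" "a \<notin> P" for a
  proof (rule ccontr)
    assume neg: "\<not> ?thesis"
    let ?J = "P <+>\<^bsub>R\<^esub> PIdl a"
    have J: "ideal ?J R" by (intro add_ideals P(1) cgenideal_ideal a(1))
    have elem: "u \<in> ?J \<longleftrightarrow> (\<exists>p\<in>P. \<exists>r\<in>carrier R. u = p \<oplus> r \<otimes> a)" for u
      by (auto simp: set_add_def' cgenideal_def)
    have "P \<subseteq> ?J"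
    proof
      fix p assume "p \<in> P"
      then have "p = p \<oplus> \<zero> \<otimes> a" using a by (simp add: P.a_Hcarr)
      then show "p \<in> ?J" unfolding elem using \<open>p \<in> P\<close> by blast
    qed
    moreover have "?J \<inter> T = {}" using neg unfolding disjoint_iff elem by blast
    ultimately have "?J = P" by (rule mx[OF J])
    moreover have "a = \<zero> \<oplus> \<one> \<otimes> a" using a by simp
    then have "a \<in> ?J" unfolding elem using P.zero_closed by blast
    ultimately show False using a by simp
  qed
  have "primeideal P R"
  proof (rule primeidealI[OF P(1) is_cring])
    show "carrier R \<noteq> P" using T P(3) by blast
    fix a b assume ab: "a \<in> carrier R" "b \<in> carrier R" "a \<otimes> b \<in> P"
    show "a \<in> P \<or> b \<in> P"
    proof (rule ccontr)
      assume "\<not> ?thesis"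
      then obtain p r q s where pr: "p \<in> P" "r \<in> carrier R" "p \<oplus> r \<otimes> a \<in> T"
        and qs: "q \<in> P" "s \<in> carrier R" "q \<oplus> s \<otimes> b \<in> T"
        using meet[OF ab(1)] meet[OF ab(2)] by blast
      have c: "p \<in> carrier R" "q \<in> carrier R" using pr qs P.a_Hcarr by auto
      have "(p \<oplus> r \<otimes> a) \<otimes> (q \<oplus> s \<otimes> b) = (q \<oplus> s \<otimes> b) \<otimes> p \<oplus> (r \<otimes> a \<otimes> q \<oplus> (r \<otimes> s) \<otimes> (a \<otimes> b))"
        using ab pr(2) qs(2) c by algebra
      moreover have "\<dots> \<in> P"
        by (rule P.a_closed[OF P.I_l_closed[OF pr(1)] P.a_closed[OF P.I_l_closed[OF qs(1)] P.I_l_closed[OF ab(3)]]])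
           (use ab pr(2) qs(2) c in auto)
      ultimately show False using Tm[OF pr(3) qs(3)] P(3) by auto
    qed
  qed
  then show thesis using that P by blast
qed

context
  fixes R :: "('a, 'c) ring_scheme" (structure) and M :: "('a, 'b) module"
  assumes module: "module R M"
begin

interpretation module R M by (rule module)

lemma submodule_span_submodule:
  assumes S: "S \<subseteq> carrier M"
  shows "submodule (submodule_span R M S) R M"
proof (rule submoduleI)
  show "submodule_span R M S \<subseteq> carrier M"
    unfolding submodule_span_def using carrier_is_submodule S by blast
  show "\<zero>\<^bsub>M\<^esub> \<in> submodule_span R M S"
    unfolding submodule_span_def using subgroup.one_closed submodule.axioms(1) by fastforce
  show "\<ominus>\<^bsub>M\<^esub> a \<in> submodule_span R M S" if "a \<in> submodule_span R M S" for a
    using that unfolding submodule_span_def by (auto intro: submoduleE)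
  show "a \<oplus>\<^bsub>M\<^esub> b \<in> submodule_span R M S" if "a \<in> submodule_span R M S" "b \<in> submodule_span R M S" for a b
    using that unfolding submodule_span_def by (auto intro: submoduleE)
  show "a \<odot>\<^bsub>M\<^esub> b \<in> submodule_span R M S" if "a \<in> carrier R" "b \<in> submodule_span R M S" for a b
    using that unfolding submodule_span_def by (auto intro: submoduleE)
qed

lemma submodule_span_superset: "S \<subseteq> submodule_span R M S"
  unfolding submodule_span_def by blast

lemma submodule_span_least: "submodule N R M \<Longrightarrow> S \<subseteq> N \<Longrightarrow> submodule_span R M S \<subseteq> N"
  unfolding submodule_span_def by blast

lemma submodule_zero: "submodule N R M \<Longrightarrow> \<zero>\<^bsub>M\<^esub> \<in> N"
  using subgroup.one_closed submodule.axioms(1) by fastforce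

lemma ideal_smult_submodule:
  assumes "I \<subseteq> carrier R"
  shows "submodule (ideal_smult R I M) R M"
  unfolding ideal_smult_def using assms by (intro submodule_span_submodule) auto

lemma ideal_smult_mem: "r \<in> I \<Longrightarrow> m \<in> carrier M \<Longrightarrow> r \<odot>\<^bsub>M\<^esub> m \<in> ideal_smult R I M"
  unfolding ideal_smult_def by (rule subsetD[OF submodule_span_superset]) auto

lemma ideal_smult_least:
  assumes "submodule N R M" "\<And>r m. r \<in> I \<Longrightarrow> m \<in> carrier M \<Longrightarrow> r \<odot>\<^bsub>M\<^esub> m \<in> N"
  shows "ideal_smult R I M \<subseteq> N"
  unfolding ideal_smult_def using assms by (intro submodule_span_least) auto

lemma ideal_smult_mono: "I \<subseteq> J \<Longrightarrow> ideal_smult R I M \<subseteq> ideal_smult R J M"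
  unfolding ideal_smult_def submodule_span_def by blast

lemma annihilator_mod_ideal:
  assumes N: "submodule N R M"
  shows "ideal {r \<in> carrier R. \<forall>m\<in>carrier M. r \<odot>\<^bsub>M\<^esub> m \<in> N} R"
  by (rule R.ideal_of_closed)
     (auto simp: submodule_zero[OF N] smult_l_distr smult_assoc1 submoduleE[OF N])

lemma ideal_smult_genideal_least:
  assumes N: "submodule N R M" and Y: "Y \<subseteq> carrier R"
    and m: "\<And>r m. r \<in> Y \<Longrightarrow> m \<in> carrier M \<Longrightarrow> r \<odot>\<^bsub>M\<^esub> m \<in> N"
  shows "ideal_smult R (Idl Y) M \<subseteq> N"
proof (rule ideal_smult_least[OF N])
  have "Idl Y \<subseteq> {r \<in> carrier R. \<forall>m\<in>carrier M. r \<odot>\<^bsub>M\<^esub> m \<in> N}"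
    using m Y by (intro R.genideal_minimal annihilator_mod_ideal[OF N]) auto
  then show "\<And>r m. r \<in> Idl Y \<Longrightarrow> m \<in> carrier M \<Longrightarrow> r \<odot>\<^bsub>M\<^esub> m \<in> N" by blast
qed

lemma ideal_smult_empty: "ideal_smult R (Idl {}) M = {\<zero>\<^bsub>M\<^esub>}"
proof -
  have "submodule {\<zero>\<^bsub>M\<^esub>} R M" by (rule submoduleI) auto
  then have "ideal_smult R (Idl {}) M \<subseteq> {\<zero>\<^bsub>M\<^esub>}"
    by (rule ideal_smult_genideal_least) auto
  moreover have "submodule (ideal_smult R (Idl {}) M) R M"
    by (intro ideal_smult_submodule) (simp add: R.genideal_ideal additive_subgroup.a_subset ideal.axioms(1))
  ultimately show ?thesis using submodule_zero by fastforce
qed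

lemma smult_image_submodule:
  assumes r: "r \<in> carrier R"
  shows "submodule ((\<lambda>m. r \<odot>\<^bsub>M\<^esub> m) ` carrier M) R M"
proof (rule submoduleI)
  show "\<zero>\<^bsub>M\<^esub> \<in> (\<lambda>m. r \<odot>\<^bsub>M\<^esub> m) ` carrier M"
    by (rule image_eqI[where x="\<zero>\<^bsub>M\<^esub>"]) (use r in auto)
  show "\<ominus>\<^bsub>M\<^esub> a \<in> (\<lambda>m. r \<odot>\<^bsub>M\<^esub> m) ` carrier M" if a: "a \<in> (\<lambda>m. r \<odot>\<^bsub>M\<^esub> m) ` carrier M" for a
  proof -
    obtain m where "m \<in> carrier M" "a = r \<odot>\<^bsub>M\<^esub> m" using a by auto
    then have "\<ominus>\<^bsub>M\<^esub> a = r \<odot>\<^bsub>M\<^esub> (\<ominus>\<^bsub>M\<^esub> m)" "\<ominus>\<^bsub>M\<^esub> m \<in> carrier M"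
      using r smult_r_minus by auto
    then show ?thesis by blast
  qed
  show "a \<oplus>\<^bsub>M\<^esub> b \<in> (\<lambda>m. r \<odot>\<^bsub>M\<^esub> m) ` carrier M"
    if "a \<in> (\<lambda>m. r \<odot>\<^bsub>M\<^esub> m) ` carrier M" "b \<in> (\<lambda>m. r \<odot>\<^bsub>M\<^esub> m) ` carrier M" for a b
    using that r by (auto simp: smult_r_distr[symmetric])
  show "s \<odot>\<^bsub>M\<^esub> a \<in> (\<lambda>m. r \<odot>\<^bsub>M\<^esub> m) ` carrier M"
    if s: "s \<in> carrier R" and a: "a \<in> (\<lambda>m. r \<odot>\<^bsub>M\<^esub> m) ` carrier M" for a s
  proof -
    obtain m where "m \<in> carrier M" "a = r \<odot>\<^bsub>M\<^esub> m" using a by auto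
    then have "s \<odot>\<^bsub>M\<^esub> a = r \<odot>\<^bsub>M\<^esub> (s \<odot>\<^bsub>M\<^esub> m)" "s \<odot>\<^bsub>M\<^esub> m \<in> carrier M"
      using r s by (auto simp: smult_assoc1[symmetric] R.m_comm)
    then show ?thesis by blast
  qed
qed (use r in auto)

lemma genideal_self_mem: "r \<in> Y \<Longrightarrow> Y \<subseteq> carrier R \<Longrightarrow> r \<in> Idl Y"
  using R.genideal_self by blast

lemma ideal_smult_singleton:
  assumes r: "r \<in> carrier R"
  shows "ideal_smult R (Idl {r}) M = (\<lambda>m. r \<odot>\<^bsub>M\<^esub> m) ` carrier M"
proof
  show "ideal_smult R (Idl {r}) M \<subseteq> (\<lambda>m. r \<odot>\<^bsub>M\<^esub> m) ` carrier M"
    by (rule ideal_smult_genideal_least[OF smult_image_submodule[OF r]]) (use r in auto)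
  show "(\<lambda>m. r \<odot>\<^bsub>M\<^esub> m) ` carrier M \<subseteq> ideal_smult R (Idl {r}) M"
    using r by (auto intro!: ideal_smult_mem genideal_self_mem)
qed

text \<open>Going down one step. Suppose that \<open>r\<close> is a non-zerodivisor on \<open>M/N\<close>, and that \<open>r\<close> lies in a
  prime \<open>P\<close> containing the annihilator of \<open>M/N\<close>. The products \<open>r\<^sup>n s\<close> with \<open>s \<notin> P\<close> are not in that
  annihilator, since otherwise \<open>s\<close> would be. So there is a prime over the annihilator avoiding all
  of them: it is contained in \<open>P\<close> and misses \<open>r\<close>.\<close>

lemma nonzerodivisor_smaller_prime:
  assumes N: "submodule N R M" and reg: "nonzerodivisor_mod R M N r"
    and P: "primeideal P R" and rP: "r \<in> P"
    and ann: "{s \<in> carrier R. \<forall>m\<in>carrier M. s \<odot>\<^bsub>M\<^esub> m \<in> N} \<subseteq> P"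
  obtains Q where "primeideal Q R" "Q \<subset> P"
    "{s \<in> carrier R. \<forall>m\<in>carrier M. s \<odot>\<^bsub>M\<^esub> m \<in> N} \<subseteq> Q"
proof -
  interpret P: primeideal P R by fact
  have r: "r \<in> carrier R" using reg by (simp add: nonzerodivisor_mod_def)
  let ?T = "{r [^]\<^bsub>R\<^esub> (n::nat) \<otimes> s | n s. s \<in> carrier R - P}"
  let ?A = "{s \<in> carrier R. \<forall>m\<in>carrier M. s \<odot>\<^bsub>M\<^esub> m \<in> N}"
  have oneP: "\<one> \<notin> P" using P.I_notcarr P.one_imp_carrier by blast
  have pow: "m \<in> N" if "m \<in> carrier M" "r [^]\<^bsub>R\<^esub> (n::nat) \<odot>\<^bsub>M\<^esub> m \<in> N" for m n
    using that
  proof (induction n arbitrary: m)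
    case (Suc n)
    have "r [^]\<^bsub>R\<^esub> n \<odot>\<^bsub>M\<^esub> (r \<odot>\<^bsub>M\<^esub> m) \<in> N"
      using Suc.prems r by (simp add: smult_assoc1)
    then have "r \<odot>\<^bsub>M\<^esub> m \<in> N" using Suc r by blast
    then show ?case using reg Suc.prems by (simp add: nonzerodivisor_mod_def)
  qed simp
  obtain Q where Q: "primeideal Q R" "?A \<subseteq> Q" "Q \<inter> ?T = {}"
  proof (rule R.primeideal_avoiding[of ?A ?T])
    show "ideal ?A R" by (rule annihilator_mod_ideal[OF N])
    show "?T \<subseteq> carrier R" using r by auto
    have "\<one> = r [^]\<^bsub>R\<^esub> (0::nat) \<otimes> \<one>" by simp
    then show "\<one> \<in> ?T" using oneP by blast
    show "s \<otimes> t \<in> ?T" if s: "s \<in> ?T" and t: "t \<in> ?T" for s t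
    proof -
      obtain n m :: nat and a b where s: "s = r [^]\<^bsub>R\<^esub> n \<otimes> a" "a \<in> carrier R - P" and t: "t = r [^]\<^bsub>R\<^esub> m \<otimes> b" "b \<in> carrier R - P"
        using s t by blast
      then have "s \<otimes> t = r [^]\<^bsub>R\<^esub> n \<otimes> r [^]\<^bsub>R\<^esub> m \<otimes> (a \<otimes> b)"
        using r by (simp add: R.m_ac)
      also have "r [^]\<^bsub>R\<^esub> n \<otimes> r [^]\<^bsub>R\<^esub> m = r [^]\<^bsub>R\<^esub> (n + m)" using r by (simp add: R.nat_pow_mult)
      finally have "s \<otimes> t = r [^]\<^bsub>R\<^esub> (n + m) \<otimes> (a \<otimes> b)" .
      moreover have "a \<otimes> b \<in> carrier R - P" using s t P.I_prime by auto
      ultimately show ?thesis by blast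
    qed
    show "?A \<inter> ?T = {}"
    proof -
      have False if "r [^]\<^bsub>R\<^esub> (n::nat) \<otimes> s \<in> ?A" and s: "s \<in> carrier R - P" for n s
      proof -
        have "s \<odot>\<^bsub>M\<^esub> m \<in> N" if m: "m \<in> carrier M" for m
        proof (rule pow[of _ n])
          show "r [^]\<^bsub>R\<^esub> n \<odot>\<^bsub>M\<^esub> (s \<odot>\<^bsub>M\<^esub> m) \<in> N"
            using \<open>r [^]\<^bsub>R\<^esub> n \<otimes> s \<in> ?A\<close> m s r by (auto simp: smult_assoc1)
        qed (use m s in auto)
        then show False using ann s by blast
      qed
      then show ?thesis by blast
    qed
  qed blast
  have "Q \<subseteq> P"
  proof
    fix q assume "q \<in> Q"
    then have qR: "q \<in> carrier R" using Q(1) by (meson ideal.Icarr primeideal.axioms(1))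
    have "q = r [^]\<^bsub>R\<^esub> (0::nat) \<otimes> q" using qR by simp
    then show "q \<in> P" using Q(3) \<open>q \<in> Q\<close> qR by blast
  qed
  moreover have "r \<notin> Q"
  proof -
    have "r = r [^]\<^bsub>R\<^esub> (1::nat) \<otimes> \<one>" using r by simp
    then have "r \<in> ?T" using oneP by blast
    then show ?thesis using Q(3) by blast
  qed
  ultimately show thesis using that Q rP by blast
qed

text \<open>Iterating the previous lemma along a regular sequence, from its end to its start, produces a
  strictly increasing chain of primes of the same length.\<close>

lemma regular_sequence_prime_chain:
  assumes reg: "regular_sequence R M xs"
  obtains P :: "nat \<Rightarrow> 'a set" where "\<forall>i\<le>length xs. primeideal (P i) R" "\<forall>i<length xs. P i \<subset> P (Suc i)"
proof -
  have xs: "set xs \<subseteq> carrier R" using reg by (simp add: regular_sequence_def)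
  define N where "N i = ideal_smult R (Idl (set (take i xs))) M" for i
  define A where "A i = {s \<in> carrier R. \<forall>m\<in>carrier M. s \<odot>\<^bsub>M\<^esub> m \<in> N i}" for i
  have txs: "set (take i xs) \<subseteq> carrier R" for i using xs set_take_subset by fast
  have Idlc: "Idl Y \<subseteq> carrier R" if "Y \<subseteq> carrier R" for Y
    using R.genideal_ideal[OF that] by (simp add: additive_subgroup.a_subset ideal.axioms(1))
  have N: "submodule (N i) R M" for i
    unfolding N_def by (intro ideal_smult_submodule Idlc txs)
  have step: "\<exists>P. (\<forall>j\<le>i. primeideal (P j) R) \<and> (\<forall>j<i. P j \<subset> P (Suc j)) \<and> P i = Q"
    if "primeideal Q R" "A i \<subseteq> Q" "i \<le> length xs" for i and Q :: "'a set"
    using that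
  proof (induction i arbitrary: Q)
    case 0
    then show ?case by (intro exI[of _ "\<lambda>_. Q"]) auto
  next
    case (Suc i)
    have i: "i < length xs" using Suc.prems by simp
    let ?r = "xs ! i"
    have mono: "N i \<subseteq> N (Suc i)"
      unfolding N_def using i txs[of "Suc i"]
      by (intro ideal_smult_mono R.subset_Idl_subset) (auto simp: take_Suc_conv_app_nth)
    then have "A i \<subseteq> A (Suc i)" unfolding A_def by blast
    moreover have "?r \<in> A (Suc i)"
    proof -
      have "?r \<in> Idl (set (take (Suc i) xs))"
        by (rule genideal_self_mem[OF _ txs]) (simp add: take_Suc_conv_app_nth[OF i])
      then show ?thesis
        unfolding A_def N_def using i xs by (auto intro: ideal_smult_mem)
    qed
    ultimately have "?r \<in> Q" "A i \<subseteq> Q" using Suc.prems by auto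
    moreover have "nonzerodivisor_mod R M (N i) ?r"
      using reg i by (simp add: regular_sequence_def N_def)
    ultimately obtain Q' where Q': "primeideal Q' R" "Q' \<subset> Q" "A i \<subseteq> Q'"
      using nonzerodivisor_smaller_prime[OF N[of i] _ Suc.prems(1)] unfolding A_def by blast
    then obtain P where P: "\<forall>j\<le>i. primeideal (P j) R" "\<forall>j<i. P j \<subset> P (Suc j)" "P i = Q'"
      using Suc.IH[OF Q'(1,3)] i by auto
    show ?case
      by (rule exI[of _ "P(Suc i := Q)"])
         (use P Q' Suc.prems in \<open>auto simp: le_Suc_eq less_Suc_eq\<close>)
  qed
  have "\<one> \<notin> A (length xs)"
  proof
    assume "\<one> \<in> A (length xs)"
    then have "carrier M \<subseteq> N (length xs)" unfolding A_def by auto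
    moreover have "N (length xs) \<subseteq> carrier M" using N submoduleE(1) by blast
    ultimately have "N (length xs) = carrier M" by blast
    then show False using reg by (simp add: regular_sequence_def N_def)
  qed
  then obtain Q where "primeideal Q R" "A (length xs) \<subseteq> Q"
    using R.primeideal_avoiding[of "A (length xs)" "{\<one>}"] annihilator_mod_ideal[OF N[of "length xs"]]
    unfolding A_def[symmetric] by (auto simp: A_def)
  from step[OF this] that show thesis by auto
qed

lemma regular_sequence_length_le_krull_dim:
  assumes "regular_sequence R M xs"
  shows "enat (length xs) \<le> krull_dim R"
proof -
  obtain P :: "nat \<Rightarrow> 'a set" where "\<forall>i\<le>length xs. primeideal (P i) R" "\<forall>i<length xs. P i \<subset> P (Suc i)"
    by (rule regular_sequence_prime_chain[OF assms])
  then show ?thesis unfolding krull_dim_def by (intro Sup_upper) auto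
qed

end

section \<open>Linear forms and closures in tensor products\<close>

context
  fixes R :: "('a, 'c) ring_scheme" and M :: "('a, 'm) module" and B :: "('a, 'n) module"
  assumes M: "module R M" and B: "module R B"
begin

interpretation M: module R M by (rule M)
interpretation B: module R B by (rule B)

lemma tensor_kernel_subgroup: "subgroup (tensor_kernel R M B) (free_on_pairs M B)"
  unfolding tensor_kernel_def
  by (rule group.generate_is_subgroup[OF group_free_Abelian_group tensor_relators_carrier[OF M B]])

lemma tensor_kernel_add: "c \<in> tensor_kernel R M B \<Longrightarrow> d \<in> tensor_kernel R M B \<Longrightarrow> c + d \<in> tensor_kernel R M B"
  using subgroup.m_closed[OF tensor_kernel_subgroup, of c d] by simp

lemma tensor_kernel_uminus: "c \<in> tensor_kernel R M B \<Longrightarrow> - c \<in> tensor_kernel R M B"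
  using subgroup.m_inv_closed[OF tensor_kernel_subgroup, of c]
    subgroup.mem_carrier[OF tensor_kernel_subgroup, of c] by simp

lemma tensor_kernel_diff: "c \<in> tensor_kernel R M B \<Longrightarrow> d \<in> tensor_kernel R M B \<Longrightarrow> c - d \<in> tensor_kernel R M B"
  using tensor_kernel_add[of c "- d"] tensor_kernel_uminus[of d] by simp

lemma tensor_relator_in_kernel: "c \<in> tensor_relators R M B \<Longrightarrow> c \<in> tensor_kernel R M B"
  unfolding tensor_kernel_def by (rule generate.incl)

lemma pure_tensor_in_inclusion_iff:
  assumes A: "submodule A R B" and m: "m \<in> carrier M" and b: "b \<in> carrier B"
  shows "pure_tensor R M B m b \<in> tensor_inclusion R M B ` carrier (tensor_product R M (B\<lparr>carrier := A\<rparr>))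
    \<longleftrightarrow> (\<exists>c. Poly_Mapping.keys c \<subseteq> carrier M \<times> A \<and> frag_of (m, b) - c \<in> tensor_kernel R M B)"
    (is "?L \<longleftrightarrow> ?R")
proof -
  let ?A = "B\<lparr>carrier := A\<rparr>"
  let ?F = "free_on_pairs M B" and ?K = "tensor_kernel R M B"
  have AB: "A \<subseteq> carrier B" by (rule B.submoduleE(1)[OF A])
  have car: "carrier (tensor_product R M ?A) =
      {tensor_kernel R M ?A #>\<^bsub>free_on_pairs M ?A\<^esub> c | c. c \<in> carrier (free_on_pairs M ?A)}"
    by (auto simp: tensor_product_def FactGroup_def RCOSETS_def)
  have eq: "pure_tensor R M B m b = ?K #>\<^bsub>?F\<^esub> c \<longleftrightarrow> frag_of (m, b) - c \<in> ?K"
    if c: "Poly_Mapping.keys c \<subseteq> carrier M \<times> A" for c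
  proof -
    have cF: "c \<in> carrier ?F" "frag_of (m, b) \<in> carrier ?F" using c AB m b by auto
    have "?K #>\<^bsub>?F\<^esub> frag_of (m, b) = ?K #>\<^bsub>?F\<^esub> c \<longleftrightarrow> frag_of (m, b) \<in> ?K #>\<^bsub>?F\<^esub> c"
      using group.repr_independence[OF group_free_Abelian_group _ cF(1) tensor_kernel_subgroup]
        group.rcos_self[OF group_free_Abelian_group cF(2) tensor_kernel_subgroup] by auto
    also have "\<dots> \<longleftrightarrow> frag_of (m, b) - c \<in> ?K"
      by (force simp: r_coset_def)
    finally show ?thesis by (simp add: pure_tensor_def)
  qed
  have "?L \<longleftrightarrow> (\<exists>c \<in> carrier (free_on_pairs M ?A). pure_tensor R M B m b = ?K #>\<^bsub>?F\<^esub> c)"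
    
  proof
    assume ?L
    then show "\<exists>c \<in> carrier (free_on_pairs M ?A). pure_tensor R M B m b = ?K #>\<^bsub>?F\<^esub> c"
      unfolding car using tensor_inclusion_class[OF M B A] by auto
  next
    assume "\<exists>c \<in> carrier (free_on_pairs M ?A). pure_tensor R M B m b = ?K #>\<^bsub>?F\<^esub> c"
    then obtain c where c: "c \<in> carrier (free_on_pairs M ?A)" "pure_tensor R M B m b = ?K #>\<^bsub>?F\<^esub> c"
      by blast
    show ?L
      unfolding c(2) tensor_inclusion_class[OF M B A c(1), symmetric] car using c(1) by blast
  qed
  also have "\<dots> \<longleftrightarrow> ?R"
    unfolding Bex_def by (rule arg_cong[where f=Ex], rule ext) (use eq in auto)
  finally show ?thesis .
qed

text \<open>A linear form \<open>h\<close> on \<open>M\<close> induces a map from \<open>M \<otimes> B\<close> to \<open>B\<close>, sending \<open>m \<otimes> b\<close> to \<open>h(m) b\<close>, and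
  it maps the image of \<open>M \<otimes> A\<close> into \<open>A\<close>. Hence \<open>h(m)\<close> multiplies the closure of \<open>A\<close> into \<open>A\<close>.\<close>

lemma linear_form_value_multiplies_closure:
  assumes hc: "\<And>m. m \<in> carrier M \<Longrightarrow> h m \<in> carrier R"
    and ha: "\<And>m m'. m \<in> carrier M \<Longrightarrow> m' \<in> carrier M \<Longrightarrow> h (m \<oplus>\<^bsub>M\<^esub> m') = h m \<oplus>\<^bsub>R\<^esub> h m'"
    and hs: "\<And>r m. r \<in> carrier R \<Longrightarrow> m \<in> carrier M \<Longrightarrow> h (r \<odot>\<^bsub>M\<^esub> m) = r \<otimes>\<^bsub>R\<^esub> h m"
    and A: "submodule A R B" and m: "m \<in> carrier M" and b: "b \<in> module_closure R M A B"
  shows "h m \<odot>\<^bsub>B\<^esub> b \<in> A"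
proof -
  let ?F = "free_on_pairs M B"
  let ?e = "\<lambda>(m, n). h m \<odot>\<^bsub>B\<^esub> n"
  have bB: "b \<in> carrier B" using b by (simp add: module_closure_def)
  have "?e ` (carrier M \<times> carrier B) \<subseteq> carrier (add_monoid B)" using hc by auto
  then obtain H where H: "H \<in> hom ?F (add_monoid B)"
    and Hf: "\<And>p. p \<in> carrier M \<times> carrier B \<Longrightarrow> H (frag_of p) = ?e p"
    using comm_group.free_Abelian_group_universal[OF B.a_comm_group] by metis
  interpret H: group_hom ?F "add_monoid B" H
    using H B.a_group by (simp add: group_hom_def group_hom_axioms_def)
  have Hc: "H c \<in> carrier B" if "Poly_Mapping.keys c \<subseteq> carrier M \<times> carrier B" for c
    using H.hom_closed[of c] that by simp
  have Hm: "H (- c) = \<ominus>\<^bsub>B\<^esub> H c" if "Poly_Mapping.keys c \<subseteq> carrier M \<times> carrier B" for c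
    using H.hom_inv[of c] that by (simp add: a_inv_def)
  have Hd: "H (c - d) = H c \<ominus>\<^bsub>B\<^esub> H d"
    if "Poly_Mapping.keys c \<subseteq> carrier M \<times> carrier B" "Poly_Mapping.keys d \<subseteq> carrier M \<times> carrier B" for c d
    using H.hom_mult[of c "- d"] that Hm[OF that(2)] by (simp add: a_minus_def)
  have dk: "Poly_Mapping.keys (c - d) \<subseteq> Y"
    if "Poly_Mapping.keys c \<subseteq> Y" "Poly_Mapping.keys d \<subseteq> Y"
    for c d :: "'m \<times> 'n \<Rightarrow>\<^sub>0 int" and Y
    using that keys_diff[of c d] by blast
  have rel: "H c = \<zero>\<^bsub>B\<^esub>" if "c \<in> tensor_relators R M B" for c
    using that unfolding tensor_relators_def
  proof (elim UnE CollectE exE conjE)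
    fix m m' n assume c: "c = frag_of (m \<oplus>\<^bsub>M\<^esub> m', n) - frag_of (m, n) - frag_of (m', n)"
      and mn: "m \<in> carrier M" "m' \<in> carrier M" "n \<in> carrier B"
    have "H c = (h m \<oplus>\<^bsub>R\<^esub> h m') \<odot>\<^bsub>B\<^esub> n \<ominus>\<^bsub>B\<^esub> h m \<odot>\<^bsub>B\<^esub> n \<ominus>\<^bsub>B\<^esub> h m' \<odot>\<^bsub>B\<^esub> n"
      unfolding c using mn by (simp add: Hd dk Hf ha)
    then show ?thesis using mn hc by (simp add: B.smult_l_distr B.minus_eq B.a_ac B.r_neg)
  next
    fix m n n' assume c: "c = frag_of (m, n \<oplus>\<^bsub>B\<^esub> n') - frag_of (m, n) - frag_of (m, n')"
      and mn: "m \<in> carrier M" "n \<in> carrier B" "n' \<in> carrier B"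
    have "H c = h m \<odot>\<^bsub>B\<^esub> (n \<oplus>\<^bsub>B\<^esub> n') \<ominus>\<^bsub>B\<^esub> h m \<odot>\<^bsub>B\<^esub> n \<ominus>\<^bsub>B\<^esub> h m \<odot>\<^bsub>B\<^esub> n'"
      unfolding c using mn by (simp add: Hd dk Hf)
    then show ?thesis using mn hc by (simp add: B.smult_r_distr B.minus_eq B.a_ac B.r_neg)
  next
    fix r m n assume c: "c = frag_of (r \<odot>\<^bsub>M\<^esub> m, n) - frag_of (m, r \<odot>\<^bsub>B\<^esub> n)"
      and mn: "r \<in> carrier R" "m \<in> carrier M" "n \<in> carrier B"
    have "H c = (r \<otimes>\<^bsub>R\<^esub> h m) \<odot>\<^bsub>B\<^esub> n \<ominus>\<^bsub>B\<^esub> h m \<odot>\<^bsub>B\<^esub> (r \<odot>\<^bsub>B\<^esub> n)"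
      unfolding c using mn by (simp add: Hd dk Hf hs)
    then show ?thesis using mn hc
      by (simp add: B.smult_assoc1[symmetric] M.R.m_comm[of r] B.minus_eq B.r_neg)
  qed
  have "tensor_kernel R M B \<subseteq> kernel ?F (add_monoid B) H"
    unfolding tensor_kernel_def
  proof (rule group.generate_subgroup_incl[OF group_free_Abelian_group])
    show "tensor_relators R M B \<subseteq> kernel ?F (add_monoid B) H"
      using rel subsetD[OF tensor_relators_carrier[OF M B]]
      by (auto simp: kernel_def simp del: carrier_free_Abelian_group_iff)
    show "subgroup (kernel ?F (add_monoid B) H) ?F" by (rule H.subgroup_kernel)
  qed
  then have ker: "H c = \<zero>\<^bsub>B\<^esub>" if "c \<in> tensor_kernel R M B" for c
    using that by (auto simp: kernel_def)
  have HA: "H c \<in> A" if "Poly_Mapping.keys c \<subseteq> carrier M \<times> A" for c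
    using that
  proof (rule free_Abelian_group_induct)
    have "H 0 = \<zero>\<^bsub>B\<^esub>" using H.hom_one by simp
    then show "H 0 \<in> A" using submodule_zero[OF B A] by simp
  next
    fix c d assume cd: "Poly_Mapping.keys c \<subseteq> carrier M \<times> A" "Poly_Mapping.keys d \<subseteq> carrier M \<times> A"
      "H c \<in> A" "H d \<in> A"
    have "Poly_Mapping.keys c \<subseteq> carrier M \<times> carrier B" "Poly_Mapping.keys d \<subseteq> carrier M \<times> carrier B"
      using cd(1,2) B.submoduleE(1)[OF A] by auto
    then show "H (c - d) \<in> A" using cd by (simp add: Hd B.minus_eq B.submoduleE[OF A])
  next
    fix p assume "p \<in> carrier M \<times> A"
    then show "H (frag_of p) \<in> A" using Hf[of p] B.submoduleE(1,4)[OF A] hc by auto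
  qed
  obtain c where c: "Poly_Mapping.keys c \<subseteq> carrier M \<times> A" "frag_of (m, b) - c \<in> tensor_kernel R M B"
    using b m pure_tensor_in_inclusion_iff[OF A m bB] by (auto simp: module_closure_def)
  have ck: "Poly_Mapping.keys c \<subseteq> carrier M \<times> carrier B"
    using c(1) B.submoduleE(1)[OF A] by auto
  have fk: "Poly_Mapping.keys (frag_of (m, b)) \<subseteq> carrier M \<times> carrier B" using m bB by simp
  have "H (frag_of (m, b)) \<ominus>\<^bsub>B\<^esub> H c = \<zero>\<^bsub>B\<^esub>" using ker[OF c(2)] Hd[OF fk ck] by simp
  then have "H (frag_of (m, b)) = H c" using Hc[OF ck] Hc[OF fk] B.minus_equality[of "H (frag_of (m, b))" "\<ominus>\<^bsub>B\<^esub> H c"]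
    by (simp add: B.minus_eq)
  then show ?thesis using HA[OF c(1)] Hf[of "(m, b)"] m bB by simp
qed

text \<open>In \<open>M \<otimes> B\<close>, a scalar can be moved from the second factor to the first. This gives
  \<open>m \<otimes> \<beta> u = \<alpha>\<^sub>1 m\<^sub>1 \<otimes> u + \<alpha>\<^sub>2 m\<^sub>2 \<otimes> u = m\<^sub>1 \<otimes> \<alpha>\<^sub>1 u + m\<^sub>2 \<otimes> \<alpha>\<^sub>2 u\<close>.\<close>

lemma smult_mem_module_closure:
  assumes A: "submodule A R B" and u: "u \<in> carrier B" and \<beta>: "\<beta> \<in> carrier R"
    and \<alpha>: "\<alpha>\<^sub>1 \<in> carrier R" "\<alpha>\<^sub>2 \<in> carrier R"
    and \<alpha>A: "\<alpha>\<^sub>1 \<odot>\<^bsub>B\<^esub> u \<in> A" "\<alpha>\<^sub>2 \<odot>\<^bsub>B\<^esub> u \<in> A"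
    and ex: "\<And>m. m \<in> carrier M \<Longrightarrow>
      \<exists>m\<^sub>1\<in>carrier M. \<exists>m\<^sub>2\<in>carrier M. \<beta> \<odot>\<^bsub>M\<^esub> m = \<alpha>\<^sub>1 \<odot>\<^bsub>M\<^esub> m\<^sub>1 \<oplus>\<^bsub>M\<^esub> \<alpha>\<^sub>2 \<odot>\<^bsub>M\<^esub> m\<^sub>2"
  shows "\<beta> \<odot>\<^bsub>B\<^esub> u \<in> module_closure R M A B"
proof -
  have "pure_tensor R M B m (\<beta> \<odot>\<^bsub>B\<^esub> u)
      \<in> tensor_inclusion R M B ` carrier (tensor_product R M (B\<lparr>carrier := A\<rparr>))"
    if m: "m \<in> carrier M" for m
  proof -
    obtain m\<^sub>1 m\<^sub>2 where m12: "m\<^sub>1 \<in> carrier M" "m\<^sub>2 \<in> carrier M"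
      and eq: "\<beta> \<odot>\<^bsub>M\<^esub> m = \<alpha>\<^sub>1 \<odot>\<^bsub>M\<^esub> m\<^sub>1 \<oplus>\<^bsub>M\<^esub> \<alpha>\<^sub>2 \<odot>\<^bsub>M\<^esub> m\<^sub>2"
      using ex[OF m] by blast
    let ?K = "tensor_kernel R M B"
    let ?c = "frag_of (m\<^sub>1, \<alpha>\<^sub>1 \<odot>\<^bsub>B\<^esub> u) + frag_of (m\<^sub>2, \<alpha>\<^sub>2 \<odot>\<^bsub>B\<^esub> u)"
    have bal: "frag_of (r \<odot>\<^bsub>M\<^esub> n, u) - frag_of (n, r \<odot>\<^bsub>B\<^esub> u) \<in> ?K"
      if "r \<in> carrier R" "n \<in> carrier M" for r n
      using that u by (intro tensor_relator_in_kernel) (auto simp: tensor_relators_def)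
    have add: "frag_of (n \<oplus>\<^bsub>M\<^esub> n', u) - frag_of (n, u) - frag_of (n', u) \<in> ?K"
      if "n \<in> carrier M" "n' \<in> carrier M" for n n'
      using that u by (intro tensor_relator_in_kernel) (auto simp: tensor_relators_def)
    have k1: "frag_of (\<beta> \<odot>\<^bsub>M\<^esub> m, u) - frag_of (m, \<beta> \<odot>\<^bsub>B\<^esub> u) \<in> ?K" by (rule bal[OF \<beta> m])
    have k2: "frag_of (\<beta> \<odot>\<^bsub>M\<^esub> m, u) - frag_of (\<alpha>\<^sub>1 \<odot>\<^bsub>M\<^esub> m\<^sub>1, u) - frag_of (\<alpha>\<^sub>2 \<odot>\<^bsub>M\<^esub> m\<^sub>2, u) \<in> ?K"
      unfolding eq by (rule add) (use \<alpha> m12 in auto)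
    note k3 = bal[OF \<alpha>(1) m12(1)] and k4 = bal[OF \<alpha>(2) m12(2)]
    have "frag_of (m, \<beta> \<odot>\<^bsub>B\<^esub> u) - ?c
      = (frag_of (\<beta> \<odot>\<^bsub>M\<^esub> m, u) - frag_of (\<alpha>\<^sub>1 \<odot>\<^bsub>M\<^esub> m\<^sub>1, u) - frag_of (\<alpha>\<^sub>2 \<odot>\<^bsub>M\<^esub> m\<^sub>2, u))
        + (frag_of (\<alpha>\<^sub>1 \<odot>\<^bsub>M\<^esub> m\<^sub>1, u) - frag_of (m\<^sub>1, \<alpha>\<^sub>1 \<odot>\<^bsub>B\<^esub> u))
        + (frag_of (\<alpha>\<^sub>2 \<odot>\<^bsub>M\<^esub> m\<^sub>2, u) - frag_of (m\<^sub>2, \<alpha>\<^sub>2 \<odot>\<^bsub>B\<^esub> u))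
        - (frag_of (\<beta> \<odot>\<^bsub>M\<^esub> m, u) - frag_of (m, \<beta> \<odot>\<^bsub>B\<^esub> u))"
      by (simp add: algebra_simps)
    also have "\<dots> \<in> ?K"
      by (intro tensor_kernel_diff[OF _ k1] tensor_kernel_add[OF tensor_kernel_add[OF k2 k3] k4])
    finally have "frag_of (m, \<beta> \<odot>\<^bsub>B\<^esub> u) - ?c \<in> ?K" .
    moreover have "Poly_Mapping.keys ?c \<subseteq> carrier M \<times> A"
      using keys_add[of "frag_of (m\<^sub>1, \<alpha>\<^sub>1 \<odot>\<^bsub>B\<^esub> u)" "frag_of (m\<^sub>2, \<alpha>\<^sub>2 \<odot>\<^bsub>B\<^esub> u)"] m12 \<alpha>A
      by auto
    ultimately show ?thesis
      using pure_tensor_in_inclusion_iff[OF A m, of "\<beta> \<odot>\<^bsub>B\<^esub> u"] u \<beta> by auto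
  qed
  then show ?thesis using u \<beta> by (simp add: module_closure_def)
qed

end

lemma linear_form_value_in_test_ideal:
  fixes R :: "('a, 'c) ring_scheme" and M :: "('a, 'm) module"
  assumes M: "module R M"
    and h: "\<And>m. m \<in> carrier M \<Longrightarrow> h m \<in> carrier R"
      "\<And>m m'. m \<in> carrier M \<Longrightarrow> m' \<in> carrier M \<Longrightarrow> h (m \<oplus>\<^bsub>M\<^esub> m') = h m \<oplus>\<^bsub>R\<^esub> h m'"
      "\<And>r m. r \<in> carrier R \<Longrightarrow> m \<in> carrier M \<Longrightarrow> h (r \<odot>\<^bsub>M\<^esub> m) = r \<otimes>\<^bsub>R\<^esub> h m"
    and m: "m \<in> carrier M"
  shows "h m \<in> test_ideal TYPE('u) R M"
  unfolding test_ideal_def module_colon_def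
  using h(1)[OF m] linear_form_value_multiplies_closure[OF M _ h _ m] by auto

lemma test_ideal_ideal:
  fixes R :: "('a, 'c) ring_scheme" and M :: "('a, 'm) module"
  assumes "cring R"
  shows "ideal (test_ideal TYPE('u) R M) R"
proof -
  interpret cring R by fact
  have cl: "c \<in> carrier B" if "c \<in> module_closure R M A B" for c and B :: "('a, 'u) module" and A
    using that by (simp add: module_closure_def)
  show ?thesis
  proof (rule ideal_of_closed)
    show "\<zero>\<^bsub>R\<^esub> \<in> test_ideal TYPE('u) R M"
      unfolding test_ideal_def module_colon_def
      by (auto simp: module.smult_l_null[OF _ cl] submodule_zero)
    show "a \<oplus>\<^bsub>R\<^esub> b \<in> test_ideal TYPE('u) R M"
      if "a \<in> test_ideal TYPE('u) R M" "b \<in> test_ideal TYPE('u) R M" for a b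
      using that unfolding test_ideal_def module_colon_def
      by (auto simp: module.smult_l_distr[OF _ _ _ cl] module.submoduleE)
    show "r \<otimes>\<^bsub>R\<^esub> a \<in> test_ideal TYPE('u) R M"
      if "a \<in> test_ideal TYPE('u) R M" "r \<in> carrier R" for a r
      using that unfolding test_ideal_def module_colon_def
      by (auto simp: module.smult_assoc1[OF _ _ _ cl] module.submoduleE)
  qed (auto simp: test_ideal_def)
qed

section \<open>Power series in two variables\<close>

text \<open>The ideals of a ring that is a type are its submodules as a module over itself.\<close>

interpretation type_ideal: Modules.module "(*) :: 'a::comm_ring_1 \<Rightarrow> 'a \<Rightarrow> 'a"
  by standard (simp_all add: algebra_simps)

text \<open>As a rewrite rule, this is the associativity of the product from right to left, which loops
  together with the usual orientation.\<close>

declare type_ideal.scale_scale [simp del]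

abbreviation is_type_ideal :: "'a::comm_ring_1 set \<Rightarrow> bool" where
  "is_type_ideal \<equiv> type_ideal.subspace"

definition is_type_prime :: "'a::comm_ring_1 set \<Rightarrow> bool" where
  "is_type_prime P \<longleftrightarrow> is_type_ideal P \<and> 1 \<notin> P \<and> (\<forall>a b. a * b \<in> P \<longrightarrow> a \<in> P \<or> b \<in> P)"

lemmas type_ideal_add = type_ideal.subspace_add
  and type_ideal_diff = type_ideal.subspace_diff
  and type_ideal_mult = type_ideal.subspace_scale

lemma type_ideal_mult_right: "is_type_ideal I \<Longrightarrow> a \<in> I \<Longrightarrow> a * c \<in> I"
  using type_ideal_mult[of I a c] by (simp add: mult.commute)

lemma type_prime_power: "is_type_prime P \<Longrightarrow> a ^ n \<in> P \<Longrightarrow> a \<in> P"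
  by (induction n) (auto simp: is_type_prime_def)

lemma fps2_unit:
  fixes h :: "'k::field fps fps"
  assumes "h $ 0 $ 0 \<noteq> 0"
  obtains g where "h * g = 1"
proof -
  obtain y where "1 = h $ 0 * y" using fps_unit_dvd_left[OF assms] by blast
  then show thesis using fps_right_inverse[of h y] that by simp
qed

lemma type_prime_no_unit: "is_type_prime P \<Longrightarrow> a * b = 1 \<Longrightarrow> a \<notin> P"
  using type_ideal_mult_right[of P a b] by (auto simp: is_type_prime_def)

lemma fps_X_power_times_shift:
  fixes h :: "'a::comm_ring_1 fps"
  assumes "\<And>i. i < m \<Longrightarrow> h $ i = 0"
  shows "h = fps_X ^ m * fps_shift m h"
  by (rule fps_ext) (use assms in \<open>auto simp: fps_X_power_mult_nth\<close>)

lemma fps_division: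
  fixes u :: "'k::field fps"
  assumes "u \<noteq> 0"
  shows "s = ((s - fps_cutoff (subdegree u) s) div u) * u + fps_cutoff (subdegree u) s"
proof -
  have "u dvd s - fps_cutoff (subdegree u) s"
  proof (cases "s - fps_cutoff (subdegree u) s = 0")
    case False
    have "subdegree u \<le> subdegree (s - fps_cutoff (subdegree u) s)"
      by (rule subdegree_geI[OF False]) simp
    then show ?thesis using fps_dvd_iff[OF assms False] by blast
  qed simp
  then show ?thesis by simp
qed

fun weierstrass_quotient :: "'k::field fps fps \<Rightarrow> 'k fps fps \<Rightarrow> nat \<Rightarrow> 'k fps" where
  "weierstrass_quotient h s j =
     (let c = s $ j - (\<Sum>i<j. weierstrass_quotient h s i * h $ (j - i))
      in (c - fps_cutoff (subdegree (h $ 0)) c) div (h $ 0))"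

declare weierstrass_quotient.simps [simp del]

text \<open>Division with remainder in \<open>k[[x]][[y]]\<close> by a series \<open>h\<close> with \<open>h(x, 0) \<noteq> 0\<close>. The coefficients of
  the quotient with respect to \<open>y\<close> are found one after the other, each by a division by
  \<open>h(x, 0)\<close> in \<open>k[[x]]\<close>. The remainder is a polynomial in \<open>x\<close> with coefficients in \<open>k[[y]]\<close>.\<close>

lemma weierstrass_division:
  fixes h :: "'k::field fps fps"
  assumes "h $ 0 \<noteq> 0"
  obtains q r where "s = q * h + r" "\<And>j i. subdegree (h $ 0) \<le> i \<Longrightarrow> r $ j $ i = 0"
proof -
  define q where "q = Abs_fps (weierstrass_quotient h s)"
  define r where "r = s - q * h"
  have "r $ j $ i = 0" if "subdegree (h $ 0) \<le> i" for i j
  proof -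
    define c where "c = s $ j - (\<Sum>i<j. q $ i * h $ (j - i))"
    have "q $ j = (c - fps_cutoff (subdegree (h $ 0)) c) div (h $ 0)"
      unfolding q_def c_def by (subst (1) fps_nth_Abs_fps, subst weierstrass_quotient.simps) (simp add: Let_def)
    moreover have "r $ j = c - q $ j * h $ 0"
      unfolding r_def c_def by (simp add: fps_mult_nth atLeast0AtMost lessThan_Suc_atMost[symmetric])
    ultimately have "r $ j = fps_cutoff (subdegree (h $ 0)) c"
      using fps_division[OF assms, of c] by (metis add_diff_cancel_left')
    then show ?thesis using that by simp
  qed
  moreover have "s = q * h + r" by (simp add: r_def)
  ultimately show thesis using that by blast
qed

text \<open>Gaussian elimination without division: the last coordinate is cleared by cross-multiplication
  with a pivot \<open>p\<close>.\<close>

lemma linear_dependence_idom: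
  fixes v :: "'i \<Rightarrow> nat \<Rightarrow> 't::idom"
  assumes "finite I" "card I > d"
  shows "\<exists>c. (\<exists>i\<in>I. c i \<noteq> 0) \<and> (\<forall>j<d. (\<Sum>i\<in>I. c i * v i j) = 0)"
  using assms
proof (induction d arbitrary: I v)
  case 0
  then show ?case by (intro exI[of _ "\<lambda>_. 1"]) (auto simp: card_gt_0_iff)
next
  case (Suc d)
  show ?case
  proof (cases "\<forall>i\<in>I. v i d = 0")
    case True
    obtain c where "\<exists>i\<in>I. c i \<noteq> 0" "\<forall>j<d. (\<Sum>i\<in>I. c i * v i j) = 0"
      using Suc.IH[OF Suc.prems(1), of v] Suc.prems(2) by auto
    then show ?thesis using True by (intro exI[of _ c]) (auto simp: less_Suc_eq)
  next
    case False
    then obtain p where p: "p \<in> I" "v p d \<noteq> 0" by blast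
    let ?I = "I - {p}"
    have "d < card ?I" using Suc.prems p by simp
    then obtain c where c: "\<exists>i\<in>?I. c i \<noteq> 0"
      and cz: "\<And>j. j < d \<Longrightarrow> (\<Sum>i\<in>?I. c i * (v p d * v i j - v i d * v p j)) = 0"
      using Suc.IH[of ?I "\<lambda>i j. v p d * v i j - v i d * v p j"] Suc.prems(1) by blast
    define c' where "c' = (\<lambda>i. if i = p then - (\<Sum>i\<in>?I. c i * v i d) else c i * v p d)"
    have "(\<Sum>i\<in>I. c' i * v i j) = (\<Sum>i\<in>?I. c i * (v p d * v i j - v i d * v p j))" for j
    proof -
      have "(\<Sum>i\<in>I. c' i * v i j) = c' p * v p j + (\<Sum>i\<in>?I. c' i * v i j)"
        using sum.remove[OF Suc.prems(1) p(1)] by blast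
      also have "(\<Sum>i\<in>?I. c' i * v i j) = (\<Sum>i\<in>?I. c i * v p d * v i j)"
        by (rule sum.cong) (auto simp: c'_def)
      also have "c' p * v p j + \<dots> = (\<Sum>i\<in>?I. c i * v p d * v i j - c i * v i d * v p j)"
        by (simp add: c'_def sum_distrib_right sum_subtractf)
      also have "\<dots> = (\<Sum>i\<in>?I. c i * (v p d * v i j - v i d * v p j))"
        by (rule sum.cong) (simp_all add: right_diff_distrib mult.assoc)
      finally show ?thesis .
    qed
    moreover have "(\<Sum>i\<in>?I. c i * (v p d * v i d - v i d * v p d)) = 0"
      by (simp add: mult.commute)
    ultimately have "\<forall>j<Suc d. (\<Sum>i\<in>I. c' i * v i j) = 0"
      using cz by (simp add: less_Suc_eq)
    moreover have "\<exists>i\<in>I. c' i \<noteq> 0" using c p by (auto simp: c'_def)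
    ultimately show ?thesis by blast
  qed
qed

text \<open>In \<open>k[[x]][[y]]\<close> the constants are the series in \<open>x\<close>. This is the other embedding, of \<open>k[[y]]\<close>.\<close>

definition series_in_y :: "'k::comm_ring_1 fps \<Rightarrow> 'k fps fps" where
  "series_in_y c = Abs_fps (\<lambda>j. fps_const (c $ j))"

lemma series_in_y_nth [simp]: "series_in_y c $ j = fps_const (c $ j)"
  by (simp add: series_in_y_def)

lemma series_in_y_mult_nth:
  "(series_in_y c * r) $ j $ l = (\<Sum>i=0..j. c $ i * r $ (j - i) $ l)"
  by (simp add: fps_mult_nth[of "series_in_y c" r j] fps_sum_nth)

text \<open>By division with remainder, \<open>k[[x, y]]/(h)\<close> is generated by \<open>1, x, \<dots>, x\<^bsup>d-1\<^esup>\<close> over \<open>k[[y]]\<close>, where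
  \<open>d\<close> is the order of \<open>h(x, 0)\<close>. So the \<open>d + 1\<close> first powers of any element are linearly dependent over \<open>k[[y]]\<close> modulo \<open>h\<close>.\<close>

lemma algebraic_relation_mod:
  fixes h q :: "'k::field fps fps"
  assumes "h $ 0 \<noteq> 0"
  obtains c d where "\<exists>i\<le>d. c i \<noteq> 0" "h dvd (\<Sum>i\<le>d. series_in_y (c i) * q ^ i)"
proof -
  define d where "d = subdegree (h $ 0)"
  have "\<exists>r. h dvd q ^ i - r \<and> (\<forall>j l. d \<le> l \<longrightarrow> r $ j $ l = 0)" for i
  proof -
    obtain t r where "q ^ i = t * h + r" "\<And>j l. subdegree (h $ 0) \<le> l \<Longrightarrow> r $ j $ l = 0"
      using weierstrass_division[OF assms] by metis
    then show ?thesis unfolding d_def by (intro exI[of _ r]) auto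
  qed
  then obtain r where r: "\<And>i. h dvd q ^ i - r i" "\<And>i j l. d \<le> l \<Longrightarrow> r i $ j $ l = 0"
    by metis
  obtain c where c: "\<exists>i\<in>{..d}. c i \<noteq> (0::'k fps)"
    and cz: "\<forall>l<d. (\<Sum>i\<le>d. c i * Abs_fps (\<lambda>j. r i $ j $ l)) = 0"
    using linear_dependence_idom[of "{..d}" d "\<lambda>i l. Abs_fps (\<lambda>j. r i $ j $ l)"] by auto
  have "(\<Sum>i\<le>d. series_in_y (c i) * r i) = 0"
  proof (intro fps_ext)
    fix j l
    show "(\<Sum>i\<le>d. series_in_y (c i) * r i) $ j $ l = 0 $ j $ l"
    proof (cases "l < d")
      case True
      then have "(\<Sum>i\<le>d. c i * Abs_fps (\<lambda>j. r i $ j $ l)) $ j = 0" using cz by simp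
      then show ?thesis by (simp add: fps_sum_nth series_in_y_mult_nth) (simp add: fps_sum_nth fps_mult_nth)
    next
      case False
      then show ?thesis by (simp add: fps_sum_nth series_in_y_mult_nth r(2))
    qed
  qed
  then have "(\<Sum>i\<le>d. series_in_y (c i) * q ^ i) = (\<Sum>i\<le>d. series_in_y (c i) * (q ^ i - r i))"
    by (simp add: algebra_simps sum_subtractf)
  also have "h dvd \<dots>" using r(1) by (intro dvd_sum dvd_mult) auto
  finally show thesis using c that[of d c] by auto
qed

lemma series_in_y_mem_prime:
  fixes c :: "'k::field fps"
  assumes P: "is_type_prime P" and c: "c \<noteq> 0" "series_in_y c \<in> P"
  shows "fps_X \<in> P"
proof -
  let ?m = "subdegree c"
  let ?u = "fps_shift ?m (series_in_y c)"
  have "series_in_y c = fps_X ^ ?m * ?u"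
  proof (rule fps_X_power_times_shift)
    show "series_in_y c $ i = 0" if "i < ?m" for i
      using nth_less_subdegree_zero[OF that] by simp
  qed
  moreover obtain w where "?u * w = 1"
    using fps2_unit[of ?u] c(1) by auto
  ultimately have "fps_X ^ ?m \<in> P"
    using P c(2) type_prime_no_unit unfolding is_type_prime_def by metis
  then show ?thesis using type_prime_power[OF P] by blast
qed

lemma fps_const_mem_prime:
  fixes a :: "'k::field fps"
  assumes P: "is_type_prime P" and a: "a \<noteq> 0" "fps_const a \<in> P"
  shows "fps_const fps_X \<in> P"
proof -
  let ?m = "subdegree a"
  have a0: "a = fps_X ^ ?m * unit_factor a" by (rule fps_unit_factor_decompose')
  have "fps_const a = fps_const fps_X ^ ?m * fps_const (unit_factor a)"
    by (subst a0) (simp add: fps_const_power)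
  moreover obtain w where "fps_const (unit_factor a) * w = 1"
    using fps2_unit[of "fps_const (unit_factor a)"] a(1) by auto
  ultimately have "fps_const fps_X ^ ?m \<in> P"
    using P a(2) type_prime_no_unit unfolding is_type_prime_def by metis
  then show ?thesis using type_prime_power[OF P] by blast
qed

lemma fps_nth_0_decompose: "h = fps_const (h $ 0) + fps_X * fps_shift 1 (h::'a::comm_ring_1 fps)"
  by (rule fps_ext) auto

lemma type_prime_drop_X:
  assumes P: "is_type_prime P" and X: "fps_X \<in> P" and h: "h \<in> P"
  shows "fps_const (h $ 0) \<in> P"
proof -
  have "is_type_ideal P" using P by (simp add: is_type_prime_def)
  then have "h - fps_X * fps_shift 1 h \<in> P" using X h
    by (intro type_ideal_diff type_ideal_mult_right)
  moreover have "h - fps_X * fps_shift 1 h = fps_const (h $ 0)"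
    using fps_nth_0_decompose[of h] by (metis add_diff_cancel_right')
  ultimately show ?thesis by simp
qed

text \<open>The ring \<open>k[[x, y]]\<close> has dimension at most two: a prime \<open>Q\<close> strictly above a nonzero prime \<open>P\<close>
  contains \<open>x\<close> and \<open>y\<close>. If \<open>y \<notin> P\<close>, then \<open>P\<close> contains some \<open>h\<close> with \<open>h(x, 0) \<noteq> 0\<close>, so an element \<open>q\<close> of \<open>Q\<close>
  outside \<open>P\<close> is algebraic over \<open>k[[y]]\<close> modulo \<open>P\<close>. After cancelling powers of \<open>q\<close>, the constant
  term of the relation is a nonzero series in \<open>y\<close> that belongs to \<open>Q\<close>.\<close>

lemma prime_above_nonzero_prime_fps2:
  fixes P Q :: "'k::field fps fps set"
  assumes P: "is_type_prime P" and Q: "is_type_prime Q" and PQ: "P \<subset> Q" and nz: "P \<noteq> {0}"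
  shows "fps_X \<in> Q \<and> fps_const fps_X \<in> Q"
proof -
  have iP: "is_type_ideal P" and iQ: "is_type_ideal Q" using P Q by (auto simp: is_type_prime_def)
  obtain q where q: "q \<in> Q" "q \<notin> P" using PQ by blast
  show ?thesis
  proof (cases "fps_X \<in> P")
    case True
    have "q $ 0 \<noteq> 0"
    proof
      assume "q $ 0 = 0"
      then have "q = fps_X * fps_shift 1 q" using fps_nth_0_decompose[of q] by simp
      then show False using q(2) type_ideal_mult_right[OF iP True] by metis
    qed
    moreover have "fps_const (q $ 0) \<in> Q" using True PQ q type_prime_drop_X[OF Q] by blast
    ultimately have "fps_const fps_X \<in> Q" using fps_const_mem_prime[OF Q] by blast
    then show ?thesis using True PQ by blast
  next
    case False
    obtain h0 where h0: "h0 \<in> P" "h0 \<noteq> 0" using nz type_ideal.subspace_0[OF iP] by blast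
    \<comment> \<open>Removing the powers of \<open>y\<close> from \<open>h0\<close> does not lead out of the prime \<open>P\<close>.\<close>
    define h where "h = unit_factor h0"
    have "h0 = fps_X ^ subdegree h0 * h" unfolding h_def by (rule fps_unit_factor_decompose')
    then have hP: "h \<in> P" using h0 P False type_prime_power[OF P] unfolding is_type_prime_def by metis
    have h_nz: "h $ 0 \<noteq> 0" unfolding h_def using h0(2) by (rule fps_unit_factor_nth_0)
    obtain c d where c: "\<exists>i\<le>d. c i \<noteq> 0" and rel: "h dvd (\<Sum>i\<le>d. series_in_y (c i) * q ^ i)"
      using algebraic_relation_mod[OF h_nz] by metis
    \<comment> \<open>The lowest nonzero coefficient becomes the constant term once \<open>q\<^sup>e\<close> is cancelled.\<close>
    define e where "e = (LEAST i. c i \<noteq> 0)"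
    have e: "c e \<noteq> 0" "\<And>i. i < e \<Longrightarrow> c i = 0" "e \<le> d"
    proof -
      obtain i where i: "i \<le> d" "c i \<noteq> 0" using c by blast
      show "c e \<noteq> 0" unfolding e_def by (rule LeastI[of "\<lambda>i. c i \<noteq> 0", OF i(2)])
      show "c j = 0" if "j < e" for j using not_less_Least that unfolding e_def by blast
      show "e \<le> d" unfolding e_def using Least_le[of "\<lambda>i. c i \<noteq> 0", OF i(2)] i(1) by simp
    qed
    have s0: "series_in_y 0 = (0::'k fps fps)" by (intro fps_ext) simp
    have "(\<Sum>i\<le>d. series_in_y (c i) * q ^ i) = (\<Sum>i\<in>{e..d}. series_in_y (c i) * q ^ i)"
      by (rule sum.mono_neutral_right) (auto simp: e(2) s0)
    also have "\<dots> = (\<Sum>i\<in>{e..d}. q ^ e * (series_in_y (c i) * q ^ (i - e)))"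
    proof (rule sum.cong)
      fix i assume "i \<in> {e..d}"
      then have "q ^ i = q ^ e * q ^ (i - e)" by (simp add: power_add[symmetric])
      then show "series_in_y (c i) * q ^ i = q ^ e * (series_in_y (c i) * q ^ (i - e))"
        by (simp only: mult.left_commute)
    qed simp
    also have "\<dots> = q ^ e * (\<Sum>i\<in>{e..d}. series_in_y (c i) * q ^ (i - e))"
      by (simp add: sum_distrib_left)
    finally have "q ^ e * (\<Sum>i\<in>{e..d}. series_in_y (c i) * q ^ (i - e)) \<in> P"
      using rel hP type_ideal_mult_right[OF iP] by (metis dvdE)
    then have "(\<Sum>i\<in>{e..d}. series_in_y (c i) * q ^ (i - e)) \<in> P"
      using P q(2) type_prime_power[OF P] unfolding is_type_prime_def by blast
    moreover have "(\<Sum>i\<in>{e..d}. series_in_y (c i) * q ^ (i - e)) =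
        series_in_y (c e) + (\<Sum>i\<in>{e<..d}. series_in_y (c i) * q ^ (i - e))"
    proof -
      have "{e..d} = insert e {e<..d}" using e(3) by auto
      then show ?thesis by simp
    qed
    moreover have tail: "(\<Sum>i\<in>{e<..d}. series_in_y (c i) * q ^ (i - e)) \<in> Q"
    proof (rule type_ideal.subspace_sum[OF iQ])
      fix i assume "i \<in> {e<..d}"
      then have "q ^ (i - e - 1) * q = q ^ (i - e)" by (intro power_minus_mult) simp
      moreover have "series_in_y (c i) * (q ^ (i - e - 1) * q) \<in> Q"
        by (intro type_ideal_mult[OF iQ] q(1))
      ultimately show "series_in_y (c i) * q ^ (i - e) \<in> Q" by simp
    qed
    ultimately have "series_in_y (c e) + (\<Sum>i\<in>{e<..d}. series_in_y (c i) * q ^ (i - e)) \<in> Q"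
      using PQ by auto
    from type_ideal_diff[OF iQ this tail] have "series_in_y (c e) \<in> Q" by simp
    then have X: "fps_X \<in> Q" by (rule series_in_y_mem_prime[OF Q e(1)])
    moreover have "fps_const (h $ 0) \<in> Q" using X hP PQ type_prime_drop_X[OF Q] by blast
    then have "fps_const fps_X \<in> Q" by (rule fps_const_mem_prime[OF Q h_nz])
    ultimately show ?thesis by blast
  qed
qed

lemma prime_chain_fps2_bound:
  fixes P :: "nat \<Rightarrow> 'k::field fps fps set"
  assumes pr: "\<And>i. i \<le> 3 \<Longrightarrow> is_type_prime (P i)"
    and ch: "\<And>i. i < 3 \<Longrightarrow> P i \<subset> P (Suc i)"
  shows False
proof -
  have ch': "P 0 \<subset> P 1" "P 1 \<subset> P 2" "P 2 \<subset> P 3" using ch[of 0] ch[of 1] ch[of 2] by (auto simp: eval_nat_numeral)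
  have "0 \<in> P 0" using pr[of 0] type_ideal.subspace_0 by (auto simp: is_type_prime_def)
  then have "P 1 \<noteq> {0}" using ch'(1) by (auto simp del: One_nat_def)
  then have X: "fps_X \<in> P 2" "fps_const fps_X \<in> P 2"
    using prime_above_nonzero_prime_fps2[of "P 1" "P 2"] pr ch' by auto
  obtain q where q: "q \<in> P 3" "q \<notin> P 2" using ch'(3) by blast
  have i2: "is_type_ideal (P 2)" using pr[of 2] by (simp add: is_type_prime_def)
  have "q $ 0 $ 0 \<noteq> 0"
  proof
    assume z: "q $ 0 $ 0 = 0"
    then have "q $ 0 = fps_X * fps_shift 1 (q $ 0)" using fps_nth_0_decompose[of "q $ 0"] by simp
    then have "q = fps_const fps_X * fps_const (fps_shift 1 (q $ 0)) + fps_X * fps_shift 1 q"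
      using fps_nth_0_decompose[of q] by (metis fps_const_mult)
    also have "\<dots> \<in> P 2"
      by (intro type_ideal_add[OF i2] type_ideal_mult_right[OF i2] X)
    finally show False using q(2) by simp
  qed
  then show False using fps2_unit[of q] type_prime_no_unit[OF pr[of 3]] q(1) by (metis order_refl)
qed

text \<open>Hilbert's basis theorem for \<open>k[[x]][[y]]\<close>. Among the nonzero elements of \<open>I\<close>, take \<open>g\<close> whose
  leading coefficient with respect to \<open>y\<close> has minimal order in \<open>x\<close>, and let \<open>y\<^sup>J\<close> be the corresponding
  power of \<open>y\<close>. Division with remainder by \<open>g\<close> shows that the elements of \<open>I\<close> divisible by \<open>y\<^sup>J\<close> are
  multiples of \<open>g\<close>; the lower powers of \<open>y\<close> require at most one further generator each.\<close>

lemma fps2_ideal_fin_gen: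
  fixes I :: "'k::field fps fps set"
  assumes I: "is_type_ideal I"
  obtains G where "finite G" "G \<subseteq> I" "I \<subseteq> type_ideal.span G"
proof (cases "I \<subseteq> {0}")
  case True
  then show thesis using that[of "{}"] by simp
next
  case False
  define lead_ord where "lead_ord = (\<lambda>a :: 'k fps fps. subdegree (a $ subdegree a))"
  obtain g where g: "g \<in> I" "g \<noteq> 0" and gmin: "\<And>a. a \<in> I \<Longrightarrow> a \<noteq> 0 \<Longrightarrow> lead_ord g \<le> lead_ord a"
    using False ex_has_least_nat[of "\<lambda>a. a \<in> I \<and> a \<noteq> 0" _ lead_ord] by blast
  define J where "J = subdegree g"
  define L where "L m = {s \<in> I. \<forall>i<m. s $ i = 0}" for m
  have base: "L J \<subseteq> type_ideal.span {g}"
  proof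
    fix s assume s: "s \<in> L J"
    let ?g = "fps_shift J g" and ?s = "fps_shift J s"
    have g0: "g = fps_X ^ J * ?g"
      unfolding J_def by (rule fps_X_power_times_shift) (rule nth_less_subdegree_zero)
    have s0: "s = fps_X ^ J * ?s" using s by (intro fps_X_power_times_shift) (simp add: L_def)
    have lead: "?g $ 0 = g $ subdegree g" by (simp add: J_def)
    have "?g $ 0 \<noteq> 0" using lead g(2) by simp
    then obtain q r where qr: "?s = q * ?g + r" "\<And>j i. subdegree (?g $ 0) \<le> i \<Longrightarrow> r $ j $ i = 0"
      using weierstrass_division[of ?g ?s] by metis
    have sr: "s - q * g = fps_X ^ J * r"
    proof -
      have "s = fps_X ^ J * (q * ?g + r)" using s0 qr(1) by simp
      also have "\<dots> = q * (fps_X ^ J * ?g) + fps_X ^ J * r" by (simp only: algebra_simps)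
      finally show ?thesis using g0 by simp
    qed
    have "r = 0"
    proof (rule ccontr)
      assume r: "r \<noteq> 0"
      let ?r = "fps_X ^ J * r"
      have "?r \<in> I" using sr s g(1) type_ideal_diff[OF I] type_ideal_mult[OF I] by (metis (no_types, lifting) L_def mem_Collect_eq)
      moreover have "?r \<noteq> 0" using r by simp
      ultimately have le: "lead_ord g \<le> lead_ord ?r" by (rule gmin)
      have "subdegree ?r = J + subdegree r" using r by (simp add: fps_X_power_subdegree)
      then have "?r $ subdegree ?r = r $ subdegree r" by (simp add: fps_X_power_mult_nth)
      then have "lead_ord ?r = subdegree (r $ subdegree r)" by (simp add: lead_ord_def)
      then have "subdegree (?g $ 0) \<le> subdegree (r $ subdegree r)"
        using le lead by (simp add: lead_ord_def)
      then have "r $ subdegree r $ subdegree (r $ subdegree r) = 0" by (rule qr(2))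
      then show False using r by simp
    qed
    then have "s = q * g" using sr by simp
    then show "s \<in> type_ideal.span {g}" by (simp add: type_ideal.span_base type_ideal.span_scale)
  qed
  have "\<exists>G. finite G \<and> G \<subseteq> I \<and> L (J - n) \<subseteq> type_ideal.span G" if "n \<le> J" for n
    using that
  proof (induction n)
    case 0
    then show ?case using base g(1) by (intro exI[of _ "{g}"]) auto
  next
    case (Suc n)
    obtain G where G: "finite G" "G \<subseteq> I" "L (J - n) \<subseteq> type_ideal.span G" using Suc by auto
    define m where "m = J - Suc n"
    have Jn: "J - n = Suc m" using Suc.prems by (simp add: m_def)
    show ?case
    proof (cases "\<exists>s\<in>L m. s $ m \<noteq> 0")
      case False
      then have "L m \<subseteq> L (Suc m)" by (auto simp: L_def less_Suc_eq)
      then show ?thesis using G unfolding Jn m_def[symmetric] by blast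
    next
      case True
      then obtain h where h: "h \<in> L m" "h $ m \<noteq> 0"
        and hmin: "\<And>a. a \<in> L m \<Longrightarrow> a $ m \<noteq> 0 \<Longrightarrow> subdegree (h $ m) \<le> subdegree (a $ m)"
        using ex_has_least_nat[of "\<lambda>a. a \<in> L m \<and> a $ m \<noteq> 0" _ "\<lambda>a. subdegree (a $ m)"] by blast
      have "L m \<subseteq> type_ideal.span (insert h G)"
      proof
        fix s assume s: "s \<in> L m"
        have "h $ m dvd s $ m"
          using hmin[OF s] fps_dvd_iff[OF h(2)] by (cases "s $ m = 0") auto
        then obtain c where c: "s $ m = h $ m * c" by (rule dvdE)
        let ?t = "s - fps_const c * h"
        have "?t \<in> I" using s h(1) type_ideal_diff[OF I] type_ideal_mult[OF I] by (simp add: L_def)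
        moreover have "?t $ i = 0" if "i < Suc m" for i
          using that s h(1) c by (auto simp: L_def less_Suc_eq)
        ultimately have "?t \<in> type_ideal.span (insert h G)"
          using subsetD[OF G(3), of ?t] Jn subsetD[OF type_ideal.span_mono[of G "insert h G"], of ?t]
          by (auto simp: L_def)
        moreover have "fps_const c * h \<in> type_ideal.span (insert h G)"
          by (intro type_ideal.span_scale type_ideal.span_base) simp
        ultimately show "s \<in> type_ideal.span (insert h G)"
          using type_ideal.span_add by fastforce
      qed
      then show ?thesis
        using G h(1) unfolding m_def[symmetric] by (intro exI[of _ "insert h G"]) (auto simp: L_def)
    qed
  qed
  from this[of J] obtain G where "finite G" "G \<subseteq> I" "L 0 \<subseteq> type_ideal.span G" by auto
  then show thesis using that by (auto simp: L_def)
qed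

section \<open>Modules with scalars in a type\<close>

text \<open>Modules over a ring that is a type. The group is a carrier set, but the scalars are
  elements of a type, so that computations with scalars are ordinary arithmetic.\<close>

locale type_module = abelian_group M for M :: "('m, 'b) ring_scheme" (structure) +
  fixes act :: "'s::comm_ring_1 \<Rightarrow> 'm \<Rightarrow> 'm" (infixr "\<bullet>" 75)
  assumes act_closed [simp, intro]: "m \<in> carrier M \<Longrightarrow> s \<bullet> m \<in> carrier M"
    and act_add_left: "m \<in> carrier M \<Longrightarrow> (s + t) \<bullet> m = s \<bullet> m \<oplus> t \<bullet> m"
    and act_add_right: "m \<in> carrier M \<Longrightarrow> n \<in> carrier M \<Longrightarrow> s \<bullet> (m \<oplus> n) = s \<bullet> m \<oplus> s \<bullet> n"
    and act_mult: "m \<in> carrier M \<Longrightarrow> (s * t) \<bullet> m = s \<bullet> t \<bullet> m"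
    and act_one [simp]: "m \<in> carrier M \<Longrightarrow> 1 \<bullet> m = m"
begin

lemma act_zero_left [simp]: "m \<in> carrier M \<Longrightarrow> 0 \<bullet> m = \<zero>"
  using act_add_left[of m 0 0] by simp

lemma act_zero_right [simp]: "s \<bullet> \<zero> = \<zero>"
  using act_add_right[of \<zero> \<zero> s] by simp

lemma act_minus_left: "m \<in> carrier M \<Longrightarrow> (- s) \<bullet> m = \<ominus> (s \<bullet> m)"
  using act_add_left[of m "- s" s] minus_equality[of "(- s) \<bullet> m" "s \<bullet> m"] by simp

lemma act_diff_left: "m \<in> carrier M \<Longrightarrow> (s - t) \<bullet> m = s \<bullet> m \<ominus> t \<bullet> m"
  using act_add_left[of m s "- t"] by (simp add: act_minus_left minus_eq)

lemma act_minus_right: "m \<in> carrier M \<Longrightarrow> s \<bullet> (\<ominus> m) = \<ominus> (s \<bullet> m)"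
  using act_mult[of m s "- 1"] act_minus_left[of m s] act_minus_left[of m 1] by simp

lemma act_diff_right: "m \<in> carrier M \<Longrightarrow> n \<in> carrier M \<Longrightarrow> s \<bullet> (m \<ominus> n) = s \<bullet> m \<ominus> s \<bullet> n"
  by (simp add: minus_eq act_add_right act_minus_right)

lemma act_left_commute: "m \<in> carrier M \<Longrightarrow> s \<bullet> t \<bullet> m = t \<bullet> s \<bullet> m"
  by (simp add: act_mult[symmetric] mult.commute)

lemma diff_eq_zero_iff: "m \<in> carrier M \<Longrightarrow> n \<in> carrier M \<Longrightarrow> m \<ominus> n = \<zero> \<longleftrightarrow> m = n"
  using minus_equality[of m "\<ominus> n"] by (auto simp: minus_eq r_neg)

lemma diff_add_cancel: "m \<in> carrier M \<Longrightarrow> n \<in> carrier M \<Longrightarrow> (m \<oplus> n) \<ominus> n = m"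
  by (simp add: minus_eq a_assoc r_neg)

lemma add_diff_cancel': "m \<in> carrier M \<Longrightarrow> n \<in> carrier M \<Longrightarrow> n \<oplus> (m \<ominus> n) = m"
  by (simp add: minus_eq a_lcomm r_neg)

definition act_submodule :: "'m set \<Rightarrow> bool" where
  "act_submodule N \<longleftrightarrow> N \<subseteq> carrier M \<and> \<zero> \<in> N \<and> (\<forall>m\<in>N. \<forall>n\<in>N. m \<oplus> n \<in> N) \<and> (\<forall>s. \<forall>m\<in>N. s \<bullet> m \<in> N)"

inductive_set combinations :: "'m set \<Rightarrow> 'm set" for G where
  comb_zero: "\<zero> \<in> combinations G"
| comb_step: "g \<in> G \<Longrightarrow> u \<in> combinations G \<Longrightarrow> s \<bullet> g \<oplus> u \<in> combinations G"

lemma act_submodule_minus: "act_submodule N \<Longrightarrow> m \<in> N \<Longrightarrow> \<ominus> m \<in> N"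
proof -
  assume N: "act_submodule N" and m: "m \<in> N"
  then have "m \<in> carrier M" "(- 1) \<bullet> m \<in> N" by (auto simp: act_submodule_def)
  then show ?thesis using act_minus_left[of m 1] by simp
qed

lemma act_submodule_diff: "act_submodule N \<Longrightarrow> m \<in> N \<Longrightarrow> n \<in> N \<Longrightarrow> m \<ominus> n \<in> N"
  using act_submodule_minus[of N n] by (auto simp: act_submodule_def minus_eq)

lemma combinations_least: "act_submodule N \<Longrightarrow> G \<subseteq> N \<Longrightarrow> combinations G \<subseteq> N"
proof
  fix u assume N: "act_submodule N" "G \<subseteq> N" and "u \<in> combinations G"
  from this(3) show "u \<in> N"
    by induction (use N in \<open>auto simp: act_submodule_def\<close>)
qed

lemma combinations_carrier: "G \<subseteq> carrier M \<Longrightarrow> combinations G \<subseteq> carrier M"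
  by (rule combinations_least) (auto simp: act_submodule_def)

lemma combinations_add:
  assumes G: "G \<subseteq> carrier M" and "u \<in> combinations G" "v \<in> combinations G"
  shows "u \<oplus> v \<in> combinations G"
  using assms(2)
proof induction
  case comb_zero
  then show ?case using assms combinations_carrier[OF G] by auto
next
  case (comb_step g u s)
  then have "s \<bullet> g \<oplus> u \<oplus> v = s \<bullet> g \<oplus> (u \<oplus> v)"
    using assms combinations_carrier[OF G] by (intro a_assoc) auto
  then show ?case using comb_step by (auto intro: combinations.comb_step)
qed

lemma combinations_act:
  assumes G: "G \<subseteq> carrier M" and "u \<in> combinations G"
  shows "t \<bullet> u \<in> combinations G"
  using assms(2)
proof induction
  case comb_zero
  then show ?case by (simp add: combinations.comb_zero)
next
  case (comb_step g u s)
  have "g \<in> carrier M" "u \<in> carrier M" using comb_step combinations_carrier[OF G] G by auto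
  then have "t \<bullet> (s \<bullet> g \<oplus> u) = (t * s) \<bullet> g \<oplus> t \<bullet> u"
    by (simp add: act_add_right act_mult)
  then show ?case using comb_step by (auto intro: combinations.comb_step)
qed

lemma combinations_submodule: "G \<subseteq> carrier M \<Longrightarrow> act_submodule (combinations G)"
  using combinations_carrier combinations_add combinations_act comb_zero
  by (auto simp: act_submodule_def)

lemma combinations_superset: "G \<subseteq> carrier M \<Longrightarrow> G \<subseteq> combinations G"
proof
  fix g assume "G \<subseteq> carrier M" "g \<in> G"
  then show "g \<in> combinations G" using comb_step[OF \<open>g \<in> G\<close> comb_zero, of 1] by auto
qed

lemma combinations_mono: "G \<subseteq> H \<Longrightarrow> H \<subseteq> carrier M \<Longrightarrow> combinations G \<subseteq> combinations H"
  by (rule combinations_least[OF combinations_submodule]) (use combinations_superset in blast)+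

lemma combinations_insertE:
  assumes G: "insert e G \<subseteq> carrier M" and u: "u \<in> combinations (insert e G)"
  obtains s v where "v \<in> combinations G" "u = s \<bullet> e \<oplus> v"
proof -
  have e: "e \<in> carrier M" and G': "G \<subseteq> carrier M" using G by auto
  have GC: "v \<in> carrier M" if "v \<in> combinations G" for v using that combinations_carrier[OF G'] by auto
  from u have "\<exists>s v. v \<in> combinations G \<and> u = s \<bullet> e \<oplus> v"
  proof induction
    case comb_zero
    have "\<zero> = 0 \<bullet> e \<oplus> \<zero>" using e by simp
    then show ?case using combinations.comb_zero by blast
  next
    case (comb_step g u t)
    then obtain s v where sv: "v \<in> combinations G" "u = s \<bullet> e \<oplus> v" by blast
    show ?case
    proof (cases "g = e")
      case True
      have "t \<bullet> g \<oplus> u = (t + s) \<bullet> e \<oplus> v"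
        using True sv e GC by (simp add: act_add_left a_assoc)
      then show ?thesis using sv by blast
    next
      case False
      then have g: "g \<in> G" "g \<in> carrier M" using comb_step G by auto
      have "t \<bullet> g \<oplus> u = s \<bullet> e \<oplus> (t \<bullet> g \<oplus> v)"
        using sv e GC g by (simp add: a_lcomm)
      then show ?thesis using combinations.comb_step[OF g(1) sv(1)] by blast
    qed
  qed
  then show thesis using that by blast
qed

text \<open>Over a ring whose ideals are finitely generated, submodules of finitely generated modules are
  finitely generated: the coefficients of the last generator \<open>e\<close> that occur in \<open>N\<close> form an ideal,
  and lifts of its generators reduce \<open>N\<close> to its intersection with the span of the others.\<close>

lemma submodule_fin_gen:
  assumes noeth: "\<And>I :: 's set. is_type_ideal I \<Longrightarrow> \<exists>H. finite H \<and> H \<subseteq> I \<and> I \<subseteq> type_ideal.span H"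
    and "finite G" "G \<subseteq> carrier M" "act_submodule N" "N \<subseteq> combinations G"
  shows "\<exists>D. finite D \<and> D \<subseteq> N \<and> N \<subseteq> combinations D"
  using assms(2-)
proof (induction G arbitrary: N rule: finite_induct)
  case empty
  have "combinations {} \<subseteq> {\<zero>}" by (rule combinations_least) (auto simp: act_submodule_def)
  then have "N \<subseteq> combinations {}" using empty by blast
  then show ?case by (intro exI[of _ "{}"]) auto
next
  case (insert e G)
  have e: "e \<in> carrier M" and G: "G \<subseteq> carrier M" using insert.prems by auto
  note subG = combinations_submodule[OF G]
  have GC: "v \<in> carrier M" if "v \<in> combinations G" for v using that combinations_carrier[OF G] by auto
  have NC: "N \<subseteq> carrier M" using insert.prems by (simp add: act_submodule_def)
  have N': "act_submodule (N \<inter> combinations G)"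
    using insert.prems(2) subG by (auto simp: act_submodule_def)
  obtain D where D: "finite D" "D \<subseteq> N" "N \<inter> combinations G \<subseteq> combinations D"
    using insert.IH[OF G N'] by blast
  define I where "I = {s. \<exists>v\<in>combinations G. s \<bullet> e \<oplus> v \<in> N}"
  have "is_type_ideal I"
    unfolding type_ideal.subspace_def
  proof (intro conjI ballI allI)
    have "0 \<bullet> e \<oplus> \<zero> \<in> N" using e insert.prems(2) by (simp add: act_submodule_def)
    then show "0 \<in> I" unfolding I_def using comb_zero by blast
  next
    fix s t assume "s \<in> I" "t \<in> I"
    then obtain v w where vw: "v \<in> combinations G" "s \<bullet> e \<oplus> v \<in> N" "w \<in> combinations G" "t \<bullet> e \<oplus> w \<in> N"
      unfolding I_def by blast
    have "(s + t) \<bullet> e \<oplus> (v \<oplus> w) = (s \<bullet> e \<oplus> v) \<oplus> (t \<bullet> e \<oplus> w)"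
      using e GC vw by (simp add: act_add_left a_ac)
    then have "(s + t) \<bullet> e \<oplus> (v \<oplus> w) \<in> N" using vw insert.prems(2) by (simp add: act_submodule_def)
    then show "s + t \<in> I" unfolding I_def using combinations_add[OF G] vw by blast
  next
    fix c s assume "s \<in> I"
    then obtain v where v: "v \<in> combinations G" "s \<bullet> e \<oplus> v \<in> N" unfolding I_def by blast
    have "(c * s) \<bullet> e \<oplus> c \<bullet> v = c \<bullet> (s \<bullet> e \<oplus> v)"
      using e GC v by (simp add: act_add_right act_mult)
    then have "(c * s) \<bullet> e \<oplus> c \<bullet> v \<in> N" using v insert.prems(2) by (simp add: act_submodule_def)
    then show "c * s \<in> I" unfolding I_def using combinations_act[OF G] v by blast
  qed
  then obtain H where H: "finite H" "H \<subseteq> I" "I \<subseteq> type_ideal.span H" using noeth by blast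
  have "\<forall>h\<in>H. \<exists>v. v \<in> combinations G \<and> h \<bullet> e \<oplus> v \<in> N" using H(2) unfolding I_def by blast
  then obtain w where w: "\<And>h. h \<in> H \<Longrightarrow> w h \<in> combinations G" "\<And>h. h \<in> H \<Longrightarrow> h \<bullet> e \<oplus> w h \<in> N"
    by metis
  let ?d = "\<lambda>h. h \<bullet> e \<oplus> w h"
  have dN: "?d ` H \<subseteq> N" using w by blast
  then have dC: "?d ` H \<subseteq> carrier M" using NC by blast
  note subD = combinations_submodule[OF dC]
  have lift: "\<exists>v\<in>combinations G. s \<bullet> e \<oplus> v \<in> combinations (?d ` H)" if "s \<in> type_ideal.span H" for s
    using that
  proof (induction rule: type_ideal.span_induct_alt)
    case base
    have "0 \<bullet> e \<oplus> \<zero> \<in> combinations (?d ` H)" using e comb_zero by simp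
    then show ?case using comb_zero by blast
  next
    case (step c h s)
    then obtain v where v: "v \<in> combinations G" "s \<bullet> e \<oplus> v \<in> combinations (?d ` H)" by blast
    have "(c * h + s) \<bullet> e \<oplus> (c \<bullet> w h \<oplus> v) = c \<bullet> ?d h \<oplus> (s \<bullet> e \<oplus> v)"
      using e GC[OF v(1)] GC[OF w(1)[OF step(1)]] by (simp add: act_add_left act_add_right act_mult a_ac)
    also have "\<dots> \<in> combinations (?d ` H)" by (rule comb_step) (use v step in auto)
    finally show ?case
      using combinations_add[OF G combinations_act[OF G w(1)[OF step(1)]] v(1)] by blast
  qed
  have "N \<subseteq> combinations (D \<union> ?d ` H)"
  proof
    fix n assume n: "n \<in> N"
    then obtain s v where sv: "v \<in> combinations G" "n = s \<bullet> e \<oplus> v"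
      using insert.prems combinations_insertE[of e G n] by blast
    then have "s \<in> I" unfolding I_def using n by blast
    then obtain v' where v': "v' \<in> combinations G" "s \<bullet> e \<oplus> v' \<in> combinations (?d ` H)"
      using lift H(3) by blast
    let ?u = "s \<bullet> e \<oplus> v'"
    have uN: "?u \<in> N" using v'(2) combinations_least[OF insert.prems(2) dN] by blast
    have "n \<ominus> ?u = v \<ominus> v'"
      using sv e GC v'(1) by (simp add: minus_eq minus_add a_ac r_neg2 r_neg r_neg1)
    then have "n \<ominus> ?u \<in> N \<inter> combinations G"
      using act_submodule_diff[OF insert.prems(2) n uN] act_submodule_diff[OF subG sv(1) v'(1)] by simp
    then have "n \<ominus> ?u \<in> combinations (D \<union> ?d ` H)"
      using D(3) combinations_mono[of D "D \<union> ?d ` H"] D(2) dN NC by blast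
    moreover have "?u \<in> combinations (D \<union> ?d ` H)"
      using v'(2) combinations_mono[of "?d ` H" "D \<union> ?d ` H"] D(2) dN NC by blast
    ultimately have "?u \<oplus> (n \<ominus> ?u) \<in> combinations (D \<union> ?d ` H)"
      using D(2) dN NC by (intro combinations_add[of _ ?u "n \<ominus> ?u"]) auto
    moreover have "?u \<oplus> (n \<ominus> ?u) = n" using n uN NC by (intro add_diff_cancel') auto
    ultimately show "n \<in> combinations (D \<union> ?d ` H)" by simp
  qed
  then show ?case using D H(1) dN by (intro exI[of _ "D \<union> ?d ` H"]) auto
qed

text \<open>If \<open>N = x N\<close>, then \<open>(1 - x s) e\<close> is a combination of the other generators for each generator
  \<open>e\<close>, with some \<open>s\<close>. So generators can be removed until none is left.\<close>

lemma nakayama: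
  assumes rad: "\<And>s. \<exists>t. (1 - x * s) * t = 1"
    and "finite D" and N: "act_submodule N" and "D \<subseteq> N" "N \<subseteq> combinations D"
    and div: "\<And>n. n \<in> N \<Longrightarrow> \<exists>n'\<in>N. n = x \<bullet> n'"
  shows "N \<subseteq> {\<zero>}"
  using assms(2,4,5)
proof (induction D rule: finite_induct)
  case empty
  have "combinations {} \<subseteq> {\<zero>}" by (rule combinations_least) (auto simp: act_submodule_def)
  then show ?case using empty by blast
next
  case (insert e D)
  have C: "insert e D \<subseteq> carrier M" using insert N by (auto simp: act_submodule_def)
  then have e: "e \<in> carrier M" and DC: "D \<subseteq> carrier M" by auto
  obtain n' where n': "n' \<in> N" "e = x \<bullet> n'" using div insert.prems by auto
  obtain s v where sv: "v \<in> combinations D" "n' = s \<bullet> e \<oplus> v"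
    using n'(1) insert.prems(2) combinations_insertE[OF C, of n'] by blast
  have v: "v \<in> carrier M" using sv combinations_carrier[OF DC] by blast
  obtain t where t: "(1 - x * s) * t = 1" using rad by blast
  have "e = (x * s) \<bullet> e \<oplus> x \<bullet> v" using n'(2) sv(2) e v by (simp add: act_add_right act_mult)
  then have "e \<ominus> (x * s) \<bullet> e = x \<bullet> v"
    using diff_add_cancel[of "x \<bullet> v" "(x * s) \<bullet> e"] e v by (simp add: a_comm)
  then have "(1 - x * s) \<bullet> e = x \<bullet> v" using e by (simp add: act_diff_left)
  then have "((1 - x * s) * t) \<bullet> e = t \<bullet> x \<bullet> v" using e by (simp add: act_mult mult.commute[of _ t])
  then have "e = t \<bullet> x \<bullet> v" using t e by simp
  then have "e \<in> combinations D" using combinations_act[OF DC] sv(1) by metis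
  then have "combinations (insert e D) \<subseteq> combinations D"
    using combinations_superset[OF DC] by (intro combinations_least combinations_submodule DC) auto
  then show ?case using insert by blast
qed

definition lincomb :: "'m set \<Rightarrow> ('m \<Rightarrow> 's) \<Rightarrow> 'm" where
  "lincomb E s = (\<Oplus>e\<in>E. s e \<bullet> e)"

lemma act_finsum:
  assumes "finite F" "f \<in> F \<rightarrow> carrier M"
  shows "r \<bullet> (\<Oplus>e\<in>F. f e) = (\<Oplus>e\<in>F. r \<bullet> f e)"
  using assms
proof (induction F rule: finite_induct)
  case (insert a F)
  then have "f \<in> F \<rightarrow> carrier M" "f a \<in> carrier M" "(\<lambda>e. r \<bullet> f e) \<in> F \<rightarrow> carrier M" by auto
  with insert show ?case by (simp add: act_add_right)
qed simp

context
  fixes E :: "'m set"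
  assumes finE: "finite E" and EC: "E \<subseteq> carrier M"
begin

lemma act_pi: "(\<lambda>e. s e \<bullet> e) \<in> E \<rightarrow> carrier M"
  using EC by auto

lemma lincomb_closed: "lincomb E s \<in> carrier M"
  unfolding lincomb_def by (rule finsum_closed) (rule act_pi)

lemma lincomb_add: "lincomb E (\<lambda>e. s e + t e) = lincomb E s \<oplus> lincomb E t"
  unfolding lincomb_def
  by (subst finsum_addf[OF act_pi act_pi, symmetric], rule finsum_cong') (use EC in \<open>auto simp: act_add_left\<close>)

lemma lincomb_act: "lincomb E (\<lambda>e. r * s e) = r \<bullet> lincomb E s"
  unfolding lincomb_def
  by (subst act_finsum[OF finE act_pi], rule finsum_cong') (use EC in \<open>auto simp: act_mult\<close>)

lemma lincomb_diff: "lincomb E (\<lambda>e. s e - t e) = lincomb E s \<ominus> lincomb E t"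
  using lincomb_add[of s "\<lambda>e. (- 1) * t e"] lincomb_act[of "- 1" t] act_minus_left[of "lincomb E t" 1]
  by (simp add: lincomb_closed minus_eq)

lemma lincomb_zero: "lincomb E (\<lambda>e. 0) = \<zero>"
  using lincomb_act[of 0 "\<lambda>e. 0"] lincomb_closed by simp

lemma lincomb_remove: "a \<in> E \<Longrightarrow> lincomb E s = s a \<bullet> a \<oplus> lincomb (E - {a}) s"
proof -
  assume a: "a \<in> E"
  have "(\<Oplus>e\<in>insert a (E - {a}). s e \<bullet> e) = s a \<bullet> a \<oplus> (\<Oplus>e\<in>E - {a}. s e \<bullet> e)"
    by (rule finsum_insert) (use finE EC a in auto)
  then show ?thesis by (simp only: lincomb_def insert_Diff[OF a])
qed

end

lemma lincomb_in_combinations: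
  assumes "finite E" "E \<subseteq> carrier M"
  shows "lincomb E s \<in> combinations E"
  using assms
proof (induction E rule: finite_induct)
  case empty
  then show ?case by (simp add: lincomb_def comb_zero)
next
  case (insert a E)
  have "lincomb (insert a E) s = s a \<bullet> a \<oplus> lincomb E s"
    using lincomb_remove[of "insert a E" a s] insert by simp
  moreover have "lincomb E s \<in> combinations (insert a E)"
    using insert combinations_mono[of E "insert a E"] by blast
  ultimately show ?case by (auto intro: comb_step)
qed

lemma lincomb_single:
  assumes E: "finite E" "E \<subseteq> carrier M" and a: "a \<in> E"
  shows "lincomb E (\<lambda>e. if e = a then 1 else 0) = a"
proof -
  have "lincomb E (\<lambda>e. if e = a then 1 else 0) = a \<oplus> lincomb (E - {a}) (\<lambda>e. if e = a then 1 else 0)"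
    using lincomb_remove[OF E a] a E by auto
  also have "lincomb (E - {a}) (\<lambda>e. if e = a then 1 else 0) = lincomb (E - {a}) (\<lambda>e. 0)"
    unfolding lincomb_def by (rule finsum_cong') (use E in auto)
  also have "\<dots> = \<zero>" using lincomb_zero[of "E - {a}"] E by auto
  finally show ?thesis using a E by auto
qed

lemma combinations_lincombE:
  assumes E: "finite E" "E \<subseteq> carrier M" and u: "u \<in> combinations E"
  obtains s where "u = lincomb E s"
proof -
  have "act_submodule (range (lincomb E))"
    unfolding act_submodule_def
  proof (intro conjI ballI allI)
    show "range (lincomb E) \<subseteq> carrier M" using lincomb_closed[OF E] by blast
    show "\<zero> \<in> range (lincomb E)"
      by (rule range_eqI[where x="\<lambda>e. 0"]) (simp add: lincomb_zero[OF E])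
    fix m assume "m \<in> range (lincomb E)"
    then obtain s where s: "m = lincomb E s" by blast
    show "r \<bullet> m \<in> range (lincomb E)" for r
      by (rule range_eqI[where x="\<lambda>e. r * s e"]) (simp add: s lincomb_act[OF E])
    fix n assume "n \<in> range (lincomb E)"
    then obtain t where t: "n = lincomb E t" by blast
    show "m \<oplus> n \<in> range (lincomb E)"
      by (rule range_eqI[where x="\<lambda>e. s e + t e"]) (simp add: s t lincomb_add[OF E])
  qed
  moreover have "E \<subseteq> range (lincomb E)"
    using lincomb_single[OF E] by (metis rangeI subsetI)
  ultimately have "u \<in> range (lincomb E)" using u combinations_least by blast
  then show thesis using that by blast
qed

end

lemma fps2_radical_x: "\<exists>t. (1 - fps_const fps_X * s) * t = (1 :: 'k::field fps fps)"
  using fps2_unit[of "1 - fps_const fps_X * s"] by auto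

locale fps2_module = type_module M act
  for M :: "('m, 'b) ring_scheme" (structure) and act :: "'k::field fps fps \<Rightarrow> 'm \<Rightarrow> 'm" (infixr "\<bullet>" 75)
begin

text \<open>If \<open>y\<close> and \<open>x\<close> form a regular sequence on a finitely generated module over \<open>k[[x, y]]\<close>, the
  module is free, and a generating set \<open>E\<close> of minimal size is a basis. By minimality, a
  combination that lies in \<open>y M\<close> has no unit among its coefficients. Dividing by \<open>x\<close>, one sees
  that its coefficients lie in \<open>(x\<^sup>c, y)\<close> for all \<open>c\<close>, hence in \<open>(y)\<close>. So the coefficients of a
  relation can be divided by \<open>y\<close> again and again.\<close>

lemma free_of_regular:
  assumes G: "finite G" "G \<subseteq> carrier M" "carrier M \<subseteq> combinations G"
    and y_reg: "\<And>m. m \<in> carrier M \<Longrightarrow> fps_X \<bullet> m = \<zero> \<Longrightarrow> m = \<zero>"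
    and x_reg: "\<And>u v. u \<in> carrier M \<Longrightarrow> v \<in> carrier M \<Longrightarrow> fps_const fps_X \<bullet> u = fps_X \<bullet> v \<Longrightarrow>
      \<exists>w\<in>carrier M. u = fps_X \<bullet> w"
  obtains E where "finite E" "E \<subseteq> carrier M" "carrier M \<subseteq> combinations E"
    "\<And>s e. lincomb E s = \<zero> \<Longrightarrow> e \<in> E \<Longrightarrow> s e = 0"
proof -
  let ?Q = "\<lambda>E. finite E \<and> E \<subseteq> carrier M \<and> carrier M \<subseteq> combinations E"
  obtain E where "?Q E" and min: "\<And>F. ?Q F \<Longrightarrow> card E \<le> card F"
    using ex_has_least_nat[of ?Q G card] G by blast
  then have E: "finite E" "E \<subseteq> carrier M" and gen: "carrier M \<subseteq> combinations E" by auto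
  have relation_nonunit: "s e $ 0 $ 0 = 0" if s: "lincomb E s = \<zero>" and e: "e \<in> E" for s e
  proof (rule ccontr)
    assume "s e $ 0 $ 0 \<noteq> 0"
    then obtain t where t: "s e * t = 1" by (rule fps2_unit)
    let ?E = "E - {e}"
    have E': "finite ?E" "?E \<subseteq> carrier M" and eC: "e \<in> carrier M" using E e by auto
    have l: "lincomb ?E s \<in> carrier M" by (rule lincomb_closed[OF E'])
    have "s e \<bullet> e \<oplus> lincomb ?E s = \<zero>" using lincomb_remove[OF E e, of s] s by simp
    then have "s e \<bullet> e = \<ominus> lincomb ?E s" using minus_equality[of "s e \<bullet> e" "lincomb ?E s"] l eC by simp
    then have "t \<bullet> s e \<bullet> e = t \<bullet> (\<ominus> lincomb ?E s)" by simp
    then have "e = t \<bullet> (\<ominus> lincomb ?E s)" using t eC by (simp add: act_mult[symmetric] mult.commute)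
    moreover have "\<ominus> lincomb ?E s \<in> combinations ?E"
      by (intro act_submodule_minus combinations_submodule lincomb_in_combinations E')
    ultimately have "e \<in> combinations ?E" using combinations_act[OF E'(2)] by metis
    then have "E \<subseteq> combinations ?E" using combinations_superset[OF E'(2)] by blast
    then have "combinations E \<subseteq> combinations ?E"
      by (intro combinations_least combinations_submodule E')
    then have "?Q ?E" using E' gen by blast
    then have "card E \<le> card ?E" by (rule min)
    then show False using e E(1) by (metis card_Diff1_less not_le)
  qed
  have nonunit: "s e $ 0 $ 0 = 0" if u: "u \<in> carrier M" "lincomb E s = fps_X \<bullet> u" and e: "e \<in> E" for s e u
  proof -
    obtain t where t: "u = lincomb E t" using combinations_lincombE[OF E] gen u(1) by blast
    have "lincomb E (\<lambda>e. s e - fps_X * t e) = \<zero>"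
      using u t by (simp add: lincomb_diff[OF E] lincomb_act[OF E] diff_eq_zero_iff)
    from relation_nonunit[OF this e] show ?thesis by simp
  qed
  have x_power: "\<forall>i<c. s e $ 0 $ i = 0" if "u \<in> carrier M" "lincomb E s = fps_X \<bullet> u" "e \<in> E" for s e u c
    using that
  proof (induction c arbitrary: s u e)
    case (Suc c)
    have z: "s e $ 0 $ 0 = 0" if "e \<in> E" for e by (rule nonunit[OF Suc.prems(1,2) that])
    define t where "t e = fps_const (fps_shift 1 (s e $ 0))" for e
    define r where "r e = fps_shift 1 (s e)" for e
    have dec: "s e - fps_X * r e = fps_const fps_X * t e" if "e \<in> E" for e
    proof -
      have "s e $ 0 = fps_X * fps_shift 1 (s e $ 0)"
        using fps_nth_0_decompose[of "s e $ 0"] z[OF that] by simp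
      then have "fps_const (s e $ 0) = fps_const fps_X * t e"
        unfolding t_def by (metis fps_const_mult)
      then show ?thesis using fps_nth_0_decompose[of "s e"] unfolding r_def
        by (metis add_diff_cancel_right')
    qed
    have "lincomb E (\<lambda>e. s e - fps_X * r e) = lincomb E (\<lambda>e. fps_const fps_X * t e)"
      unfolding lincomb_def by (rule finsum_cong') (use dec E in auto)
    then have "fps_const fps_X \<bullet> lincomb E t = fps_X \<bullet> (u \<ominus> lincomb E r)"
      using Suc.prems lincomb_closed[OF E] by (simp add: lincomb_diff[OF E] lincomb_act[OF E] act_diff_right)
    then obtain w where w: "w \<in> carrier M" "lincomb E t = fps_X \<bullet> w"
      using x_reg[of "lincomb E t" "u \<ominus> lincomb E r"] Suc.prems lincomb_closed[OF E] by auto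
    have "\<forall>i<c. t e $ 0 $ i = 0" by (rule Suc.IH[OF w Suc.prems(3)])
    then have "\<forall>i<c. s e $ 0 $ Suc i = 0" by (simp add: t_def)
    then show ?case using z[OF Suc.prems(3)] by (auto simp: less_Suc_eq_0_disj)
  qed simp
  have y_power: "\<forall>i<c. s e $ i = 0" if "lincomb E s = \<zero>" "e \<in> E" for s e c
    using that
  proof (induction c arbitrary: s e)
    case (Suc c)
    have z: "s e $ 0 = 0" if "e \<in> E" for e
    proof (rule fps_ext)
      have "lincomb E s = fps_X \<bullet> \<zero>" using Suc.prems by simp
      from x_power[OF _ this that] show "s e $ 0 $ i = 0 $ i" for i by (metis fps_zero_nth lessI zero_closed)
    qed
    define r where "r e = fps_shift 1 (s e)" for e
    have dec: "s e = fps_X * r e" if "e \<in> E" for e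
      using fps_nth_0_decompose[of "s e"] z[OF that] unfolding r_def by simp
    have "lincomb E s = lincomb E (\<lambda>e. fps_X * r e)"
      unfolding lincomb_def by (rule finsum_cong') (use dec E in auto)
    then have "fps_X \<bullet> lincomb E r = \<zero>" using Suc.prems by (simp add: lincomb_act[OF E])
    then have "lincomb E r = \<zero>" using y_reg lincomb_closed[OF E] by blast
    from Suc.IH[OF this Suc.prems(2)] have "\<forall>i<c. s e $ Suc i = 0" by (simp add: r_def)
    then show ?case using z[OF Suc.prems(2)] by (auto simp: less_Suc_eq_0_disj)
  qed simp
  show thesis
  proof (rule that[OF E gen])
    fix s e assume "lincomb E s = \<zero>" "e \<in> E"
    from y_power[OF this] show "s e = 0" by (intro fps_ext) (metis fps_zero_nth lessI)
  qed
qed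

end

section \<open>The hypersurface ring over power series in two variables\<close>

definition vanishes_to_order :: "nat \<Rightarrow> 'k::comm_ring_1 fps fps \<Rightarrow> bool" where
  "vanishes_to_order N s \<longleftrightarrow> (\<forall>n m. n + m < N \<longrightarrow> s $ n $ m = 0)"

lemma vanishes_to_order_add:
  "vanishes_to_order N s \<Longrightarrow> vanishes_to_order N t \<Longrightarrow> vanishes_to_order N (s + t)"
  by (simp add: vanishes_to_order_def)

lemma vanishes_to_order_mult:
  assumes "vanishes_to_order N s" "vanishes_to_order K t"
  shows "vanishes_to_order (N + K) (s * t)"
  unfolding vanishes_to_order_def
proof (intro allI impI)
  fix n m assume nm: "n + m < N + K"
  have "(s $ i * t $ (n - i)) $ m = 0" if "i \<le> n" for i
    unfolding fps_mult_nth[of "s $ i"]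
  proof (rule sum.neutral, rule ballI)
    fix j assume j: "j \<in> {0..m}"
    show "s $ i $ j * t $ (n - i) $ (m - j) = 0"
    proof (cases "i + j < N")
      case True
      then show ?thesis using assms(1) by (simp add: vanishes_to_order_def)
    next
      case False
      then have "(n - i) + (m - j) < K" using nm that j by auto
      then show ?thesis using assms(2) by (simp add: vanishes_to_order_def)
    qed
  qed
  then show "(s * t) $ n $ m = 0" by (simp add: fps_mult_nth[of s t n] fps_sum_nth)
qed

lemma vanishes_to_order_mult_left: "vanishes_to_order N t \<Longrightarrow> vanishes_to_order N (s * t)"
  using vanishes_to_order_mult[of 0 s N t] by (simp add: vanishes_to_order_def)

lemma vanishes_to_all_orders: "(\<And>N. vanishes_to_order N s) \<Longrightarrow> s = 0"
  unfolding vanishes_to_order_def by (intro fps_ext) (metis fps_zero_nth lessI)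

lemma vanishes_to_order_power: "vanishes_to_order 1 s \<Longrightarrow> vanishes_to_order n (s ^ n)"
proof (induction n)
  case (Suc n)
  then show ?case using vanishes_to_order_mult[of 1 s n "s ^ n"] by simp
qed (simp add: vanishes_to_order_def)

text \<open>The infinite sum of the \<open>h\<^sup>t c\<^sub>t\<close>, for \<open>h\<close> without constant term. In every degree, finitely
  many terms contribute.\<close>

definition power_sum :: "'k::comm_ring_1 fps fps \<Rightarrow> (nat \<Rightarrow> 'k fps fps) \<Rightarrow> 'k fps fps" where
  "power_sum h c = Abs_fps (\<lambda>n. Abs_fps (\<lambda>m. (\<Sum>t\<le>n + m. h ^ t * c t) $ n $ m))"

lemma power_sum_approx:
  assumes h: "vanishes_to_order 1 h"
  shows "vanishes_to_order (Suc N) (power_sum h c - (\<Sum>t\<le>N. h ^ t * c t))"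
  unfolding vanishes_to_order_def
proof (intro allI impI)
  fix n m assume nm: "n + m < Suc N"
  have "{..N} = {..n + m} \<union> {n + m<..N}" using nm by auto
  then have "(\<Sum>t\<le>N. h ^ t * c t) = (\<Sum>t\<le>n + m. h ^ t * c t) + (\<Sum>t\<in>{n + m<..N}. h ^ t * c t)"
    by (simp add: sum.union_disjoint ivl_disj_int)
  moreover have "(h ^ t * c t) $ n $ m = 0" if "n + m < t" for t
    using vanishes_to_order_mult_left[OF vanishes_to_order_power[OF h, of t], of "c t"] that
    by (simp add: vanishes_to_order_def mult.commute)
  ultimately show "(power_sum h c - (\<Sum>t\<le>N. h ^ t * c t)) $ n $ m = 0"
    by (simp add: power_sum_def fps_sum_nth)
qed

lemma power_sum_rec:
  assumes h: "vanishes_to_order 1 h"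
  shows "power_sum h c = c 0 + h * power_sum h (\<lambda>t. c (Suc t))"
proof -
  have "power_sum h c - (c 0 + h * power_sum h (\<lambda>t. c (Suc t))) = 0"
  proof (rule vanishes_to_all_orders)
    fix N
    let ?A = "\<Sum>t\<le>Suc N. h ^ t * c t" and ?B = "\<Sum>t\<le>N. h ^ t * c (Suc t)"
    have AB: "?A = c 0 + h * ?B"
      by (subst sum.atMost_Suc_shift) (simp add: sum_distrib_left mult.assoc)
    have "vanishes_to_order N (power_sum h c - ?A)"
      using power_sum_approx[OF h, of "Suc N" c] by (simp add: vanishes_to_order_def)
    moreover have "vanishes_to_order N ((- h) * (power_sum h (\<lambda>t. c (Suc t)) - ?B))"
      using power_sum_approx[OF h, of N "\<lambda>t. c (Suc t)"]
      by (intro vanishes_to_order_mult_left) (simp add: vanishes_to_order_def)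
    ultimately have "vanishes_to_order N
        ((power_sum h c - ?A) + (- h) * (power_sum h (\<lambda>t. c (Suc t)) - ?B))"
      by (rule vanishes_to_order_add)
    also have "(power_sum h c - ?A) + (- h) * (power_sum h (\<lambda>t. c (Suc t)) - ?B) =
        power_sum h c - (c 0 + h * power_sum h (\<lambda>t. c (Suc t)))"
      unfolding AB by (simp add: algebra_simps)
    finally show "vanishes_to_order N (power_sum h c - (c 0 + h * power_sum h (\<lambda>t. c (Suc t))))" .
  qed
  then show ?thesis by simp
qed

abbreviation x2 :: "'k::comm_ring_1 fps fps" where "x2 \<equiv> fps_const fps_X"
abbreviation y2 :: "'k::comm_ring_1 fps fps" where "y2 \<equiv> fps_X"

definition branch_eq :: "'k::comm_ring_1 fps fps" where "branch_eq = x2 ^ 3 + y2 ^ 4"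

definition hyp_eq :: "'k::comm_ring_1 fps fps fps" where "hyp_eq = ps_z ^ 2 + ps_x ^ 3 + ps_y ^ 4"

lemma hyp_eq_branch_eq: "hyp_eq = ps_z ^ 2 + fps_const branch_eq"
  by (simp add: hyp_eq_def branch_eq_def ps_x_def ps_y_def fps_const_power add.assoc
      flip: fps_const_add)

lemma branch_eq_vanishes: "vanishes_to_order 1 (branch_eq :: 'k::comm_ring_1 fps fps)"
  by (simp add: vanishes_to_order_def branch_eq_def fps_const_power)

abbreviation binomial_in_z :: "'k::comm_ring_1 fps fps \<Rightarrow> 'k fps fps \<Rightarrow> 'k fps fps fps" where
  "binomial_in_z a b \<equiv> fps_const a + fps_const b * ps_z"

text \<open>Modulo \<open>z\<^sup>2 + g\<close> with \<open>g = x\<^sup>3 + y\<^sup>4\<close>, a series \<open>\<Sum> p\<^sub>i z\<^sup>i\<close> is congruent to \<open>a + b z\<close>, where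
  \<open>a = \<Sum> (-g)\<^sup>t p\<^sub>2\<^sub>t\<close> and \<open>b = \<Sum> (-g)\<^sup>t p\<^sub>2\<^sub>t\<^sub>+\<^sub>1\<close>.\<close>

lemma normal_form_exists:
  fixes p :: "'k::comm_ring_1 fps fps fps"
  obtains a b where "hyp_eq dvd p - binomial_in_z a b"
proof -
  let ?h = "- branch_eq :: 'k fps fps"
  have h: "vanishes_to_order 1 ?h" using branch_eq_vanishes by (simp add: vanishes_to_order_def)
  define q where "q i = power_sum ?h (\<lambda>t. p $ (i + 2 * t))" for i
  have q: "q i = p $ i - branch_eq * q (i + 2)" for i
    unfolding q_def by (subst power_sum_rec[OF h]) simp
  define Q where "Q = Abs_fps (\<lambda>i. q (i + 2))"
  have "p - binomial_in_z (q 0) (q 1) = hyp_eq * Q"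
  proof (rule fps_ext)
    fix i
    consider "i = 0" | "i = 1" | j where "i = Suc (Suc j)"
      by (metis One_nat_def not0_implies_Suc)
    then show "(p - binomial_in_z (q 0) (q 1)) $ i = (hyp_eq * Q) $ i"
    proof cases
      case 1
      then show ?thesis using q[of 0]
        by (simp add: hyp_eq_branch_eq ps_z_def distrib_right Q_def fps_X_power_mult_nth)
    next
      case 2
      then show ?thesis using q[of 1]
        by (simp add: hyp_eq_branch_eq ps_z_def distrib_right Q_def fps_X_power_mult_nth numeral_3_eq_3)
    next
      case 3
      then show ?thesis using q[of i]
        by (simp add: hyp_eq_branch_eq ps_z_def distrib_right Q_def fps_X_power_mult_nth)
    qed
  qed
  then show thesis using that by (metis dvd_triv_left)
qed

text \<open>If \<open>a + b z = (z\<^sup>2 + g) \<Sum> q\<^sub>i z\<^sup>i\<close>, then \<open>q\<^sub>i = -g q\<^sub>i\<^sub>+\<^sub>2\<close> for all \<open>i\<close>. So the \<open>q\<^sub>i\<close> are divisible by all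
  powers of \<open>g\<close>, and vanish.\<close>

lemma normal_form_unique:
  fixes a b :: "'k::comm_ring_1 fps fps"
  assumes "hyp_eq dvd binomial_in_z a b"
  shows "a = 0 \<and> b = 0"
proof -
  obtain Q where Q: "binomial_in_z a b = hyp_eq * Q" using assms by (rule dvdE)
  have rec: "Q $ i = (- branch_eq) * Q $ (i + 2)" for i
  proof -
    have "(binomial_in_z a b) $ (i + 2) = (hyp_eq * Q) $ (i + 2)" using Q by simp
    then have "0 = Q $ i + branch_eq * Q $ (i + 2)"
      by (simp add: hyp_eq_branch_eq ps_z_def distrib_right fps_X_power_mult_nth)
    then show ?thesis by (simp add: eq_neg_iff_add_eq_0)
  qed
  have "vanishes_to_order N (Q $ i)" for N i
  proof (induction N arbitrary: i)
    case (Suc N)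
    have "vanishes_to_order (1 + N) (- branch_eq * Q $ (i + 2))"
      using branch_eq_vanishes Suc by (intro vanishes_to_order_mult) (auto simp: vanishes_to_order_def)
    then show ?case using rec[of i] by simp
  qed (simp add: vanishes_to_order_def)
  then have "Q $ i = 0" for i by (intro vanishes_to_all_orders)
  then have "Q = 0" by (intro fps_ext[of Q 0]) simp
  then have z: "binomial_in_z a b = 0" using Q by simp
  have "(binomial_in_z a b) $ 0 = 0" "(binomial_in_z a b) $ 1 = 0" by (simp_all add: z)
  then show ?thesis by (simp add: ps_z_def)
qed

lemma normal_form_eq:
  assumes "hyp_eq dvd binomial_in_z a b - binomial_in_z c d"
  shows "a = c \<and> b = d"
proof -
  have "binomial_in_z a b - binomial_in_z c d = binomial_in_z (a - c) (b - d)"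
    by (simp add: algebra_simps flip: fps_const_sub)
  then show ?thesis using normal_form_unique[of "a - c" "b - d"] assms by simp
qed

lemma norm_identity:
  "hyp_eq dvd binomial_in_z a b * binomial_in_z a (- b) - fps_const (a ^ 2 + branch_eq * b ^ 2)"
proof -
  have "binomial_in_z a b * binomial_in_z a (- b) - fps_const (a ^ 2 + branch_eq * b ^ 2)
    = hyp_eq * (- fps_const (b ^ 2))"
    unfolding hyp_eq_branch_eq
    by (simp add: algebra_simps power2_eq_square flip: fps_const_neg fps_const_mult fps_const_add)
  then show ?thesis by simp
qed

lemma fps3_unit:
  fixes p :: "'k::field fps fps fps"
  assumes "p $ 0 $ 0 $ 0 \<noteq> 0"
  obtains q where "p * q = 1"
proof -
  obtain y where "p $ 0 * y = 1" using fps2_unit[OF assms] by blast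
  then show thesis using fps_right_inverse[of p y] that by simp
qed

abbreviation type_ring :: "'a::comm_ring_1 ring" where "type_ring \<equiv> ring_of_type_algebra"

lemma type_ring_simps [simp]:
  "carrier type_ring = UNIV" "\<zero>\<^bsub>type_ring\<^esub> = 0" "\<one>\<^bsub>type_ring\<^esub> = 1"
  "p \<oplus>\<^bsub>type_ring\<^esub> q = p + q" "p \<otimes>\<^bsub>type_ring\<^esub> q = p * q"
  by (simp_all add: ring_of_type_algebra_def)

lemma type_ring_cring: "cring (type_ring :: 'a::comm_ring_1 ring)"
  by (rule cring_from_type_algebra)

lemma hypersurface_ideal_eq: "hypersurface_ideal = {p. hyp_eq dvd p}"
proof -
  interpret T: cring "type_ring :: 'a fps fps fps ring" by (rule type_ring_cring)
  have "hypersurface_ideal = PIdl\<^bsub>type_ring\<^esub> (hyp_eq :: 'a fps fps fps)"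
    unfolding hypersurface_ideal_def hyp_eq_def by (rule T.cgenideal_eq_genideal[symmetric]) simp
  then show ?thesis by (auto simp: cgenideal_def dvd_def mult.commute)
qed

lemma hypersurface_ideal_ideal: "ideal (hypersurface_ideal :: 'k::comm_ring_1 fps fps fps set) type_ring"
proof -
  interpret T: cring "type_ring :: 'k fps fps fps ring" by (rule type_ring_cring)
  show ?thesis unfolding hypersurface_ideal_def by (rule T.genideal_ideal) simp
qed

lemma hyp_ring_cring: "cring (hypersurface_ring :: 'k::comm_ring_1 fps fps fps set ring)"
  unfolding hypersurface_ring_def
  by (rule ideal.quotient_is_cring[OF hypersurface_ideal_ideal type_ring_cring])

lemma residue_class_hom: "residue_class \<in> ring_hom type_ring (hypersurface_ring :: 'k::comm_ring_1 fps fps fps set ring)"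
proof -
  have "residue_class = (+>\<^bsub>type_ring\<^esub>) (hypersurface_ideal :: 'k fps fps fps set)"
    by (rule ext) (simp add: residue_class_def)
  then show ?thesis
    unfolding hypersurface_ring_def using ideal.rcos_ring_hom[OF hypersurface_ideal_ideal] by metis
qed

lemma residue_class_closed [simp, intro]: "residue_class p \<in> carrier hypersurface_ring"
  using ring_hom_closed[OF residue_class_hom, of p] by simp

lemma residue_class_add: "residue_class (p + q) = residue_class p \<oplus>\<^bsub>hypersurface_ring\<^esub> residue_class q"
  using ring_hom_add[OF residue_class_hom, of p q] by simp

lemma residue_class_mult: "residue_class (p * q) = residue_class p \<otimes>\<^bsub>hypersurface_ring\<^esub> residue_class q"
  using ring_hom_mult[OF residue_class_hom, of p q] by simp

lemma residue_class_one: "residue_class 1 = \<one>\<^bsub>hypersurface_ring\<^esub>"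
  using ring_hom_one[OF residue_class_hom] by simp

lemma residue_class_zero: "residue_class 0 = (\<zero>\<^bsub>hypersurface_ring\<^esub> :: 'k::comm_ring_1 fps fps fps set)"
proof -
  interpret R: cring "hypersurface_ring :: 'k fps fps fps set ring" by (rule hyp_ring_cring)
  interpret T: cring "type_ring :: 'k fps fps fps ring" by (rule type_ring_cring)
  show ?thesis
    using ring_hom_zero[OF residue_class_hom T.ring_axioms R.ring_axioms] by simp
qed

lemma residue_class_surj: "r \<in> carrier hypersurface_ring \<Longrightarrow> \<exists>p. r = residue_class p"
  unfolding hypersurface_ring_def residue_class_def FactRing_def A_RCOSETS_def'
  by auto

lemma residue_class_eq_iff:
  fixes p q :: "'k::comm_ring_1 fps fps fps"
  shows "residue_class p = residue_class q \<longleftrightarrow> hyp_eq dvd p - q"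
proof -
  interpret T: cring "type_ring :: 'k fps fps fps ring" by (rule type_ring_cring)
  have "(p \<ominus>\<^bsub>type_ring\<^esub> q) = p - q"
    using T.minus_equality[of "- q" q] by (simp add: T.minus_eq)
  then show ?thesis
    unfolding residue_class_def
    using T.quotient_eq_iff_same_a_r_cos[OF hypersurface_ideal_ideal, of p q]
    by (auto simp: hypersurface_ideal_eq)
qed

lemma hyp_ring_ideal_preimage:
  assumes "ideal J (hypersurface_ring :: 'k::comm_ring_1 fps fps fps set ring)"
  shows "is_type_ideal {p. residue_class p \<in> J}"
proof -
  interpret J: ideal J hypersurface_ring by fact
  show ?thesis
    unfolding type_ideal.subspace_def
    by (auto simp: residue_class_zero residue_class_add residue_class_mult J.I_l_closed)
qed

lemma hyp_ring_prime_preimage: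
  assumes "primeideal P (hypersurface_ring :: 'k::comm_ring_1 fps fps fps set ring)"
  shows "is_type_prime {p. residue_class p \<in> P}"
proof -
  interpret P: primeideal P hypersurface_ring by fact
  have "\<one>\<^bsub>hypersurface_ring\<^esub> \<notin> P" using P.I_notcarr P.one_imp_carrier by blast
  then show ?thesis
    unfolding is_type_prime_def
    using hyp_ring_ideal_preimage[OF P.is_ideal] P.I_prime[OF residue_class_closed residue_class_closed]
    by (auto simp: residue_class_one residue_class_mult)
qed

lemma type_prime_contract:
  assumes "is_type_prime P"
  shows "is_type_prime {s. fps_const s \<in> P}"
  using assms unfolding is_type_prime_def type_ideal.subspace_def
  by (auto simp flip: fps_const_add fps_const_mult)

text \<open>Distinct comparable primes of \<open>R\<close> have distinct contractions to \<open>S = k[[x, y]]\<close>: if \<open>r = a + b z\<close>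
  lies in \<open>Q\<close> but not in \<open>P\<close>, then its norm \<open>r (a - b z)\<close> lies in \<open>Q \<inter> S\<close>. If this is \<open>P \<inter> S\<close>, then \<open>P\<close>
  contains \<open>a - b z\<close>. So the trace \<open>2 a\<close> lies in \<open>Q \<inter> S\<close> too, hence in \<open>P\<close>, which then contains \<open>r\<close>.\<close>

lemma contraction_strict:
  fixes P Q :: "'k::comm_ring_1 fps fps fps set"
  assumes P: "is_type_prime P" and Q: "is_type_prime Q" and PQ: "P \<subset> Q" and f: "hyp_eq \<in> P"
  shows "{s. fps_const s \<in> P} \<subset> {s. fps_const s \<in> Q}"
proof -
  have iP: "is_type_ideal P" and iQ: "is_type_ideal Q" using P Q by (auto simp: is_type_prime_def)
  have dvdP: "p \<in> P" if "hyp_eq dvd p" for p using that type_ideal_mult_right[OF iP f] by (metis dvdE)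
  have False if eq: "{s. fps_const s \<in> P} = {s. fps_const s \<in> Q}"
  proof -
    have SP: "fps_const s \<in> P" if "fps_const s \<in> Q" for s using eq that by blast
    obtain p where p: "p \<in> Q" "p \<notin> P" using PQ by blast
    obtain a b where ab: "hyp_eq dvd p - binomial_in_z a b" by (rule normal_form_exists)
    let ?r = "binomial_in_z a b" and ?r' = "binomial_in_z a (- b)"
    have rQ: "?r \<in> Q"
      using type_ideal_diff[OF iQ p(1), of "p - ?r"] dvdP[OF ab] PQ by auto
    have rP: "?r \<notin> P"
      using type_ideal_add[OF iP dvdP[OF ab], of ?r] p(2) by auto
    have "?r * ?r' - (?r * ?r' - fps_const (a ^ 2 + branch_eq * b ^ 2)) \<in> Q"
      using type_ideal_mult_right[OF iQ rQ, of ?r'] subsetD[OF psubset_imp_subset[OF PQ] dvdP[OF norm_identity[of a b]]]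
      by (rule type_ideal_diff[OF iQ])
    then have "fps_const (a ^ 2 + branch_eq * b ^ 2) \<in> Q" by simp
    then have "fps_const (a ^ 2 + branch_eq * b ^ 2) \<in> P" by (rule SP)
    then have "fps_const (a ^ 2 + branch_eq * b ^ 2) + (?r * ?r' - fps_const (a ^ 2 + branch_eq * b ^ 2)) \<in> P"
      using dvdP[OF norm_identity[of a b]] by (rule type_ideal_add[OF iP])
    then have "?r * ?r' \<in> P" by simp
    then have r'P: "?r' \<in> P" using P rP by (auto simp: is_type_prime_def)
    have tr: "?r + ?r' = fps_const (a + a)" by (simp flip: fps_const_add fps_const_neg)
    have "?r + ?r' \<in> Q"
      by (rule type_ideal_add[OF iQ rQ subsetD[OF psubset_imp_subset[OF PQ] r'P]])
    then have "?r + ?r' \<in> P" unfolding tr by (rule SP)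
    from type_ideal_diff[OF iP this r'P] show False using rP by simp
  qed
  then show ?thesis using PQ by auto
qed

text \<open>A chain of four primes of \<open>R\<close> would contract to a chain of four primes of \<open>k[[x, y]]\<close>.\<close>

lemma krull_dim_hyp_ring_le: "krull_dim (hypersurface_ring :: 'k::field fps fps fps set ring) \<le> 2"
  unfolding krull_dim_def
proof (rule Sup_least)
  fix e assume "e \<in> {enat n | n. \<exists>P :: nat \<Rightarrow> 'k fps fps fps set set.
     (\<forall>i\<le>n. primeideal (P i) hypersurface_ring) \<and> (\<forall>i<n. P i \<subset> P (Suc i))}"
  then obtain n and P :: "nat \<Rightarrow> 'k fps fps fps set set" where e: "e = enat n"
    and pr: "\<And>i. i \<le> n \<Longrightarrow> primeideal (P i) hypersurface_ring" and ch: "\<And>i. i < n \<Longrightarrow> P i \<subset> P (Suc i)"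
    by auto
  have "n \<le> 2"
  proof (rule ccontr)
    assume n: "\<not> n \<le> 2"
    define A where "A i = {p. residue_class p \<in> P i}" for i
    have A: "is_type_prime (A i)" if "i \<le> 3" for i
      unfolding A_def using n that by (intro hyp_ring_prime_preimage pr) auto
    have f: "hyp_eq \<in> A i" if "i \<le> 3" for i
    proof -
      have "residue_class hyp_eq = (residue_class 0 :: 'k fps fps fps set)"
        by (simp add: residue_class_eq_iff)
      then show ?thesis using A[OF that] type_ideal.subspace_0[of "A i"]
        unfolding A_def is_type_prime_def by auto
    qed
    have Ach: "A i \<subset> A (Suc i)" if "i < 3" for i
    proof -
      have "P i \<subset> P (Suc i)" using n that by (intro ch) auto
      moreover have "P (Suc i) \<subseteq> carrier hypersurface_ring"
        using pr[of "Suc i"] n that by (auto dest!: primeideal.axioms(1) ideal.Icarr)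
      ultimately obtain r where "r \<in> P (Suc i)" "r \<notin> P i" "r \<in> carrier hypersurface_ring" by blast
      then show ?thesis using \<open>P i \<subset> P (Suc i)\<close> residue_class_surj[of r] unfolding A_def by auto
    qed
    show False
      using prime_chain_fps2_bound[of "\<lambda>i. {s. fps_const s \<in> A i}"]
        type_prime_contract[OF A] contraction_strict[OF A A Ach f] by auto
  qed
  then show "e \<le> 2" using e by (metis enat_ord_simps(1) numeral_eq_enat)
qed

section \<open>Maximal Cohen-Macaulay modules are free over power series in two variables\<close>

text \<open>The preimage in \<open>k[[x, y, z]]\<close> of the ideal \<open>(y)\<close> of \<open>R\<close>.\<close>

definition y_f_ideal :: "'k::comm_ring_1 fps fps fps set" where
  "y_f_ideal = {ps_y * a + hyp_eq * b | a b. True}"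

lemma y_f_ideal_ideal: "is_type_ideal (y_f_ideal :: 'k::comm_ring_1 fps fps fps set)"
  unfolding type_ideal.subspace_def
proof (intro conjI ballI allI)
  have "0 = ps_y * 0 + hyp_eq * (0 :: 'k fps fps fps)" by simp
  then show "0 \<in> (y_f_ideal :: 'k fps fps fps set)" unfolding y_f_ideal_def by blast
  fix p :: "'k fps fps fps" assume "p \<in> y_f_ideal"
  then obtain a b where p: "p = ps_y * a + hyp_eq * b" unfolding y_f_ideal_def by blast
  show "c * p \<in> y_f_ideal" for c
  proof -
    have "c * p = ps_y * (c * a) + hyp_eq * (c * b)" by (simp add: p algebra_simps)
    then show ?thesis unfolding y_f_ideal_def by blast
  qed
  fix q :: "'k fps fps fps" assume "q \<in> y_f_ideal"
  then obtain c d where q: "q = ps_y * c + hyp_eq * d" unfolding y_f_ideal_def by blast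
  have "p + q = ps_y * (a + c) + hyp_eq * (b + d)" by (simp add: p q algebra_simps)
  then show "p + q \<in> y_f_ideal" unfolding y_f_ideal_def by blast
qed

lemma y_in_y_f_ideal: "ps_y * a \<in> y_f_ideal"
proof -
  have "ps_y * a = ps_y * a + hyp_eq * 0" by simp
  then show ?thesis unfolding y_f_ideal_def by blast
qed

lemma hyp_eq_dvd_in_y_f_ideal: "hyp_eq dvd p \<Longrightarrow> p \<in> y_f_ideal"
proof -
  assume "hyp_eq dvd p"
  then obtain b where "p = ps_y * 0 + hyp_eq * b" by (auto elim: dvdE)
  then show ?thesis unfolding y_f_ideal_def by blast
qed

lemma fps_const_decompose_y: "fps_const s = fps_const (fps_const (s $ 0)) + ps_y * fps_const (fps_shift 1 s)"
  using fps_nth_0_decompose[of s] by (metis fps_const_add fps_const_mult ps_y_def)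

lemma cusp_norm_zero:
  fixes a b :: "'k::field fps"
  assumes "a ^ 2 + fps_X ^ 3 * b ^ 2 = 0"
  shows "a = 0 \<and> b = 0"
proof (rule ccontr)
  assume neg: "\<not> ?thesis"
  have eq: "a ^ 2 = - (fps_X ^ 3 * b ^ 2)" using assms by (simp add: eq_neg_iff_add_eq_0)
  have "b \<noteq> 0" using neg eq by auto
  then have "a \<noteq> 0" using eq by auto
  have "subdegree (a ^ 2) = subdegree (fps_X ^ 3 * b ^ 2)" using eq by simp
  then have "2 * subdegree a = 3 + 2 * subdegree b"
    using \<open>a \<noteq> 0\<close> \<open>b \<noteq> 0\<close> by (simp add: subdegree_power fps_X_power_subdegree)
  then show False by presburger
qed

text \<open>Modulo \<open>y\<close>, the ring \<open>R\<close> becomes the cusp \<open>k[[x, z]]/(z\<^sup>2 + x\<^sup>3)\<close>. The norm \<open>a\<^sup>2 + x\<^sup>3 b\<^sup>2\<close> of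
  \<open>a + b z\<close> cannot vanish for parity reasons, unless \<open>a = b = 0\<close>. So every nonzero element of
  the cusp divides its norm, which is a power of \<open>x\<close> up to a unit.\<close>

lemma cusp_divides_x_power:
  fixes p :: "'k::field fps fps fps"
  assumes "p \<notin> y_f_ideal"
  obtains e s where "ps_x ^ e - p * s \<in> y_f_ideal"
proof -
  note I = y_f_ideal_ideal
  obtain a b where ab: "hyp_eq dvd p - binomial_in_z a b" by (rule normal_form_exists)
  let ?n = "a ^ 2 + branch_eq * b ^ 2"
  have g0: "branch_eq $ 0 = (fps_X ^ 3 :: 'k fps)"
    by (simp add: branch_eq_def fps_const_power)
  have n0: "?n $ 0 = (a $ 0) ^ 2 + fps_X ^ 3 * (b $ 0) ^ 2"
    by (simp add: g0 power2_eq_square)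
  have "?n $ 0 \<noteq> 0"
  proof
    assume "?n $ 0 = 0"
    then have "a $ 0 = 0 \<and> b $ 0 = 0" unfolding n0 by (rule cusp_norm_zero)
    then have "fps_const a = ps_y * fps_const (fps_shift 1 a)" "fps_const b = ps_y * fps_const (fps_shift 1 b)"
      using fps_const_decompose_y[of a] fps_const_decompose_y[of b] by simp_all
    then have "binomial_in_z a b = ps_y * (fps_const (fps_shift 1 a) + fps_const (fps_shift 1 b) * ps_z)"
      by (simp add: algebra_simps)
    then have "binomial_in_z a b \<in> y_f_ideal" using y_in_y_f_ideal by metis
    then have "p - binomial_in_z a b + binomial_in_z a b \<in> y_f_ideal"
      by (rule type_ideal_add[OF I hyp_eq_dvd_in_y_f_ideal[OF ab]])
    then show False using assms by simp
  qed
  let ?e = "subdegree (?n $ 0)"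
  have "\<exists>w. fps_X ^ subdegree c = c * w" if c: "c \<noteq> 0" for c :: "'k fps"
  proof -
    obtain w where w: "1 = unit_factor c * w"
      using fps_unit_dvd_left[OF fps_unit_factor_nth_0[OF c]] by blast
    have "c * w = fps_X ^ subdegree c * unit_factor c * w"
      using fps_unit_factor_decompose'[of c] by simp
    also have "\<dots> = fps_X ^ subdegree c" by (simp only: mult.assoc w[symmetric] mult_1_right)
    finally show ?thesis by metis
  qed
  then obtain w where e: "fps_X ^ ?e = ?n $ 0 * w" using \<open>?n $ 0 \<noteq> 0\<close> by blast
  let ?w = "fps_const (fps_const w) :: 'k fps fps fps"
  have "ps_x ^ ?e = fps_const (fps_const (fps_X ^ ?e) :: 'k fps fps)"
    by (simp add: ps_x_def fps_const_power)
  also have "\<dots> = fps_const (fps_const (?n $ 0)) * ?w" unfolding e by simp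
  finally have xe: "ps_x ^ ?e = fps_const (fps_const (?n $ 0)) * ?w" .
  let ?d1 = "p - binomial_in_z a b"
    and ?d2 = "binomial_in_z a b * binomial_in_z a (- b) - fps_const ?n"
  have ident: "(N - Y) * W - P * (B' * W) = - (Y * W) - (B * B' - N) * W - (P - B) * (B' * W)"
    for P B B' W N Y :: "'k fps fps fps" by (simp add: algebra_simps)
  have cn: "fps_const (fps_const (?n $ 0)) = fps_const ?n - ps_y * fps_const (fps_shift 1 ?n)"
    using fps_const_decompose_y[of ?n] by (metis add_diff_cancel_right')
  have "ps_x ^ ?e - p * (binomial_in_z a (- b) * ?w) =
     - ((ps_y * fps_const (fps_shift 1 ?n)) * ?w) - ?d2 * ?w - ?d1 * (binomial_in_z a (- b) * ?w)"
    unfolding xe cn by (rule ident)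
  also have "\<dots> \<in> y_f_ideal"
    by (intro type_ideal_diff[OF I] type_ideal.subspace_neg[OF I] type_ideal_mult_right[OF I]
        y_in_y_f_ideal hyp_eq_dvd_in_y_f_ideal ab norm_identity)
  finally show thesis using that by blast
qed

lemma nonunit_decompose:
  fixes p :: "'k::field fps fps fps"
  assumes "p $ 0 $ 0 $ 0 = 0"
  obtains a b c where "p = ps_x * a + ps_y * b + ps_z * c"
proof -
  have "p = fps_const (p $ 0) + ps_z * fps_shift 1 p"
    unfolding ps_z_def by (rule fps_nth_0_decompose)
  moreover have "fps_const (p $ 0) = fps_const (fps_const (p $ 0 $ 0)) + ps_y * fps_const (fps_shift 1 (p $ 0))"
    by (rule fps_const_decompose_y)
  moreover have "p $ 0 $ 0 = fps_X * fps_shift 1 (p $ 0 $ 0)"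
    using fps_nth_0_decompose[of "p $ 0 $ 0"] assms by simp
  then have "fps_const (fps_const (p $ 0 $ 0)) = ps_x * (fps_const (fps_const (fps_shift 1 (p $ 0 $ 0))) :: 'k fps fps fps)"
    unfolding ps_x_def by (metis fps_const_mult)
  ultimately show thesis using that by metis
qed

text \<open>In \<open>R\<close>, the square of every non-unit lies in \<open>(x, y)\<close>, because \<open>z\<^sup>2\<close> does.\<close>

lemma nonunit_square:
  fixes p :: "'k::field fps fps fps"
  assumes "p $ 0 $ 0 $ 0 = 0"
  obtains a b c where "p ^ 2 = ps_x * a + ps_y * b + hyp_eq * c"
proof -
  obtain a b c where p: "p = ps_x * a + ps_y * b + ps_z * c" using nonunit_decompose[OF assms] .
  have "p ^ 2 = ps_x * (a * (ps_x * a + ps_y * b + ps_z * c) + a * (ps_y * b + ps_z * c) - ps_x ^ 2 * c ^ 2)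
     + ps_y * (b * (ps_y * b + ps_z * c) + b * (ps_z * c) - ps_y ^ 3 * c ^ 2) + hyp_eq * c ^ 2"
    unfolding p hyp_eq_def by (simp add: algebra_simps power2_eq_square power3_eq_cube power4_eq_xxxx)
  then show thesis by (rule that)
qed

locale hyp_module = module "hypersurface_ring :: 'k::field fps fps fps set ring" M
  for M :: "('k::field fps fps fps set, 'u) module" (structure)
begin

definition act :: "'k fps fps fps \<Rightarrow> 'u \<Rightarrow> 'u" (infixr "\<bullet>" 75) where
  "p \<bullet> m = residue_class p \<odot> m"

sublocale A: type_module M act
  by unfold_locales
     (auto simp: act_def residue_class_add residue_class_mult residue_class_one smult_l_distr smult_r_distr smult_assoc1)

sublocale S: fps2_module M "\<lambda>s. act (fps_const s)"
  by unfold_locales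
     (auto simp: A.act_add_left A.act_add_right A.act_mult simp flip: fps_const_add fps_const_mult)

lemma act_cong: "hyp_eq dvd p - q \<Longrightarrow> p \<bullet> m = q \<bullet> m"
  using residue_class_eq_iff[of p q] by (simp add: act_def)

lemma act_hyp_eq: "hyp_eq dvd p \<Longrightarrow> m \<in> carrier M \<Longrightarrow> p \<bullet> m = \<zero>\<^bsub>M\<^esub>"
  using act_cong[of p 0 m] by simp

lemma act_normal_form:
  obtains a b where "\<And>m. m \<in> carrier M \<Longrightarrow> p \<bullet> m = fps_const a \<bullet> m \<oplus>\<^bsub>M\<^esub> fps_const b \<bullet> ps_z \<bullet> m"
proof -
  obtain a b where "hyp_eq dvd p - binomial_in_z a b" by (rule normal_form_exists)
  from act_cong[OF this] show thesis
    using that[of a b] by (simp add: A.act_add_left A.act_mult)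
qed

lemma act_z_z: "m \<in> carrier M \<Longrightarrow> ps_z \<bullet> ps_z \<bullet> m = fps_const (- branch_eq) \<bullet> m"
  using act_cong[of "ps_z * ps_z" "fps_const (- branch_eq)" m]
  by (simp add: A.act_mult[symmetric] hyp_eq_branch_eq power2_eq_square flip: fps_const_neg)

text \<open>If \<open>G\<close> generates \<open>M\<close> over \<open>R\<close>, then \<open>G \<union> z G\<close> generates it over \<open>k[[x, y]]\<close>.\<close>

lemma fin_gen_over_fps2:
  assumes "fin_gen_module hypersurface_ring M"
  obtains G where "finite G" "G \<subseteq> carrier M" "carrier M \<subseteq> S.combinations G"
proof -
  obtain G where G: "finite G" "G \<subseteq> carrier M" "submodule_span hypersurface_ring M G = carrier M"
    using assms unfolding fin_gen_module_def by blast
  let ?G = "G \<union> act ps_z ` G" and ?K = "S.combinations (G \<union> act ps_z ` G)"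
  have GC: "?G \<subseteq> carrier M" using G by auto
  note K = S.combinations_submodule[OF GC]
  have KC: "?K \<subseteq> carrier M" by (rule S.combinations_carrier[OF GC])
  have "S.act_submodule {u \<in> ?K. ps_z \<bullet> u \<in> ?K}"
    using K unfolding S.act_submodule_def
    by (auto simp: A.act_add_right[OF subsetD[OF KC] subsetD[OF KC]]
        A.act_left_commute[OF subsetD[OF KC], of _ ps_z])
  moreover have "?G \<subseteq> {u \<in> ?K. ps_z \<bullet> u \<in> ?K}"
  proof
    fix u assume u: "u \<in> ?G"
    note sup = S.combinations_superset[OF GC]
    have "ps_z \<bullet> u \<in> ?K"
    proof (cases "u \<in> G")
      case True
      then show ?thesis using sup by blast
    next
      case False
      then obtain g where g: "g \<in> G" "u = ps_z \<bullet> g" using u by blast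
      then have "ps_z \<bullet> u = fps_const (- branch_eq) \<bullet> g" using act_z_z G by blast
      moreover have "g \<in> ?K" using sup g by blast
      ultimately show ?thesis using S.combinations_act[OF GC] by simp
    qed
    then show "u \<in> {u \<in> ?K. ps_z \<bullet> u \<in> ?K}" using sup u by blast
  qed
  ultimately have z: "ps_z \<bullet> u \<in> ?K" if "u \<in> ?K" for u
    using S.combinations_least that by blast
  have "submodule ?K hypersurface_ring M"
  proof (rule submoduleI)
    show "?K \<subseteq> carrier M" by (rule KC)
    show "r \<odot> u \<in> ?K" if r: "r \<in> carrier hypersurface_ring" and u: "u \<in> ?K" for r u
    proof -
      obtain p where p: "r = residue_class p" using residue_class_surj[OF r] by blast
      obtain a b where "\<And>m. m \<in> carrier M \<Longrightarrow> p \<bullet> m = fps_const a \<bullet> m \<oplus>\<^bsub>M\<^esub> fps_const b \<bullet> ps_z \<bullet> m"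
        using act_normal_form[of p] by metis
      then have "r \<odot> u = fps_const a \<bullet> u \<oplus>\<^bsub>M\<^esub> fps_const b \<bullet> ps_z \<bullet> u"
        using p u KC by (auto simp: act_def)
      then show ?thesis
        using S.combinations_add[OF GC S.combinations_act[OF GC u] S.combinations_act[OF GC z[OF u]]] by simp
    qed
  qed (use K S.act_submodule_minus[OF K] in \<open>auto simp: S.act_submodule_def\<close>)
  then have "carrier M \<subseteq> ?K"
    using submodule_span_least[OF module_axioms] S.combinations_superset[OF GC] G(3) by blast
  then show thesis using that[of ?G] G GC by blast
qed

context
  fixes p q :: "'k fps fps fps"
  assumes fg: "fin_gen_module hypersurface_ring M"
    and p_nonunit: "p $ 0 $ 0 $ 0 = 0" and q_nonunit: "q $ 0 $ 0 $ 0 = 0"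
    and p_reg: "\<And>m. m \<in> carrier M \<Longrightarrow> p \<bullet> m = \<zero>\<^bsub>M\<^esub> \<Longrightarrow> m = \<zero>\<^bsub>M\<^esub>"
    and q_reg: "\<And>u v. u \<in> carrier M \<Longrightarrow> v \<in> carrier M \<Longrightarrow> q \<bullet> u = p \<bullet> v \<Longrightarrow> \<exists>w\<in>carrier M. u = p \<bullet> w"
begin

lemma q_power_reg:
  "u \<in> carrier M \<Longrightarrow> v \<in> carrier M \<Longrightarrow> (q ^ n) \<bullet> u = p \<bullet> v \<Longrightarrow> \<exists>w\<in>carrier M. u = p \<bullet> w"
proof (induction n arbitrary: u v)
  case 0
  then show ?case by auto
next
  case (Suc n)
  then have "q \<bullet> (q ^ n) \<bullet> u = p \<bullet> v" by (simp add: A.act_mult[symmetric])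
  then obtain w where "w \<in> carrier M" "(q ^ n) \<bullet> u = p \<bullet> w"
    using q_reg[of "(q ^ n) \<bullet> u" v] Suc.prems(1,2) by auto
  then show ?case using Suc by blast
qed

lemma p_cancel: "u \<in> carrier M \<Longrightarrow> v \<in> carrier M \<Longrightarrow> p \<bullet> u = p \<bullet> v \<Longrightarrow> u = v"
  using p_reg[of "u \<ominus>\<^bsub>M\<^esub> v"] by (simp add: A.act_diff_right A.diff_eq_zero_iff)

text \<open>The kernel \<open>L\<close> of \<open>y\<close> is a module over the cusp \<open>R/(y)\<close>, where \<open>p\<close> vanishes or divides a power of
  \<open>x\<close>, and where \<open>x\<close> divides \<open>q\<^sup>2\<close>. If \<open>p\<close> vanishes, it is injective only on \<open>L = 0\<close>. Otherwise, as \<open>q\<close> is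
  regular modulo \<open>p M\<close>, it follows that \<open>L = p L\<close>. But \<open>p\<^sup>2\<close> is
  divisible by \<open>x\<close> on \<open>L\<close>, so that \<open>L = x L\<close>, and \<open>L = 0\<close> by Nakayama's lemma.\<close>

lemma y_regular:
  assumes "m \<in> carrier M" "ps_y \<bullet> m = \<zero>\<^bsub>M\<^esub>"
  shows "m = \<zero>\<^bsub>M\<^esub>"
proof -
  define L where "L = {u \<in> carrier M. ps_y \<bullet> u = \<zero>\<^bsub>M\<^esub>}"
  have LC: "u \<in> carrier M" if "u \<in> L" for u using that by (simp add: L_def)
  have Lact: "r \<bullet> u \<in> L" if "u \<in> L" for r u
    using that by (simp add: L_def A.act_left_commute[of _ ps_y])
  have LS: "S.act_submodule L"
    using Lact unfolding S.act_submodule_def by (auto simp: L_def A.act_add_right)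
  have Lyf: "r \<bullet> u = \<zero>\<^bsub>M\<^esub>" if u: "u \<in> L" and r: "r \<in> y_f_ideal" for r u
  proof -
    obtain a b where "r = ps_y * a + hyp_eq * b" using r unfolding y_f_ideal_def by blast
    then show ?thesis using u LC[OF u]
      by (simp add: A.act_add_left A.act_mult A.act_left_commute[of _ ps_y] act_hyp_eq) (simp add: L_def)
  qed
  have Lcong: "r \<bullet> u = t \<bullet> u" if "u \<in> L" "r - t \<in> y_f_ideal" for r t u
    using Lyf[OF that] LC[OF that(1)] by (simp add: A.act_diff_left A.diff_eq_zero_iff)
  have square: "\<exists>a. \<forall>u\<in>L. (r ^ 2) \<bullet> u = (ps_x * a) \<bullet> u" if r: "r $ 0 $ 0 $ 0 = 0" for r
  proof -
    obtain a b c where "r ^ 2 = ps_x * a + ps_y * b + hyp_eq * c" using nonunit_square[OF r] .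
    then have "r ^ 2 - ps_x * a \<in> y_f_ideal" unfolding y_f_ideal_def by auto
    then show ?thesis using Lcong by blast
  qed
  have "\<exists>w\<in>L. u = p \<bullet> w" if u: "u \<in> L" for u
  proof (cases "p \<in> y_f_ideal")
    case True
    then have "u = \<zero>\<^bsub>M\<^esub>" using Lyf[OF u] p_reg LC[OF u] by blast
    then show ?thesis using u by (intro bexI[of _ u]) auto
  next
    case False
    then obtain e s where es: "ps_x ^ e - p * s \<in> y_f_ideal" by (rule cusp_divides_x_power)
    obtain a where a: "\<And>u. u \<in> L \<Longrightarrow> (q ^ 2) \<bullet> u = (ps_x * a) \<bullet> u" using square[OF q_nonunit] by blast
    have pw: "((q ^ 2) ^ n) \<bullet> u = ((ps_x * a) ^ n) \<bullet> u" for n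
    proof (induction n)
      case (Suc n)
      have "((q ^ 2) ^ Suc n) \<bullet> u = (q ^ 2) \<bullet> ((q ^ 2) ^ n) \<bullet> u"
        using LC[OF u] by (simp add: A.act_mult)
      also have "\<dots> = (ps_x * a) \<bullet> ((ps_x * a) ^ n) \<bullet> u"
        unfolding Suc by (rule a[OF Lact[OF u]])
      finally show ?case using LC[OF u] by (simp add: A.act_mult[symmetric])
    qed simp
    have "(q ^ (2 * e)) \<bullet> u = ((ps_x * a) ^ e) \<bullet> u"
      unfolding power_mult by (rule pw)
    also have "\<dots> = (a ^ e) \<bullet> (ps_x ^ e) \<bullet> u"
      using LC[OF u] by (simp add: power_mult_distrib A.act_mult[symmetric] mult.commute)
    also have "(ps_x ^ e) \<bullet> u = (p * s) \<bullet> u" by (rule Lcong[OF u es])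
    also have "(a ^ e) \<bullet> (p * s) \<bullet> u = p \<bullet> (a ^ e * s) \<bullet> u"
      using LC[OF u] by (simp add: A.act_mult[symmetric] mult.left_commute)
    finally obtain w where w: "w \<in> carrier M" "u = p \<bullet> w"
      using q_power_reg[OF LC[OF u]] LC[OF u] by blast
    have "p \<bullet> ps_y \<bullet> w = \<zero>\<^bsub>M\<^esub>" using u w by (simp add: L_def A.act_left_commute[of _ p])
    then have "w \<in> L" using p_reg w by (simp add: L_def)
    then show ?thesis using w by blast
  qed
  then have pL: "\<exists>w\<in>L. u = (p ^ 2) \<bullet> w" if "u \<in> L" for u
    using that LC by (metis A.act_mult power2_eq_square)
  obtain a where a: "\<And>u. u \<in> L \<Longrightarrow> (p ^ 2) \<bullet> u = (ps_x * a) \<bullet> u" using square[OF p_nonunit] by blast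
  have xL: "\<exists>w\<in>L. u = fps_const x2 \<bullet> w" if "u \<in> L" for u
  proof -
    obtain w where w: "w \<in> L" "u = (p ^ 2) \<bullet> w" using pL \<open>u \<in> L\<close> by blast
    then have "u = fps_const x2 \<bullet> a \<bullet> w" using a LC by (simp add: A.act_mult ps_x_def)
    then show ?thesis using Lact[OF w(1)] by blast
  qed
  obtain G where G: "finite G" "G \<subseteq> carrier M" "carrier M \<subseteq> S.combinations G"
    by (rule fin_gen_over_fps2[OF fg])
  have noeth: "\<exists>H. finite H \<and> H \<subseteq> I \<and> I \<subseteq> type_ideal.span H" if I: "is_type_ideal I" for I :: "'k fps fps set"
    by (rule fps2_ideal_fin_gen[OF I]) blast
  have "L \<subseteq> S.combinations G" using LC G(3) by blast
  then obtain D where D: "finite D" "D \<subseteq> L" "L \<subseteq> S.combinations D"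
    using S.submodule_fin_gen[OF noeth G(1,2) LS] by blast
  have "L \<subseteq> {\<zero>\<^bsub>M\<^esub>}"
    by (rule S.nakayama[OF fps2_radical_x D(1) LS D(2,3) xL])
  then show ?thesis using assms by (auto simp: L_def)
qed

text \<open>Suppose that \<open>x u = y v\<close>. The fraction \<open>u/y = v/x\<close> is multiplied into \<open>M\<close> by \<open>p\<^sup>2\<close> and \<open>q\<^sup>2\<close>, which lie
  in \<open>(x, y)\<close>. The two products are the elements \<open>A\<close> and \<open>B\<close> below. As \<open>p\<^sup>2, q\<^sup>2\<close> is a regular
  sequence, the fraction belongs to \<open>M\<close>.\<close>

lemma x_regular_mod_y:
  assumes u: "u \<in> carrier M" and v: "v \<in> carrier M" and xy: "ps_x \<bullet> u = ps_y \<bullet> v"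
  shows "\<exists>w\<in>carrier M. u = ps_y \<bullet> w"
proof -
  have frac: "\<exists>A\<in>carrier M. ps_y \<bullet> A = (r ^ 2) \<bullet> u" if r0: "r $ 0 $ 0 $ 0 = 0" for r
  proof -
    obtain a b c where r: "r ^ 2 = ps_x * a + ps_y * b + hyp_eq * c" using nonunit_square[OF r0] .
    have "ps_y \<bullet> (a \<bullet> v \<oplus>\<^bsub>M\<^esub> b \<bullet> u) = a \<bullet> ps_y \<bullet> v \<oplus>\<^bsub>M\<^esub> b \<bullet> ps_y \<bullet> u"
      using u v by (simp add: A.act_add_right A.act_left_commute[of _ ps_y])
    also have "\<dots> = (r ^ 2) \<bullet> u"
      unfolding r xy[symmetric] using u
      by (simp add: A.act_add_left act_hyp_eq A.act_mult[symmetric] mult.commute)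
    finally show ?thesis using u v by blast
  qed
  obtain A where A: "A \<in> carrier M" "ps_y \<bullet> A = (p ^ 2) \<bullet> u" using frac[OF p_nonunit] by blast
  obtain B where B: "B \<in> carrier M" "ps_y \<bullet> B = (q ^ 2) \<bullet> u" using frac[OF q_nonunit] by blast
  have "ps_y \<bullet> (p ^ 2) \<bullet> B = ps_y \<bullet> (q ^ 2) \<bullet> A"
    using A B u by (simp add: A.act_left_commute[of _ ps_y]) (simp add: A.act_left_commute)
  then have "ps_y \<bullet> ((q ^ 2) \<bullet> A \<ominus>\<^bsub>M\<^esub> (p ^ 2) \<bullet> B) = \<zero>\<^bsub>M\<^esub>"
    using A(1) B(1) by (simp add: A.act_diff_right A.diff_eq_zero_iff)
  then have eq: "(q ^ 2) \<bullet> A = p \<bullet> p \<bullet> B"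
    using y_regular[of "(q ^ 2) \<bullet> A \<ominus>\<^bsub>M\<^esub> (p ^ 2) \<bullet> B"] A(1) B(1)
    by (simp add: A.diff_eq_zero_iff A.act_mult power2_eq_square)
  then obtain A' where A': "A' \<in> carrier M" "A = p \<bullet> A'" using q_power_reg A(1) B(1) by blast
  then have "p \<bullet> (q ^ 2) \<bullet> A' = p \<bullet> p \<bullet> B" using eq by (simp add: A.act_left_commute[of _ p])
  then have "(q ^ 2) \<bullet> A' = p \<bullet> B" using p_cancel A' B by blast
  then obtain A'' where A'': "A'' \<in> carrier M" "A' = p \<bullet> A''" using q_power_reg A'(1) B(1) by blast
  have "p \<bullet> p \<bullet> ps_y \<bullet> A'' = p \<bullet> p \<bullet> u"
    using A(2) A' A'' u by (simp add: A.act_left_commute[of _ ps_y] A.act_mult power2_eq_square)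
  then have "ps_y \<bullet> A'' = u" using p_cancel A''(1) u by simp
  then show ?thesis using A''(1) by blast
qed

end

lemma nonzerodivisor_mod_iff:
  assumes "r = residue_class p"
  shows "nonzerodivisor_mod hypersurface_ring M N r \<longleftrightarrow> (\<forall>m\<in>carrier M. p \<bullet> m \<in> N \<longrightarrow> m \<in> N)"
  using assms by (auto simp: nonzerodivisor_mod_def act_def)

text \<open>The first two entries of a regular sequence. They are residue classes of series without constant
  term, since a unit in the sequence would generate all of \<open>M\<close>.\<close>

lemma MCM_regular_pair:
  assumes MCM: "MCM_module hypersurface_ring M"
    and dim: "2 \<le> krull_dim (hypersurface_ring :: 'k fps fps fps set ring)"
  obtains p q where "p $ 0 $ 0 $ 0 = 0" "q $ 0 $ 0 $ 0 = 0"
    "\<And>m. m \<in> carrier M \<Longrightarrow> p \<bullet> m = \<zero>\<^bsub>M\<^esub> \<Longrightarrow> m = \<zero>\<^bsub>M\<^esub>"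
    "\<And>u v. u \<in> carrier M \<Longrightarrow> v \<in> carrier M \<Longrightarrow> q \<bullet> u = p \<bullet> v \<Longrightarrow> \<exists>w\<in>carrier M. u = p \<bullet> w"
proof -
  let ?R = "hypersurface_ring :: 'k fps fps fps set ring"
  have "2 \<le> module_depth ?R M" using MCM dim by (simp add: MCM_module_def)
  have "\<exists>xs. regular_sequence ?R M xs \<and> 2 \<le> length xs"
  proof (rule ccontr)
    assume "\<not> ?thesis"
    then have "module_depth ?R M \<le> enat 1"
      unfolding module_depth_def by (intro Sup_least) fastforce
    with \<open>2 \<le> module_depth ?R M\<close> have "(2::enat) \<le> enat 1" by (rule order_trans)
    then show False by (simp add: numeral_eq_enat)
  qed
  then obtain xs where xs: "regular_sequence ?R M xs" "2 \<le> length xs" by blast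
  have sub: "set xs \<subseteq> carrier ?R" using xs(1) by (simp add: regular_sequence_def)
  have "xs ! 0 \<in> carrier ?R" "xs ! 1 \<in> carrier ?R" using sub xs(2) by (auto dest!: subsetD intro: nth_mem)
  then obtain p q where pq: "xs ! 0 = residue_class p" "xs ! 1 = residue_class q"
    using residue_class_surj by metis
  have nonunit: "r $ 0 $ 0 $ 0 = 0" if "residue_class r \<in> set xs" for r
  proof (rule ccontr)
    assume "r $ 0 $ 0 $ 0 \<noteq> 0"
    then obtain t where t: "r * t = 1" by (rule fps3_unit)
    have Idl: "residue_class r \<in> Idl\<^bsub>?R\<^esub> (set xs)" by (rule genideal_self_mem[OF module_axioms that sub])
    have "m \<in> ideal_smult ?R (Idl\<^bsub>?R\<^esub> (set xs)) M" if "m \<in> carrier M" for m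
    proof -
      have "m = r \<bullet> t \<bullet> m" using t that by (simp add: A.act_mult[symmetric])
      moreover have "residue_class r \<odot> (t \<bullet> m) \<in> ideal_smult ?R (Idl\<^bsub>?R\<^esub> (set xs)) M"
        by (rule ideal_smult_mem[OF module_axioms Idl]) (use that in auto)
      ultimately show ?thesis by (simp add: act_def)
    qed
    moreover have "submodule (ideal_smult ?R (Idl\<^bsub>?R\<^esub> (set xs)) M) ?R M"
      using R.genideal_ideal[OF sub]
      by (intro ideal_smult_submodule[OF module_axioms]) (simp add: additive_subgroup.a_subset ideal.axioms(1))
    ultimately have "ideal_smult ?R (Idl\<^bsub>?R\<^esub> (set xs)) M = carrier M"
      using submoduleE(1) by blast
    then show False using xs(1) by (simp add: regular_sequence_def)
  qed
  have nzd: "nonzerodivisor_mod ?R M (ideal_smult ?R (Idl\<^bsub>?R\<^esub> (set (take i xs))) M) (xs ! i)"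
    if "i < length xs" for i
    using xs(1) that unfolding regular_sequence_def by blast
  have "nonzerodivisor_mod ?R M (ideal_smult ?R (Idl\<^bsub>?R\<^esub> (set (take 0 xs))) M) (xs ! 0)"
    using nzd[of 0] xs(2) by linarith
  then have reg0: "\<forall>m\<in>carrier M. p \<bullet> m = \<zero>\<^bsub>M\<^esub> \<longrightarrow> m = \<zero>\<^bsub>M\<^esub>"
    using nonzerodivisor_mod_iff[OF pq(1)] ideal_smult_empty[OF module_axioms] by simp
  have "nonzerodivisor_mod ?R M (ideal_smult ?R (Idl\<^bsub>?R\<^esub> (set (take 1 xs))) M) (xs ! 1)"
    using nzd[of 1] xs(2) by linarith
  moreover have "take 1 xs = [residue_class p]"
    using xs(2) pq(1) by (cases xs) auto
  ultimately have reg1: "\<forall>m\<in>carrier M. q \<bullet> m \<in> act p ` carrier M \<longrightarrow> m \<in> act p ` carrier M"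
    using nonzerodivisor_mod_iff[OF pq(2)] ideal_smult_singleton[OF module_axioms residue_class_closed[of p]]
    by (simp add: act_def)
  show thesis
  proof (rule that[of p q])
    show "p $ 0 $ 0 $ 0 = 0" "q $ 0 $ 0 $ 0 = 0"
    proof -
      have "xs ! 0 \<in> set xs" "xs ! 1 \<in> set xs" by (rule nth_mem, use xs(2) in linarith)+
      then show "p $ 0 $ 0 $ 0 = 0" "q $ 0 $ 0 $ 0 = 0" unfolding pq by (auto intro: nonunit)
    qed
    show "\<exists>w\<in>carrier M. u = p \<bullet> w" if "u \<in> carrier M" "v \<in> carrier M" "q \<bullet> u = p \<bullet> v" for u v
      using reg1 that by blast
  qed (use reg0 in blast)
qed

lemma MCM_free:
  assumes MCM: "MCM_module hypersurface_ring M"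
    and dim: "2 \<le> krull_dim (hypersurface_ring :: 'k fps fps fps set ring)"
  obtains E where "finite E" "E \<subseteq> carrier M" "carrier M \<subseteq> S.combinations E"
    "\<And>s e. S.lincomb E s = \<zero>\<^bsub>M\<^esub> \<Longrightarrow> e \<in> E \<Longrightarrow> s e = 0"
proof -
  have fg: "fin_gen_module hypersurface_ring M" using MCM by (simp add: MCM_module_def)
  obtain G where G: "finite G" "G \<subseteq> carrier M" "carrier M \<subseteq> S.combinations G"
    by (rule fin_gen_over_fps2[OF fg])
  show thesis
  proof (rule MCM_regular_pair[OF MCM dim])
    fix p q
    assume pq: "p $ 0 $ 0 $ 0 = 0" "q $ 0 $ 0 $ 0 = 0"
      "\<And>m. m \<in> carrier M \<Longrightarrow> p \<bullet> m = \<zero>\<^bsub>M\<^esub> \<Longrightarrow> m = \<zero>\<^bsub>M\<^esub>"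
      "\<And>u v. u \<in> carrier M \<Longrightarrow> v \<in> carrier M \<Longrightarrow> q \<bullet> u = p \<bullet> v \<Longrightarrow> \<exists>w\<in>carrier M. u = p \<bullet> w"
    show thesis
      by (rule S.free_of_regular[OF G, folded ps_x_def ps_y_def, OF y_regular[OF fg pq] x_regular_mod_y[OF fg pq]])
         (assumption+, rule that, assumption+)
  qed
qed

end

section \<open>The ideal of a matrix factorization\<close>

text \<open>Nakayama's lemma for the ideal \<open>(u, v, w)\<close>, in a dual form. If no nonzero linear form on \<open>k\<^sup>3\<close> kills
  the constant terms of all \<open>(r, s, t)\<close> with \<open>r u + s v + t w \<in> J\<close>, then three such linear forms, chosen
  one after the other, provide unit pivots for an elimination.\<close>

lemma mem_ideal_by_linear_forms:
  fixes J :: "'k::field fps fps fps set"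
  assumes J: "is_type_ideal J"
    and forms: "\<And>\<alpha> \<beta> \<gamma>. (\<alpha>, \<beta>, \<gamma>) \<noteq> (0, 0, 0) \<Longrightarrow>
      \<exists>r s t. r * u + s * v + t * w \<in> J \<and> \<alpha> * r $ 0 $ 0 $ 0 + \<beta> * s $ 0 $ 0 $ 0 + \<gamma> * t $ 0 $ 0 $ 0 \<noteq> 0"
  shows "u \<in> J \<and> v \<in> J \<and> w \<in> J"
proof -
  obtain r s t where 1: "r * u + s * v + t * w \<in> J" "r $ 0 $ 0 $ 0 \<noteq> 0"
    using forms[of 1 0 0] by auto
  obtain r' where r': "r * r' = 1" by (rule fps3_unit[OF 1(2)])
  define a b where "a = r' * s" "b = r' * t"
  have "r' * (r * u + s * v + t * w) = (r * r') * u + a * v + b * w"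
    by (simp add: a_b_def algebra_simps)
  then have e1: "u + a * v + b * w \<in> J" using type_ideal_mult[OF J 1(1), of r'] r' by simp
  define a0 b0 where "a0 = a $ 0 $ 0 $ 0" "b0 = b $ 0 $ 0 $ 0"
  \<comment> \<open>The linear forms in this step and the next kill the elements already found.\<close>
  obtain r2 s2 t2 where 2: "r2 * u + s2 * v + t2 * w \<in> J" "a0 * r2 $ 0 $ 0 $ 0 - s2 $ 0 $ 0 $ 0 \<noteq> 0"
    using forms[of a0 "-1" 0] by auto
  have "(s2 - r2 * a) $ 0 $ 0 $ 0 \<noteq> 0" using 2(2) by (simp add: a0_b0_def mult.commute)
  then obtain s' where s': "(s2 - r2 * a) * s' = 1" by (rule fps3_unit)
  define c where "c = s' * (t2 - r2 * b)"
  have "s' * ((r2 * u + s2 * v + t2 * w) - r2 * (u + a * v + b * w)) = ((s2 - r2 * a) * s') * v + c * w"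
    by (simp add: c_def algebra_simps)
  then have e2: "v + c * w \<in> J"
    using type_ideal_mult[OF J type_ideal_diff[OF J 2(1) type_ideal_mult[OF J e1, of r2]], of s'] s' by simp
  define c0 where "c0 = c $ 0 $ 0 $ 0"
  obtain r3 s3 t3 where 3: "r3 * u + s3 * v + t3 * w \<in> J"
    "(a0 * c0 - b0) * r3 $ 0 $ 0 $ 0 + (- c0) * s3 $ 0 $ 0 $ 0 + 1 * t3 $ 0 $ 0 $ 0 \<noteq> 0"
    using forms[of "a0 * c0 - b0" "- c0" 1] by auto
  let ?d = "t3 - r3 * b - (s3 - r3 * a) * c"
  have "?d $ 0 $ 0 $ 0 \<noteq> 0" using 3(2) by (simp add: a0_b0_def c0_def algebra_simps)
  then obtain d where d: "?d * d = 1" by (rule fps3_unit)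
  have "d * ((r3 * u + s3 * v + t3 * w) - r3 * (u + a * v + b * w) - (s3 - r3 * a) * (v + c * w))
    = (?d * d) * w"
    by (simp add: algebra_simps)
  then have w: "w \<in> J"
    using type_ideal_mult[OF J type_ideal_diff[OF J type_ideal_diff[OF J 3(1)
      type_ideal_mult[OF J e1, of r3]] type_ideal_mult[OF J e2, of "s3 - r3 * a"]], of d] d by simp
  have v: "v \<in> J" using type_ideal_diff[OF J e2 type_ideal_mult[OF J w, of c]] by simp
  have "u \<in> J"
    using type_ideal_diff[OF J type_ideal_diff[OF J e1 type_ideal_mult[OF J w, of b]] type_ideal_mult[OF J v, of a]]
    by simp
  then show ?thesis using v w by blast
qed

text \<open>The expansion \<open>s = b y + t\<^sub>1 x + t\<^sub>2 y\<^sup>2\<close>, in which only the term \<open>b y\<close> lies outside \<open>(x, y\<^sup>2)\<close>.\<close>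

lemma fps2_taylor:
  fixes s :: "'k::field fps fps"
  assumes "s $ 0 $ 0 = 0"
  obtains t\<^sub>1 t\<^sub>2 where
    "fps_const s = fps_const (fps_const (fps_const (s $ 1 $ 0))) * ps_y + t\<^sub>1 * ps_x + t\<^sub>2 * ps_y ^ 2"
    "t\<^sub>1 $ 0 $ 0 $ 0 = s $ 0 $ 1" "t\<^sub>2 $ 0 $ 0 $ 0 = s $ 2 $ 0"
proof -
  let ?t = "fps_const (fps_shift 1 (s $ 0)) + y2 * fps_const (fps_shift 1 (s $ 1))"
  have s: "s = fps_const (fps_const (s $ 1 $ 0)) * y2 + ?t * x2 + fps_shift 2 s * y2 ^ 2"
  proof (intro fps_ext)
    fix i j
    consider "i = 0" | "i = 1" | l where "i = Suc (Suc l)" by (metis One_nat_def not0_implies_Suc)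
    then show "s $ i $ j = (fps_const (fps_const (s $ 1 $ 0)) * y2 + ?t * x2 + fps_shift 2 s * y2 ^ 2) $ i $ j"
      by cases (use assms in \<open>auto simp: fps_X_power_mult_right_nth distrib_right mult.assoc\<close>)
  qed
  have "fps_const s = fps_const (fps_const (fps_const (s $ 1 $ 0)) * y2 + ?t * x2 + fps_shift 2 s * y2 ^ 2)"
    using s by (rule arg_cong)
  also have "\<dots> = fps_const (fps_const (fps_const (s $ 1 $ 0))) * ps_y + fps_const ?t * ps_x
      + fps_const (fps_shift 2 s) * ps_y ^ 2"
    by (simp only: ps_x_def ps_y_def fps_const_add[symmetric] fps_const_mult[symmetric] fps_const_power)
  finally show thesis by (rule that) (simp_all add: numeral_2_eq_2)
qed

context
  fixes E :: "'i set" and \<phi> :: "'i \<Rightarrow> 'i \<Rightarrow> 'k::field fps fps" and J :: "'k fps fps fps set"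
  assumes finE: "finite E" and neE: "E \<noteq> {}" and two: "(2::'k) \<noteq> 0"
    and sq: "\<And>i j. i \<in> E \<Longrightarrow> j \<in> E \<Longrightarrow> (\<Sum>l\<in>E. \<phi> i l * \<phi> l j) = (if i = j then - branch_eq else 0)"
    and J: "is_type_ideal J"
    and entries: "\<And>i j. i \<in> E \<Longrightarrow> j \<in> E \<Longrightarrow> fps_const (\<phi> i j) + (if i = j then ps_z else 0) \<in> J"
begin

definition anticomm :: "('i \<Rightarrow> 'i \<Rightarrow> 'k) \<Rightarrow> ('i \<Rightarrow> 'i \<Rightarrow> 'k) \<Rightarrow> 'i \<Rightarrow> 'i \<Rightarrow> 'k" where
  "anticomm A B i j = (\<Sum>l\<in>E. A i l * B l j + B i l * A l j)"

lemma anticomm_cong: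
  assumes "\<And>i j. i \<in> E \<Longrightarrow> j \<in> E \<Longrightarrow> A i j = A' i j" "i \<in> E" "j \<in> E"
  shows "anticomm A B i j = anticomm A' B i j"
  unfolding anticomm_def by (rule sum.cong) (use assms in auto)

lemma anticomm_scale: "anticomm (\<lambda>i j. \<nu> * A i j) B i j = \<nu> * anticomm A B i j"
  by (simp add: anticomm_def sum_distrib_left algebra_simps)

lemma anticomm_add: "anticomm (\<lambda>i j. A i j + A' i j) B i j = anticomm A B i j + anticomm A' B i j"
  by (simp add: anticomm_def sum.distrib[symmetric] algebra_simps)

lemma anticomm_unit:
  assumes "i \<in> E" "j \<in> E"
  shows "anticomm (\<lambda>i j. if i = j then 1 else 0) B i j = 2 * B i j"
proof -
  have "anticomm (\<lambda>i j. if i = j then 1 else 0) B i j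
      = (\<Sum>l\<in>E. if i = l then B l j else 0) + (\<Sum>l\<in>E. if l = j then B i l else 0)"
    unfolding anticomm_def sum.distrib[symmetric] by (rule sum.cong) auto
  then show ?thesis using assms finE by (simp add: sum.delta sum.delta')
qed

definition coef :: "nat \<Rightarrow> nat \<Rightarrow> 'i \<Rightarrow> 'i \<Rightarrow> 'k" where
  "coef n m i j = \<phi> i j $ n $ m"

text \<open>If \<open>\<phi>\<close> has no constant term, comparing the coefficients in \<open>\<phi>\<^sup>2 = -(x\<^sup>3 + y\<^sup>4)\<close> up to degree four
  gives these anticommutators.\<close>

lemma square_coefficients:
  assumes c0: "\<And>i j. i \<in> E \<Longrightarrow> j \<in> E \<Longrightarrow> coef 0 0 i j = 0" and ij: "i \<in> E" "j \<in> E"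
  shows "anticomm (coef 0 1) (coef 0 1) i j = 0"
    and "anticomm (coef 1 0) (coef 0 1) i j = 0"
    and "anticomm (coef 0 1) (coef 0 2) i j = (if i = j then -1 else 0)"
    and "anticomm (coef 0 1) (coef 1 1) i j + anticomm (coef 1 0) (coef 0 2) i j = 0"
    and "anticomm (coef 0 1) (coef 2 0) i j + anticomm (coef 1 0) (coef 1 1) i j = 0"
    and "anticomm (coef 1 0) (coef 2 0) i j = 0"
    and "anticomm (coef 2 0) (coef 2 0) i j + 2 * anticomm (coef 1 0) (coef 3 0) i j = (if i = j then -2 else 0)"
proof -
  have nth: "(\<Sum>l\<in>E. (\<phi> i l * \<phi> l j) $ n $ m) = (if i = j then - (branch_eq $ n $ m) else 0)" for n m
    using arg_cong[OF sq[OF ij], of "\<lambda>s. s $ n $ m"] by (simp add: fps_sum_nth)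
  have z: "\<phi> i l $ 0 $ 0 = 0" "\<phi> l j $ 0 $ 0 = 0" if "l \<in> E" for l
    using c0 that ij by (auto simp: coef_def)
  have b: "branch_eq $ n $ m = (if (n, m) = (0, 3) \<or> (n, m) = (4, 0) then 1 else (0::'k))" for n m
    by (auto simp: branch_eq_def fps_const_power fps_X_power_nth)
  note simps = fps_mult_nth eval_nat_numeral z coef_def
  have "anticomm (coef 0 1) (coef 0 1) i j = 2 * (\<Sum>l\<in>E. (\<phi> i l * \<phi> l j) $ 0 $ 2)"
    unfolding anticomm_def sum_distrib_left by (rule sum.cong) (simp_all add: simps)
  then show "anticomm (coef 0 1) (coef 0 1) i j = 0" unfolding nth b by simp
  have "anticomm (coef 1 0) (coef 0 1) i j = (\<Sum>l\<in>E. (\<phi> i l * \<phi> l j) $ 1 $ 1)"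
    unfolding anticomm_def by (rule sum.cong) (simp_all add: simps)
  then show "anticomm (coef 1 0) (coef 0 1) i j = 0" unfolding nth b by simp
  have "anticomm (coef 0 1) (coef 0 2) i j = (\<Sum>l\<in>E. (\<phi> i l * \<phi> l j) $ 0 $ 3)"
    unfolding anticomm_def by (rule sum.cong) (simp_all add: simps)
  then show "anticomm (coef 0 1) (coef 0 2) i j = (if i = j then -1 else 0)" unfolding nth b by simp
  have "anticomm (coef 0 1) (coef 1 1) i j + anticomm (coef 1 0) (coef 0 2) i j = (\<Sum>l\<in>E. (\<phi> i l * \<phi> l j) $ 1 $ 2)"
    unfolding anticomm_def sum.distrib[symmetric] by (rule sum.cong) (simp_all add: simps)
  then show "anticomm (coef 0 1) (coef 1 1) i j + anticomm (coef 1 0) (coef 0 2) i j = 0" unfolding nth b by simp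
  have "anticomm (coef 0 1) (coef 2 0) i j + anticomm (coef 1 0) (coef 1 1) i j = (\<Sum>l\<in>E. (\<phi> i l * \<phi> l j) $ 2 $ 1)"
    unfolding anticomm_def sum.distrib[symmetric] by (rule sum.cong) (simp_all add: simps)
  then show "anticomm (coef 0 1) (coef 2 0) i j + anticomm (coef 1 0) (coef 1 1) i j = 0" unfolding nth b by simp
  have "anticomm (coef 1 0) (coef 2 0) i j = (\<Sum>l\<in>E. (\<phi> i l * \<phi> l j) $ 3 $ 0)"
    unfolding anticomm_def by (rule sum.cong) (simp_all add: simps)
  then show "anticomm (coef 1 0) (coef 2 0) i j = 0" unfolding nth b by simp
  have "anticomm (coef 2 0) (coef 2 0) i j + 2 * anticomm (coef 1 0) (coef 3 0) i j = 2 * (\<Sum>l\<in>E. (\<phi> i l * \<phi> l j) $ 4 $ 0)"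
    unfolding anticomm_def sum_distrib_left sum.distrib[symmetric] by (rule sum.cong) (simp_all add: simps)
  then show "anticomm (coef 2 0) (coef 2 0) i j + 2 * anticomm (coef 1 0) (coef 3 0) i j = (if i = j then -2 else 0)"
    unfolding nth b by simp
qed

text \<open>If \<open>J\<close> is proper, the constant terms of the entries vanish. Consider a linear form
  \<open>(\<alpha>, \<beta>, \<gamma>)\<close> that kills the combinations \<open>r x + s y\<^sup>2 + t z\<close> in \<open>J\<close>. Let \<open>A\<close>, \<open>B\<close>, \<open>C\<close> be the coefficient
  matrices of \<open>\<phi>\<close> at \<open>x\<close>, \<open>y\<close> and \<open>y\<^sup>2\<close>. If \<open>B = 0\<close>, one gets \<open>\<alpha> A + \<beta> C + \<gamma> = 0\<close>. Otherwise the
  multiples by \<open>y\<close> of the entries give \<open>\<beta> = 0\<close>, and eliminating \<open>y\<close> between the entries gives that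
  \<open>\<alpha> A + \<gamma>\<close> is a multiple of \<open>B\<close>. In both cases, the anticommutator with \<open>A\<close> gives \<open>\<gamma> = 0\<close>. Then the
  degree 4 part of the equation for \<open>\<phi>\<^sup>2\<close> excludes \<open>\<beta> \<noteq> 0\<close> in the first case, and the cubic part
  excludes that \<open>A\<close> is a multiple of \<open>B\<close> in the second.\<close>

lemma ideal_of_matrix_factorization:
  shows "ps_x \<in> J \<and> ps_y ^ 2 \<in> J \<and> ps_z \<in> J"
proof (cases "\<exists>p\<in>J. p $ 0 $ 0 $ 0 \<noteq> 0")
  case True
  then obtain p q where "p \<in> J" "p * q = 1" using fps3_unit by metis
  then have "1 \<in> J" using type_ideal_mult_right[OF J] by metis
  then have "p \<in> J" for p using type_ideal_mult[OF J, of 1 p] by simp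
  then show ?thesis by blast
next
  case False
  then have proper: "p $ 0 $ 0 $ 0 = 0" if "p \<in> J" for p using that by blast
  have c0: "coef 0 0 i j = 0" if "i \<in> E" "j \<in> E" for i j
    using proper[OF entries[OF that]] by (auto simp: coef_def ps_z_def split: if_splits)
  note sc = square_coefficients[OF c0]
  let ?\<delta> = "\<lambda>i j :: 'i. if i = j then 1 else (0::'k)"
  define cc where "cc = (\<lambda>a :: 'k. fps_const (fps_const (fps_const a)))"
  have cc0: "cc a $ 0 $ 0 $ 0 = a" for a by (simp add: cc_def)
  have "\<exists>t\<^sub>1 t\<^sub>2. fps_const (\<phi> i j) = cc (coef 1 0 i j) * ps_y + t\<^sub>1 * ps_x + t\<^sub>2 * ps_y ^ 2 \<and>
      t\<^sub>1 $ 0 $ 0 $ 0 = coef 0 1 i j \<and> t\<^sub>2 $ 0 $ 0 $ 0 = coef 2 0 i j" if "i \<in> E" "j \<in> E" for i j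
    using fps2_taylor[of "\<phi> i j"] c0[OF that] unfolding coef_def cc_def by metis
  then obtain t\<^sub>1 t\<^sub>2 where t: "\<And>i j. i \<in> E \<Longrightarrow> j \<in> E \<Longrightarrow>
      fps_const (\<phi> i j) = cc (coef 1 0 i j) * ps_y + t\<^sub>1 i j * ps_x + t\<^sub>2 i j * ps_y ^ 2"
    "\<And>i j. i \<in> E \<Longrightarrow> j \<in> E \<Longrightarrow> t\<^sub>1 i j $ 0 $ 0 $ 0 = coef 0 1 i j"
    "\<And>i j. i \<in> E \<Longrightarrow> j \<in> E \<Longrightarrow> t\<^sub>2 i j $ 0 $ 0 $ 0 = coef 2 0 i j"
    by metis
  have entry: "cc (coef 1 0 i j) * ps_y + t\<^sub>1 i j * ps_x + t\<^sub>2 i j * ps_y ^ 2 + cc (?\<delta> i j) * ps_z \<in> J"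
    if "i \<in> E" "j \<in> E" for i j
    using entries[OF that] t(1)[OF that] by (auto simp: cc_def split: if_splits)
  obtain e where e: "e \<in> E" using neE by blast
  have A_nz: "\<exists>i\<in>E. \<exists>j\<in>E. coef 0 1 i j \<noteq> 0"
  proof (rule ccontr)
    assume "\<not> ?thesis"
    then have "anticomm (coef 0 1) (coef 0 2) e e = 0"
      using e by (auto simp: anticomm_def intro!: sum.neutral)
    then show False using sc(3)[OF _ _ e e] by simp
  qed
  show ?thesis
  proof (rule mem_ideal_by_linear_forms[OF J], rule ccontr)
    fix \<alpha> \<beta> \<gamma> :: 'k
    assume nz: "(\<alpha>, \<beta>, \<gamma>) \<noteq> (0, 0, 0)"
    assume "\<not> (\<exists>r s t. r * ps_x + s * ps_y ^ 2 + t * ps_z \<in> J \<and>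
      \<alpha> * r $ 0 $ 0 $ 0 + \<beta> * s $ 0 $ 0 $ 0 + \<gamma> * t $ 0 $ 0 $ 0 \<noteq> 0)"
    then have kill: "\<alpha> * r $ 0 $ 0 $ 0 + \<beta> * s $ 0 $ 0 $ 0 + \<gamma> * t $ 0 $ 0 $ 0 = 0"
      if "r * ps_x + s * ps_y ^ 2 + t * ps_z \<in> J" for r s t using that by blast
    show False
    proof (cases "\<forall>i\<in>E. \<forall>j\<in>E. coef 1 0 i j = 0")
      case True
      have lin: "\<alpha> * coef 0 1 i j + \<beta> * coef 2 0 i j + \<gamma> * ?\<delta> i j = 0" if "i \<in> E" "j \<in> E" for i j
        using kill[of "t\<^sub>1 i j" "t\<^sub>2 i j" "cc (?\<delta> i j)"] entry[OF that] True that t(2,3)[OF that]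
        by (simp add: cc_def)
      have zero: "anticomm (coef 1 0) B i j = 0" if "i \<in> E" "j \<in> E" for B i j
        using True that by (auto simp: anticomm_def intro!: sum.neutral)
      have "\<gamma> * (2 * coef 0 1 i j) = 0" if ij: "i \<in> E" "j \<in> E" for i j
      proof -
        have "0 = anticomm (\<lambda>i j. (\<alpha> * coef 0 1 i j + \<beta> * coef 2 0 i j) + \<gamma> * ?\<delta> i j) (coef 0 1) i j"
          unfolding anticomm_def by (rule sum.neutral[symmetric]) (use lin ij in auto)
        also have "\<dots> = \<alpha> * anticomm (coef 0 1) (coef 0 1) i j + \<beta> * anticomm (coef 2 0) (coef 0 1) i j
            + \<gamma> * (2 * coef 0 1 i j)"
          unfolding anticomm_add anticomm_scale anticomm_unit[OF ij] ..
        also have "anticomm (coef 2 0) (coef 0 1) i j = anticomm (coef 0 1) (coef 2 0) i j"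
          by (simp add: anticomm_def add.commute)
        finally show ?thesis using sc(1)[OF _ _ ij] sc(5)[OF _ _ ij] zero[OF ij] by simp
      qed
      then have \<gamma>: "\<gamma> = 0" using A_nz two by auto
      have "\<beta> = 0"
      proof -
        have "(\<Sum>l\<in>E. (\<beta> * coef 2 0 e l) * (\<beta> * coef 2 0 l e)) = (\<Sum>l\<in>E. (\<alpha> * coef 0 1 e l) * (\<alpha> * coef 0 1 l e))"
        proof (rule sum.cong)
          fix l assume l: "l \<in> E"
          have "\<beta> * coef 2 0 e l = - (\<alpha> * coef 0 1 e l)" "\<beta> * coef 2 0 l e = - (\<alpha> * coef 0 1 l e)"
            using lin[OF e l] lin[OF l e] \<gamma> by (simp_all add: eq_neg_iff_add_eq_0 add.commute)
          then show "(\<beta> * coef 2 0 e l) * (\<beta> * coef 2 0 l e) = (\<alpha> * coef 0 1 e l) * (\<alpha> * coef 0 1 l e)" by simp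
        qed simp
        then have "\<beta> ^ 2 * anticomm (coef 2 0) (coef 2 0) e e = \<alpha> ^ 2 * anticomm (coef 0 1) (coef 0 1) e e"
          by (simp add: anticomm_def sum_distrib_left power2_eq_square algebra_simps flip: mult_2)
             (simp add: mult_2[symmetric] sum_distrib_left[symmetric] mult.left_commute)
        then show ?thesis using sc(1,7)[OF _ _ e e] zero[OF e e] two by simp
      qed
      then have "\<alpha> = 0" using lin A_nz \<gamma> by auto
      then show False using nz \<open>\<beta> = 0\<close> \<gamma> by simp
    next
      case False
      then obtain p q where pq: "p \<in> E" "q \<in> E" "coef 1 0 p q \<noteq> 0" by blast
      let ?b = "coef 1 0 p q"
      have "(ps_y * t\<^sub>1 p q) * ps_x + (cc ?b + ps_y * t\<^sub>2 p q) * ps_y ^ 2 + (ps_y * cc (?\<delta> p q)) * ps_z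
         = ps_y * (cc ?b * ps_y + t\<^sub>1 p q * ps_x + t\<^sub>2 p q * ps_y ^ 2 + cc (?\<delta> p q) * ps_z)"
        by (simp add: algebra_simps power2_eq_square)
      also have "\<dots> \<in> J" by (intro type_ideal_mult[OF J] entry pq)
      finally have "\<beta> * ?b = 0" using kill by (fastforce simp: cc0 ps_y_def)
      then have \<beta>: "\<beta> = 0" using pq by simp
      define \<mu> where "\<mu> = \<alpha> * coef 0 1 p q + \<gamma> * ?\<delta> p q"
      have lin: "?b * (\<alpha> * coef 0 1 i j + \<gamma> * ?\<delta> i j) = \<mu> * coef 1 0 i j" if ij: "i \<in> E" "j \<in> E" for i j
      proof -
        let ?c = "coef 1 0 i j"
        let ?r = "cc ?b * t\<^sub>1 i j - cc ?c * t\<^sub>1 p q" and ?s = "cc ?b * t\<^sub>2 i j - cc ?c * t\<^sub>2 p q"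
          and ?t = "cc ?b * cc (?\<delta> i j) - cc ?c * cc (?\<delta> p q)"
        have "?r * ps_x + ?s * ps_y ^ 2 + ?t * ps_z =
           cc ?b * (cc ?c * ps_y + t\<^sub>1 i j * ps_x + t\<^sub>2 i j * ps_y ^ 2 + cc (?\<delta> i j) * ps_z)
         - cc ?c * (cc ?b * ps_y + t\<^sub>1 p q * ps_x + t\<^sub>2 p q * ps_y ^ 2 + cc (?\<delta> p q) * ps_z)"
          by (simp add: algebra_simps)
        also have "\<dots> \<in> J" by (intro type_ideal_diff[OF J] type_ideal_mult[OF J] entry pq ij)
        finally have "\<alpha> * ?r $ 0 $ 0 $ 0 + \<beta> * ?s $ 0 $ 0 $ 0 + \<gamma> * ?t $ 0 $ 0 $ 0 = 0" by (rule kill)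
        then have "\<alpha> * (?b * coef 0 1 i j - ?c * coef 0 1 p q) + \<gamma> * (?b * ?\<delta> i j - ?c * ?\<delta> p q) = 0"
          using \<beta> t(2)[OF ij] t(2)[OF pq(1,2)] by (simp add: cc0 del: mult_1_right)
        then show ?thesis by (simp add: \<mu>_def algebra_simps split del: if_split)
      qed
      have "?b * (\<gamma> * (2 * coef 0 1 i j)) = 0" if ij: "i \<in> E" "j \<in> E" for i j
      proof -
        have "\<mu> * anticomm (coef 1 0) (coef 0 1) i j
          = anticomm (\<lambda>i j. ?b * (\<alpha> * coef 0 1 i j + \<gamma> * ?\<delta> i j)) (coef 0 1) i j"
          unfolding anticomm_scale[symmetric] by (rule anticomm_cong) (use lin ij in auto)
        also have "\<dots> = ?b * (\<alpha> * anticomm (coef 0 1) (coef 0 1) i j + \<gamma> * (2 * coef 0 1 i j))"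
          unfolding anticomm_add anticomm_scale anticomm_unit[OF ij] ..
        finally show ?thesis using sc(1,2)[OF _ _ ij] by simp
      qed
      then have \<gamma>: "\<gamma> = 0" using A_nz two pq(3) by auto
      then have \<alpha>: "\<alpha> \<noteq> 0" using nz \<beta> by simp
      define \<nu> where "\<nu> = \<mu> / (?b * \<alpha>)"
      have AB: "coef 0 1 i j = \<nu> * coef 1 0 i j" if "i \<in> E" "j \<in> E" for i j
        using lin[OF that] \<gamma> \<alpha> pq(3) by (simp add: \<nu>_def field_simps)
      have anti: "anticomm (coef 0 1) B e e = \<nu> * anticomm (coef 1 0) B e e" for B
        unfolding anticomm_scale[symmetric] by (rule anticomm_cong) (use AB e in auto)
      have "anticomm (coef 1 0) (coef 1 1) e e = 0"
        using sc(5,6)[OF _ _ e e] anti by simp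
      then have "anticomm (coef 1 0) (coef 0 2) e e = 0"
        using sc(4)[OF _ _ e e] anti by simp
      then show False using sc(3)[OF _ _ e e] anti by simp
    qed
  qed
qed

end

section \<open>Linear forms on a maximal Cohen-Macaulay module\<close>

context hyp_module
begin

text \<open>For a basis \<open>E\<close> of \<open>M\<close> over \<open>S = k[[x, y]]\<close> and \<open>i \<in> E\<close>, the coordinate \<open>\<lambda>\<close> at \<open>i\<close> is an
  \<open>S\<close>-linear form on \<open>M\<close>, and \<open>m \<mapsto> \<lambda>(z m) + \<lambda>(m) z\<close> is \<open>R\<close>-linear. On the basis, these forms take the
  values \<open>\<phi>\<^sub>i\<^sub>j + \<delta>\<^sub>i\<^sub>j z\<close>, where \<open>\<phi>\<close> is the matrix of the multiplication by \<open>z\<close>.\<close>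

lemma MCM_test_ideal_contains:
  assumes MCM: "MCM_module hypersurface_ring M" and two: "(2::'k) \<noteq> 0"
    and dim: "2 \<le> krull_dim (hypersurface_ring :: 'k fps fps fps set ring)"
  shows "residue_class ps_x \<in> test_ideal TYPE('v) hypersurface_ring M \<and>
    residue_class (ps_y ^ 2) \<in> test_ideal TYPE('v) hypersurface_ring M \<and>
    residue_class ps_z \<in> test_ideal TYPE('v) hypersurface_ring M"
proof (rule MCM_free[OF MCM dim])
  fix E assume E: "finite E" "E \<subseteq> carrier M" and gen: "carrier M \<subseteq> S.combinations E"
    and indep: "\<And>s e. S.lincomb E s = \<zero>\<^bsub>M\<^esub> \<Longrightarrow> e \<in> E \<Longrightarrow> s e = 0"
  have EC: "e \<in> carrier M" if "e \<in> E" for e using E(2) that by blast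
  have neE: "E \<noteq> {}"
  proof
    assume "E = {}"
    moreover have "S.combinations {} \<subseteq> {\<zero>\<^bsub>M\<^esub>}"
      by (rule S.combinations_least) (auto simp: S.act_submodule_def)
    ultimately have "carrier M \<subseteq> {\<zero>\<^bsub>M\<^esub>}" using gen by blast
    then show False using MCM by (auto simp: MCM_module_def)
  qed
  define co where "co m = (SOME s. S.lincomb E s = m)" for m
  have co: "S.lincomb E (co m) = m" if "m \<in> carrier M" for m
  proof -
    have "\<exists>s. m = S.lincomb E s" using S.combinations_lincombE[OF E] gen that by blast
    then show ?thesis unfolding co_def by (metis (mono_tags) someI_ex)
  qed
  have coI: "co m e = s e" if "S.lincomb E s = m" "m \<in> carrier M" "e \<in> E" for s m e
    using indep[of "\<lambda>e. co m e - s e" e] that co[OF that(2)]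
    by (simp add: S.lincomb_diff[OF E] S.diff_eq_zero_iff)
  have co_add: "co (m \<oplus>\<^bsub>M\<^esub> n) e = co m e + co n e" if "m \<in> carrier M" "n \<in> carrier M" "e \<in> E" for m n e
    using that by (intro coI) (auto simp: S.lincomb_add[OF E] co)
  have co_act: "co (fps_const s \<bullet> m) e = s * co m e" if "m \<in> carrier M" "e \<in> E" for s m e
    using that by (intro coI) (auto simp: S.lincomb_act[OF E] co)
  have co_single: "co j i = (if i = j then 1 else 0)" if "i \<in> E" "j \<in> E" for i j
    by (rule coI) (use that EC S.lincomb_single[OF E] in auto)
  have co_finsum: "co (\<Oplus>\<^bsub>M\<^esub>l\<in>F. f l) e = (\<Sum>l\<in>F. co (f l) e)"
    if "finite F" "f \<in> F \<rightarrow> carrier M" "e \<in> E" for F f e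
    using that
  proof (induction F rule: finite_induct)
    case empty
    then show ?case using co_act[of "\<zero>\<^bsub>M\<^esub>" e 0] by simp
  next
    case (insert a F)
    then have "f \<in> F \<rightarrow> carrier M" "f a \<in> carrier M" by auto
    with insert show ?case by (simp add: co_add)
  qed
  define \<phi> where "\<phi> i j = co (ps_z \<bullet> j) i" for i j
  have sq: "(\<Sum>l\<in>E. \<phi> i l * \<phi> l j) = (if i = j then - branch_eq else 0)" if ij: "i \<in> E" "j \<in> E" for i j
  proof -
    have zj: "ps_z \<bullet> j \<in> carrier M" using EC ij by blast
    have "ps_z \<bullet> ps_z \<bullet> j = ps_z \<bullet> (\<Oplus>\<^bsub>M\<^esub>l\<in>E. fps_const (\<phi> l j) \<bullet> l)"
      using co[OF zj] by (simp add: \<phi>_def S.lincomb_def)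
    also have "\<dots> = (\<Oplus>\<^bsub>M\<^esub>l\<in>E. ps_z \<bullet> fps_const (\<phi> l j) \<bullet> l)"
      by (rule A.act_finsum) (use E in auto)
    finally have "co (ps_z \<bullet> ps_z \<bullet> j) i = (\<Sum>l\<in>E. co (ps_z \<bullet> fps_const (\<phi> l j) \<bullet> l) i)"
      using co_finsum[OF E(1), of "\<lambda>l. ps_z \<bullet> fps_const (\<phi> l j) \<bullet> l" i] EC ij by auto
    also have "\<dots> = (\<Sum>l\<in>E. \<phi> i l * \<phi> l j)"
    proof (rule sum.cong)
      fix l assume l: "l \<in> E"
      have "ps_z \<bullet> fps_const (\<phi> l j) \<bullet> l = fps_const (\<phi> l j) \<bullet> ps_z \<bullet> l"
        by (rule A.act_left_commute[OF EC[OF l]])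
      then show "co (ps_z \<bullet> fps_const (\<phi> l j) \<bullet> l) i = \<phi> i l * \<phi> l j"
        using co_act[of "ps_z \<bullet> l" i] EC[OF l] ij by (simp add: \<phi>_def mult.commute)
    qed simp
    finally show ?thesis
      using act_z_z[OF EC[OF ij(2)]] co_act[OF EC[OF ij(2)] ij(1)] co_single[OF ij] by auto
  qed
  define c where "c i m = binomial_in_z (co (ps_z \<bullet> m) i) (co m i)" for i m
  have c_add: "c i (m \<oplus>\<^bsub>M\<^esub> n) = c i m + c i n" if "i \<in> E" "m \<in> carrier M" "n \<in> carrier M" for i m n
    using that by (simp add: c_def A.act_add_right co_add algebra_simps flip: fps_const_add)
  have c_act: "c i (fps_const s \<bullet> m) = fps_const s * c i m" if "i \<in> E" "m \<in> carrier M" for i s m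
    using that by (simp add: c_def A.act_left_commute[of _ ps_z] co_act algebra_simps flip: fps_const_mult)
  have c_z: "c i (ps_z \<bullet> m) = ps_z * c i m - hyp_eq * fps_const (co m i)" if "i \<in> E" "m \<in> carrier M" for i m
  proof -
    have "co (ps_z \<bullet> ps_z \<bullet> m) i = - branch_eq * co m i"
      unfolding act_z_z[OF that(2)] by (rule co_act[OF that(2,1)])
    then show ?thesis
      by (simp add: c_def hyp_eq_branch_eq algebra_simps power2_eq_square flip: fps_const_mult fps_const_neg)
  qed
  have c_linear: "residue_class (c i (p \<bullet> m)) = residue_class (p * c i m)"
    if "i \<in> E" "m \<in> carrier M" for i p m
  proof -
    obtain a b where ab: "hyp_eq dvd p - binomial_in_z a b" by (rule normal_form_exists)
    have "c i (p \<bullet> m) = fps_const a * c i m + fps_const b * (ps_z * c i m - hyp_eq * fps_const (co m i))"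
      unfolding act_cong[OF ab] using that
      by (simp add: A.act_add_left A.act_mult c_add c_act c_z)
    moreover have "(u * w + v * (ps_z * w - hyp_eq * l)) - p * w = - ((p - (u + v * ps_z)) * w) - hyp_eq * (v * l)"
      for u v w l :: "'k fps fps fps"
      by (simp add: algebra_simps)
    ultimately have "c i (p \<bullet> m) - p * c i m
        = - ((p - binomial_in_z a b) * c i m) - hyp_eq * (fps_const b * fps_const (co m i))"
      by simp
    then have "hyp_eq dvd c i (p \<bullet> m) - p * c i m"
      using ab by (simp add: dvd_diff dvd_mult2)
    then show ?thesis by (simp add: residue_class_eq_iff)
  qed
  let ?T = "test_ideal TYPE('v) hypersurface_ring M"
  have c_mem: "residue_class (c i m) \<in> ?T" if i: "i \<in> E" and m: "m \<in> carrier M" for i m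
  proof (rule linear_form_value_in_test_ideal[OF module_axioms, where h = "\<lambda>m. residue_class (c i m)"])
    show "residue_class (c i (n \<oplus>\<^bsub>M\<^esub> n')) = residue_class (c i n) \<oplus>\<^bsub>hypersurface_ring\<^esub> residue_class (c i n')"
      if "n \<in> carrier M" "n' \<in> carrier M" for n n'
      using that i by (simp add: c_add residue_class_add)
    show "residue_class (c i (r \<odot>\<^bsub>M\<^esub> n)) = r \<otimes>\<^bsub>hypersurface_ring\<^esub> residue_class (c i n)"
      if r: "r \<in> carrier hypersurface_ring" and n: "n \<in> carrier M" for r n
    proof -
      obtain p where "r = residue_class p" using residue_class_surj[OF r] by blast
      then show ?thesis using c_linear[OF i n, of p] by (simp add: act_def residue_class_mult)
    qed
  qed (use m in auto)
  have "ps_x \<in> {p. residue_class p \<in> ?T} \<and> ps_y ^ 2 \<in> {p. residue_class p \<in> ?T} \<and> ps_z \<in> {p. residue_class p \<in> ?T}"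
  proof (rule ideal_of_matrix_factorization[OF E(1) neE two sq])
    show "is_type_ideal {p. residue_class p \<in> ?T}"
      by (intro hyp_ring_ideal_preimage test_ideal_ideal hyp_ring_cring)
    show "fps_const (\<phi> i j) + (if i = j then ps_z else 0) \<in> {p. residue_class p \<in> ?T}"
      if ij: "i \<in> E" "j \<in> E" for i j
      using c_mem[OF ij(1) EC[OF ij(2)]] co_single[OF ij] by (auto simp: c_def \<phi>_def)
  qed
  then show ?thesis by simp
qed

end

section \<open>The ideal generated by x and z + i y^2\<close>

text \<open>An ideal, as a module whose elements are renamed by an injection \<open>\<iota>\<close>. With \<open>\<iota>\<close> from \<open>R\<close> into the
  universe of the test ideals, this turns ideals of \<open>R\<close> into modules to which those test ideals
  refer.\<close>

definition renamed_ideal :: "('a, 'c) ring_scheme \<Rightarrow> ('a \<Rightarrow> 'u) \<Rightarrow> 'a set \<Rightarrow> ('a, 'u) module" where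
  "renamed_ideal R \<iota> I =
     (let \<kappa> = inv_into (carrier R) \<iota> in
      \<lparr>carrier = \<iota> ` I, monoid.mult = (\<lambda>u v. \<iota> (\<kappa> u \<otimes>\<^bsub>R\<^esub> \<kappa> v)), monoid.one = \<iota> \<one>\<^bsub>R\<^esub>, ring.zero = \<iota> \<zero>\<^bsub>R\<^esub>,
       ring.add = (\<lambda>u v. \<iota> (\<kappa> u \<oplus>\<^bsub>R\<^esub> \<kappa> v)), module.smult = (\<lambda>r u. \<iota> (r \<otimes>\<^bsub>R\<^esub> \<kappa> u))\<rparr>)"

context
  fixes R :: "('a, 'c) ring_scheme" (structure) and \<iota> :: "'a \<Rightarrow> 'u"
  assumes R: "cring R" and inj: "inj_on \<iota> (carrier R)"
begin

interpretation cring R by (rule R)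

lemma renamed_ideal_simps:
  shows "carrier (renamed_ideal R \<iota> I) = \<iota> ` I"
    and "\<zero>\<^bsub>renamed_ideal R \<iota> I\<^esub> = \<iota> \<zero>"
    and "a \<in> carrier R \<Longrightarrow> b \<in> carrier R \<Longrightarrow> \<iota> a \<oplus>\<^bsub>renamed_ideal R \<iota> I\<^esub> \<iota> b = \<iota> (a \<oplus> b)"
    and "b \<in> carrier R \<Longrightarrow> a \<odot>\<^bsub>renamed_ideal R \<iota> I\<^esub> \<iota> b = \<iota> (a \<otimes> b)"
  by (simp_all add: renamed_ideal_def Let_def inv_into_f_f[OF inj])

lemma renamed_ideal_module:
  assumes "ideal I R"
  shows "module R (renamed_ideal R \<iota> I)"
proof -
  interpret I: ideal I R by fact
  note simps = renamed_ideal_simps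
  have ab: "abelian_group (renamed_ideal R \<iota> I)"
  proof (rule abelian_groupI)
    fix u assume "u \<in> carrier (renamed_ideal R \<iota> I)"
    then obtain a where a: "a \<in> I" "u = \<iota> a" by (auto simp: simps(1))
    then have "\<iota> (\<ominus> a) \<oplus>\<^bsub>renamed_ideal R \<iota> I\<^esub> u = \<zero>\<^bsub>renamed_ideal R \<iota> I\<^esub>"
      using I.Icarr by (simp add: simps l_neg)
    then show "\<exists>v\<in>carrier (renamed_ideal R \<iota> I). v \<oplus>\<^bsub>renamed_ideal R \<iota> I\<^esub> u = \<zero>\<^bsub>renamed_ideal R \<iota> I\<^esub>"
      using a I.a_inv_closed by (auto simp: simps(1))
  qed (auto simp: simps I.Icarr a_ac intro!: imageI I.a_closed I.zero_closed)
  show ?thesis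
    by (rule moduleI[OF R ab])
       (auto simp: simps I.Icarr l_distr r_distr m_assoc intro!: imageI I.I_l_closed)
qed

lemma renamed_ideal_submodule:
  assumes I: "ideal I R" and K: "ideal K R" and KI: "K \<subseteq> I"
  shows "submodule (\<iota> ` K) R (renamed_ideal R \<iota> I)"
proof (rule module.module_incl_imp_submodule[OF renamed_ideal_module[OF I]])
  show "\<iota> ` K \<subseteq> carrier (renamed_ideal R \<iota> I)" using KI by (auto simp: renamed_ideal_simps)
  have "(renamed_ideal R \<iota> I)\<lparr>carrier := \<iota> ` K\<rparr> = renamed_ideal R \<iota> K"
    by (simp add: renamed_ideal_def Let_def)
  then show "module R ((renamed_ideal R \<iota> I)\<lparr>carrier := \<iota> ` K\<rparr>)"
    using renamed_ideal_module[OF K] by simp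
qed

end

lemma hyp_ring_ideal_image:
  assumes I: "is_type_ideal (I :: 'k::comm_ring_1 fps fps fps set)"
  shows "ideal (residue_class ` I) hypersurface_ring"
proof (rule cring.ideal_of_closed[OF hyp_ring_cring])
  show "residue_class ` I \<subseteq> carrier hypersurface_ring" by auto
  show "\<zero>\<^bsub>hypersurface_ring\<^esub> \<in> residue_class ` I"
    using type_ideal.subspace_0[OF I] residue_class_zero by (metis imageI)
  show "a \<oplus>\<^bsub>hypersurface_ring\<^esub> b \<in> residue_class ` I" if ab: "a \<in> residue_class ` I" "b \<in> residue_class ` I" for a b
  proof -
    obtain p q where "p \<in> I" "q \<in> I" "a = residue_class p" "b = residue_class q" using ab by blast
    then show ?thesis using type_ideal_add[OF I] residue_class_add by (metis imageI)
  qed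
  show "r \<otimes>\<^bsub>hypersurface_ring\<^esub> a \<in> residue_class ` I" if a: "a \<in> residue_class ` I" and r: "r \<in> carrier hypersurface_ring" for a r
  proof -
    obtain p q where "p \<in> I" "a = residue_class p" "r = residue_class q" using a residue_class_surj[OF r] by blast
    then show ?thesis using type_ideal_mult[OF I] residue_class_mult by (metis imageI)
  qed
qed

text \<open>Let \<open>i\<^sup>2 = -1\<close> and \<open>w = z + i y\<^sup>2\<close>, so that \<open>w (z - i y\<^sup>2) = -x\<^sup>3\<close> in \<open>R\<close>. The ideal \<open>(x, w)\<close> is free over
  \<open>k[[x, y]]\<close> with basis \<open>x, w\<close>. Multiplication by \<open>z\<close> has the matrix with columns
  \<open>(-i y\<^sup>2, x)\<close> and \<open>(-x\<^sup>2, i y\<^sup>2)\<close>.\<close>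

context
  fixes im :: "'k::field"
  assumes im: "im ^ 2 = - 1"
begin

abbreviation iy2 :: "'k fps fps" where "iy2 \<equiv> fps_const (fps_const im) * y2 ^ 2"

definition comb_xw :: "'k fps fps \<Rightarrow> 'k fps fps \<Rightarrow> 'k fps fps fps" where
  "comb_xw s t = binomial_in_z (s * x2 + iy2 * t) t"

lemma im_im: "fps_const (fps_const im) * fps_const (fps_const im) = (- 1 :: 'k fps fps)"
proof -
  have "im * im = - 1" using im by (simp add: power2_eq_square)
  then show ?thesis by (simp flip: fps_const_neg)
qed

lemma iy2_iy2: "iy2 * iy2 = - (y2 ^ 4)"
proof -
  have "iy2 * iy2 = (fps_const (fps_const im) * fps_const (fps_const im)) * y2 ^ 4"
    by (simp add: algebra_simps power2_eq_square power4_eq_xxxx)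
  then show ?thesis unfolding im_im by simp
qed

lemma comb_xw_add: "comb_xw s t + comb_xw s' t' = comb_xw (s + s') (t + t')"
  by (simp add: comb_xw_def algebra_simps flip: fps_const_add)

lemma comb_xw_scale: "fps_const r * comb_xw s t = comb_xw (r * s) (r * t)"
  by (simp add: comb_xw_def algebra_simps flip: fps_const_add fps_const_mult)

lemma comb_xw_z: "ps_z * comb_xw s t = comb_xw (- (iy2 * s) - x2 ^ 2 * t) (x2 * s + iy2 * t) + hyp_eq * fps_const t"
proof -
  have "(- (iy2 * s) - x2 ^ 2 * t) * x2 + iy2 * (x2 * s + iy2 * t) = (iy2 * iy2) * t - x2 ^ 3 * t"
    by (simp add: algebra_simps power2_eq_square power3_eq_cube)
  also have "\<dots> = - branch_eq * t"
  proof -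
    have "- a * t - b * t = - (b + a) * t" for a b :: "'k fps fps" by (simp add: algebra_simps)
    then show ?thesis unfolding iy2_iy2 branch_eq_def .
  qed
  finally have 1: "(- (iy2 * s) - x2 ^ 2 * t) * x2 + iy2 * (x2 * s + iy2 * t) = - branch_eq * t" .
  have 2: "s * x2 + iy2 * t = x2 * s + iy2 * t" by (simp add: mult.commute)
  show ?thesis
    unfolding comb_xw_def 1 2 hyp_eq_branch_eq
    by (simp add: algebra_simps power2_eq_square flip: fps_const_neg fps_const_mult)
qed

lemma comb_xw_unique:
  assumes "hyp_eq dvd comb_xw s t - comb_xw s' t'"
  shows "s = s' \<and> t = t'"
proof -
  have "s * x2 + iy2 * t = s' * x2 + iy2 * t'" "t = t'"
    using normal_form_eq[OF assms[unfolded comb_xw_def]] by auto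
  then show ?thesis by simp
qed

lemma comb_xw_ideal:
  assumes zero: "C 0 0" and add: "\<And>s t s' t'. C s t \<Longrightarrow> C s' t' \<Longrightarrow> C (s + s') (t + t')"
    and scale: "\<And>r s t. C s t \<Longrightarrow> C (r * s) (r * t)"
    and z: "\<And>s t. C s t \<Longrightarrow> C (- (iy2 * s) - x2 ^ 2 * t) (x2 * s + iy2 * t)"
  shows "is_type_ideal {p. \<exists>s t. C s t \<and> hyp_eq dvd p - comb_xw s t}"
  unfolding type_ideal.subspace_def
proof (intro conjI ballI allI)
  have "comb_xw 0 0 = 0" by (simp add: comb_xw_def)
  then show "0 \<in> {p. \<exists>s t. C s t \<and> hyp_eq dvd p - comb_xw s t}" using zero by force
  fix p assume "p \<in> {p. \<exists>s t. C s t \<and> hyp_eq dvd p - comb_xw s t}"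
  then obtain s t where p: "C s t" "hyp_eq dvd p - comb_xw s t" by blast
  show "q * p \<in> {p. \<exists>s t. C s t \<and> hyp_eq dvd p - comb_xw s t}" for q
  proof -
    obtain a b where q: "hyp_eq dvd q - binomial_in_z a b" by (rule normal_form_exists)
    let ?s = "- (iy2 * s) - x2 ^ 2 * t" and ?t = "x2 * s + iy2 * t"
    have "q * p - comb_xw (a * s + b * ?s) (a * t + b * ?t) =
        q * (p - comb_xw s t) + (q - binomial_in_z a b) * comb_xw s t + hyp_eq * (fps_const b * fps_const t)"
    proof -
      have cz: "comb_xw ?s ?t = ps_z * comb_xw s t - hyp_eq * fps_const t" using comb_xw_z[of s t] by simp
      show ?thesis
        unfolding comb_xw_add[symmetric] comb_xw_scale[symmetric] cz by (simp add: algebra_simps)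
    qed
    also have "hyp_eq dvd \<dots>" using p(2) q by (intro dvd_add dvd_mult dvd_mult2 dvd_triv_left)
    finally show ?thesis using add scale z p(1) by blast
  qed
  fix q assume "q \<in> {p. \<exists>s t. C s t \<and> hyp_eq dvd p - comb_xw s t}"
  then obtain s' t' where q: "C s' t'" "hyp_eq dvd q - comb_xw s' t'" by blast
  have eq: "p + q - comb_xw (s + s') (t + t') = (p - comb_xw s t) + (q - comb_xw s' t')"
    by (simp add: comb_xw_add[symmetric])
  have "hyp_eq dvd p + q - comb_xw (s + s') (t + t')" unfolding eq by (rule dvd_add[OF p(2) q(2)])
  then show "p + q \<in> {p. \<exists>s t. C s t \<and> hyp_eq dvd p - comb_xw s t}" using add[OF p(1) q(1)] by blast
qed

definition ideal_xw :: "'k fps fps fps set set" where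
  "ideal_xw = {residue_class (comb_xw s t) | s t. True}"

definition ideal_m_xw :: "'k fps fps fps set set" where
  "ideal_m_xw = {residue_class (comb_xw s t) | s t. s $ 0 $ 0 = 0 \<and> t $ 0 $ 0 = 0}"

lemma residue_class_image_comb:
  "residue_class ` {p. \<exists>s t. C s t \<and> hyp_eq dvd p - comb_xw s t} = {residue_class (comb_xw s t) | s t. C s t}"
  using residue_class_eq_iff by (fastforce simp: image_iff)

lemma ideal_xw_ideal: "ideal ideal_xw hypersurface_ring"
  using hyp_ring_ideal_image[OF comb_xw_ideal[of "\<lambda>_ _. True"]]
  unfolding residue_class_image_comb ideal_xw_def by simp

lemma ideal_m_xw_ideal: "ideal ideal_m_xw hypersurface_ring"
  using hyp_ring_ideal_image[OF comb_xw_ideal[of "\<lambda>s t. s $ 0 $ 0 = 0 \<and> t $ 0 $ 0 = 0"]]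
  unfolding residue_class_image_comb ideal_m_xw_def by (simp add: power2_eq_square)

lemma ideal_m_xw_subset: "ideal_m_xw \<subseteq> ideal_xw"
  by (auto simp: ideal_m_xw_def ideal_xw_def)

lemma comb_xw_eq_iff: "residue_class (comb_xw s t) = residue_class (comb_xw s' t') \<longleftrightarrow> s = s' \<and> t = t'"
  using comb_xw_unique by (auto simp: residue_class_eq_iff)

lemma comb_xw_zero: "residue_class (comb_xw 0 0) = \<zero>\<^bsub>hypersurface_ring\<^esub>"
  by (simp add: comb_xw_def residue_class_zero)

context
  fixes \<iota> :: "'k fps fps fps set \<Rightarrow> 'u"
  assumes inj: "inj_on \<iota> (carrier hypersurface_ring)"
begin

abbreviation module_xw :: "('k fps fps fps set, 'u) module" where
  "module_xw \<equiv> renamed_ideal hypersurface_ring \<iota> ideal_xw"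

abbreviation el :: "'k fps fps \<Rightarrow> 'k fps fps \<Rightarrow> 'u" where
  "el s t \<equiv> \<iota> (residue_class (comb_xw s t))"

interpretation M: module "hypersurface_ring :: 'k fps fps fps set ring" module_xw
  by (rule renamed_ideal_module[OF hyp_ring_cring inj ideal_xw_ideal])

lemmas xw_simps = renamed_ideal_simps[OF hyp_ring_cring inj]

lemma module_xw_carrier: "carrier module_xw = {el s t | s t. True}"
  by (auto simp: xw_simps ideal_xw_def)

lemma el_eq_iff: "el s t = el s' t' \<longleftrightarrow> s = s' \<and> t = t'"
  using inj_on_eq_iff[OF inj residue_class_closed residue_class_closed] comb_xw_eq_iff by simp

lemma module_xw_zero: "\<zero>\<^bsub>module_xw\<^esub> = el 0 0"
  by (simp add: xw_simps comb_xw_zero)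

lemma el_add: "el s t \<oplus>\<^bsub>module_xw\<^esub> el s' t' = el (s + s') (t + t')"
  by (simp add: xw_simps comb_xw_add[symmetric] residue_class_add)

lemma el_scale: "residue_class (fps_const r) \<odot>\<^bsub>module_xw\<^esub> el s t = el (r * s) (r * t)"
  by (simp add: xw_simps comb_xw_scale[symmetric] residue_class_mult)

lemma el_z: "residue_class ps_z \<odot>\<^bsub>module_xw\<^esub> el s t = el (- (iy2 * s) - x2 ^ 2 * t) (x2 * s + iy2 * t)"
proof -
  have "residue_class (ps_z * comb_xw s t) = residue_class (comb_xw (- (iy2 * s) - x2 ^ 2 * t) (x2 * s + iy2 * t))"
    unfolding residue_class_eq_iff comb_xw_z by simp
  then show ?thesis by (simp add: xw_simps residue_class_mult)
qed

lemma el_x: "residue_class ps_x \<odot>\<^bsub>module_xw\<^esub> el s t = el (x2 * s) (x2 * t)"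
  unfolding ps_x_def by (rule el_scale)

lemma el_y: "residue_class ps_y \<odot>\<^bsub>module_xw\<^esub> el s t = el (y2 * s) (y2 * t)"
  unfolding ps_y_def by (rule el_scale)

text \<open>The sequence \<open>y, x\<close> is regular because it is regular on \<open>k[[x, y]]\<close>.\<close>

lemma module_xw_regular:
  "regular_sequence hypersurface_ring module_xw [residue_class ps_y, residue_class ps_x]"
proof -
  let ?I = "Idl\<^bsub>hypersurface_ring\<^esub> {residue_class ps_y, residue_class ps_x :: 'k fps fps fps set}"
  have sub: "submodule (\<iota> ` ideal_m_xw) hypersurface_ring module_xw"
    by (rule renamed_ideal_submodule[OF hyp_ring_cring inj ideal_xw_ideal ideal_m_xw_ideal ideal_m_xw_subset])
  have "ideal_smult hypersurface_ring ?I module_xw \<subseteq> \<iota> ` ideal_m_xw"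
  proof (rule ideal_smult_genideal_least[OF M.module_axioms sub])
    fix r m assume "r \<in> {residue_class ps_y, residue_class ps_x :: 'k fps fps fps set}" "m \<in> carrier module_xw"
    then obtain s t where "m = el s t" "r = residue_class ps_y \<or> r = residue_class ps_x"
      unfolding module_xw_carrier by blast
    then show "r \<odot>\<^bsub>module_xw\<^esub> m \<in> \<iota> ` ideal_m_xw"
      by (auto simp: el_x el_y ideal_m_xw_def intro!: imageI) force+
  qed auto
  moreover have "el 1 0 \<notin> \<iota> ` ideal_m_xw"
    by (auto simp: ideal_m_xw_def el_eq_iff)
  moreover have "el 1 0 \<in> carrier module_xw" by (auto simp: module_xw_carrier)
  ultimately have proper: "ideal_smult hypersurface_ring ?I module_xw \<noteq> carrier module_xw" by blast
  have reg0: "nonzerodivisor_mod hypersurface_ring module_xw {\<zero>\<^bsub>module_xw\<^esub>} (residue_class ps_y)"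
    unfolding nonzerodivisor_mod_def module_xw_carrier module_xw_zero by (auto simp: el_y el_eq_iff)
  have y_dvd: "\<exists>r. s = y2 * r" if "x2 * s = y2 * s'" for s s' :: "'k fps fps"
  proof -
    have "(x2 * s) $ 0 = (y2 * s') $ 0" using that by simp
    then have "s $ 0 = 0" by simp
    then show ?thesis using fps_nth_0_decompose[of s] by auto
  qed
  have reg1: "nonzerodivisor_mod hypersurface_ring module_xw
      ((\<lambda>m. residue_class ps_y \<odot>\<^bsub>module_xw\<^esub> m) ` carrier module_xw) (residue_class ps_x)"
    unfolding nonzerodivisor_mod_def
  proof (intro conjI ballI impI)
    fix m assume "m \<in> carrier module_xw" and *: "residue_class ps_x \<odot>\<^bsub>module_xw\<^esub> m \<in>
      (\<lambda>m. residue_class ps_y \<odot>\<^bsub>module_xw\<^esub> m) ` carrier module_xw"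
    then obtain s t where m: "m = el s t" unfolding module_xw_carrier by blast
    obtain s' t' where "residue_class ps_x \<odot>\<^bsub>module_xw\<^esub> el s t = residue_class ps_y \<odot>\<^bsub>module_xw\<^esub> el s' t'"
      using * unfolding m module_xw_carrier by blast
    then have "x2 * s = y2 * s'" "x2 * t = y2 * t'" by (auto simp: el_x el_y el_eq_iff)
    then obtain a b where "s = y2 * a" "t = y2 * b" using y_dvd by metis
    then have "m = residue_class ps_y \<odot>\<^bsub>module_xw\<^esub> el a b" by (simp add: m el_y)
    then show "m \<in> (\<lambda>m. residue_class ps_y \<odot>\<^bsub>module_xw\<^esub> m) ` carrier module_xw"
      unfolding module_xw_carrier by blast
  qed simp
  show ?thesis
    unfolding regular_sequence_def
    using proper reg0 reg1 ideal_smult_empty[OF M.module_axioms]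
      ideal_smult_singleton[OF M.module_axioms residue_class_closed[of ps_y]]
    by (auto simp: less_Suc_eq)
qed

lemma krull_dim_hyp_ring: "krull_dim (hypersurface_ring :: 'k fps fps fps set ring) = 2"
  using regular_sequence_length_le_krull_dim[OF M.module_axioms module_xw_regular]
    krull_dim_hyp_ring_le[where 'k='k]
  by (simp add: numeral_eq_enat numeral_2_eq_2)

lemma module_xw_MCM: "MCM_module hypersurface_ring module_xw"
  unfolding MCM_module_def
proof (intro conjI)
  have "carrier module_xw \<subseteq> submodule_span hypersurface_ring module_xw {el 1 0, el 0 1}"
  proof
    fix m assume "m \<in> carrier module_xw"
    then obtain s t where m: "m = el s t" unfolding module_xw_carrier by blast
    let ?N = "submodule_span hypersurface_ring module_xw {el 1 0, el 0 1}"
    have N: "submodule ?N hypersurface_ring module_xw"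
      by (rule submodule_span_submodule[OF M.module_axioms]) (auto simp: module_xw_carrier)
    have "m = residue_class (fps_const s) \<odot>\<^bsub>module_xw\<^esub> el 1 0 \<oplus>\<^bsub>module_xw\<^esub> residue_class (fps_const t) \<odot>\<^bsub>module_xw\<^esub> el 0 1"
      by (simp add: m el_scale el_add)
    also have "\<dots> \<in> ?N"
      using submodule_span_superset[OF M.module_axioms, of "{el 1 0, el 0 1}"]
      by (intro M.submoduleE(4,5)[OF N]) auto
    finally show "m \<in> ?N" .
  qed
  moreover have "submodule_span hypersurface_ring module_xw {el 1 0, el 0 1} \<subseteq> carrier module_xw"
    by (rule submodule_span_least[OF M.module_axioms M.carrier_is_submodule]) (auto simp: module_xw_carrier)
  ultimately show "fin_gen_module hypersurface_ring module_xw"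
    unfolding fin_gen_module_def using M.module_axioms
    by (intro conjI exI[of _ "{el 1 0, el 0 1}"]) (auto simp: module_xw_carrier)
  have "el 1 0 \<in> carrier module_xw" "el 1 0 \<noteq> \<zero>\<^bsub>module_xw\<^esub>"
    by (auto simp: module_xw_carrier module_xw_zero el_eq_iff)
  then show "carrier module_xw \<noteq> {\<zero>\<^bsub>module_xw\<^esub>}" by blast
  show "module_depth hypersurface_ring module_xw = krull_dim (hypersurface_ring :: 'k fps fps fps set ring)"
  proof (rule antisym)
    show "module_depth hypersurface_ring module_xw \<le> krull_dim (hypersurface_ring :: 'k fps fps fps set ring)"
      unfolding module_depth_def
    proof (rule Sup_least)
      fix d assume "d \<in> {enat (length xs) | xs. regular_sequence hypersurface_ring module_xw xs}"
      then obtain xs where "d = enat (length xs)" "regular_sequence hypersurface_ring module_xw xs" by blast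
      then show "d \<le> krull_dim (hypersurface_ring :: 'k fps fps fps set ring)"
        using regular_sequence_length_le_krull_dim[OF M.module_axioms] by simp
    qed
    have "enat (length [residue_class ps_y, residue_class ps_x :: 'k fps fps fps set]) \<le> module_depth hypersurface_ring module_xw"
      unfolding module_depth_def by (rule Sup_upper) (use module_xw_regular in blast)
    then show "krull_dim (hypersurface_ring :: 'k fps fps fps set ring) \<le> module_depth hypersurface_ring module_xw"
      unfolding krull_dim_hyp_ring by (simp add: numeral_eq_enat numeral_2_eq_2)
  qed
qed

text \<open>The element \<open>y\<^sup>2\<close> multiplies \<open>(x, w)\<close> into \<open>(x, z) (x, w)\<close>, because
  \<open>y\<^sup>2 x = x (-i w) + z (i x)\<close> and \<open>y\<^sup>2 w = x (-i x\<^sup>2) + z (-i w)\<close>. So it lies in the closure of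
  \<open>(x, z)\<close> in \<open>R\<close> with respect to \<open>(x, w)\<close>.\<close>

lemma y_square_multiplies_xw:
  assumes "m \<in> carrier module_xw"
  shows "\<exists>m\<^sub>1\<in>carrier module_xw. \<exists>m\<^sub>2\<in>carrier module_xw.
    residue_class (ps_y ^ 2) \<odot>\<^bsub>module_xw\<^esub> m =
    residue_class ps_x \<odot>\<^bsub>module_xw\<^esub> m\<^sub>1 \<oplus>\<^bsub>module_xw\<^esub> residue_class ps_z \<odot>\<^bsub>module_xw\<^esub> m\<^sub>2"
proof -
  obtain s t where m: "m = el s t" using assms unfolding module_xw_carrier by blast
  let ?i = "fps_const (fps_const im) :: 'k fps fps"
  have y: "residue_class (ps_y ^ 2) \<odot>\<^bsub>module_xw\<^esub> el s t = el (y2 ^ 2 * s) (y2 ^ 2 * t)"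
    using el_scale[of "y2 ^ 2" s t] by (simp add: ps_y_def fps_const_power)
  have "x2 * (- (j * x2 * t)) + (- ((j * y2 ^ 2) * (j * s)) - x2 ^ 2 * (- (j * t))) = - (j * j) * y2 ^ 2 * s"
    "x2 * (- (j * s)) + (x2 * (j * s) + (j * y2 ^ 2) * (- (j * t))) = - (j * j) * y2 ^ 2 * t" for j
    by (simp_all add: algebra_simps power2_eq_square)
  note 1 = this(1)[of ?i] and 2 = this(2)[of ?i]
  have "residue_class ps_x \<odot>\<^bsub>module_xw\<^esub> el (- (?i * x2 * t)) (- (?i * s))
      \<oplus>\<^bsub>module_xw\<^esub> residue_class ps_z \<odot>\<^bsub>module_xw\<^esub> el (?i * s) (- (?i * t)) = el (y2 ^ 2 * s) (y2 ^ 2 * t)"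
    unfolding el_x el_z el_add 1 2 im_im by simp
  then show ?thesis unfolding m y module_xw_carrier by (metis (mono_tags, lifting) mem_Collect_eq)
qed

end

end

text \<open>The preimage in \<open>k[[x, y, z]]\<close> of the ideal \<open>(x, z)\<close> of \<open>R\<close>, in terms of the coefficients of
  \<open>1, y, y\<^sup>2, y\<^sup>3\<close>.\<close>

definition y_coeffs_ideal :: "'k::comm_ring_1 fps fps fps set" where
  "y_coeffs_ideal = {p. \<forall>j<4. p $ 0 $ j $ 0 = 0}"

lemma y_coeffs_ideal_ideal: "is_type_ideal (y_coeffs_ideal :: 'k::comm_ring_1 fps fps fps set)"
  unfolding type_ideal.subspace_def y_coeffs_ideal_def
  by (auto simp: fps_mult_nth fps_sum_nth intro!: sum.neutral)

text \<open>In \<open>k[y]/(y\<^sup>4)\<close>, only the multiples of \<open>y\<^sup>2\<close> are annihilated by \<open>y\<^sup>2\<close>.\<close>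

lemma y_square_mult_mem_xz:
  fixes p :: "'k::field fps fps fps"
  assumes "residue_class (p * ps_y ^ 2) \<in> Idl\<^bsub>hypersurface_ring\<^esub> {residue_class ps_x, residue_class ps_z}"
  shows "residue_class p \<in> Idl\<^bsub>hypersurface_ring\<^esub> {residue_class ps_x, residue_class (ps_y ^ 2), residue_class ps_z}"
proof -
  interpret R: cring "hypersurface_ring :: 'k fps fps fps set ring" by (rule hyp_ring_cring)
  have "ps_x \<in> (y_coeffs_ideal :: 'k fps fps fps set)" "ps_z \<in> (y_coeffs_ideal :: 'k fps fps fps set)"
    by (simp_all add: y_coeffs_ideal_def ps_x_def ps_z_def)
  then have "Idl\<^bsub>hypersurface_ring\<^esub> {residue_class ps_x, residue_class ps_z} \<subseteq> residue_class ` (y_coeffs_ideal :: 'k fps fps fps set)"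
    by (intro R.genideal_minimal hyp_ring_ideal_image y_coeffs_ideal_ideal) auto
  then obtain q where q: "q \<in> y_coeffs_ideal" "hyp_eq dvd p * ps_y ^ 2 - q"
    using assms residue_class_eq_iff by (metis (no_types, lifting) imageE subsetD)
  have "hyp_eq \<in> (y_coeffs_ideal :: 'k fps fps fps set)"
    by (auto simp: y_coeffs_ideal_def hyp_eq_branch_eq ps_z_def branch_eq_def fps_const_power fps_X_power_nth)
  then have "p * ps_y ^ 2 - q \<in> y_coeffs_ideal"
    using q(2) type_ideal_mult_right[OF y_coeffs_ideal_ideal] by (metis dvdE)
  then have "p * ps_y ^ 2 \<in> y_coeffs_ideal"
    using type_ideal_add[OF y_coeffs_ideal_ideal _ q(1)] by fastforce
  then have py: "(p * ps_y ^ 2) $ 0 $ 2 $ 0 = 0" "(p * ps_y ^ 2) $ 0 $ 3 $ 0 = 0"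
    by (auto simp: y_coeffs_ideal_def)
  have "p $ 0 $ 0 $ 0 = 0" "p $ 0 $ 1 $ 0 = 0"
    using py by (simp_all add: ps_y_def fps_const_power fps_X_power_mult_right_nth)
  then obtain t\<^sub>1 t\<^sub>2 where "fps_const (p $ 0) = t\<^sub>1 * ps_x + t\<^sub>2 * ps_y ^ 2"
    using fps2_taylor[of "p $ 0"] by (metis add.left_neutral fps_const_0_eq_0 mult_zero_left)
  then have "p = t\<^sub>1 * ps_x + t\<^sub>2 * ps_y ^ 2 + fps_shift 1 p * ps_z"
    using fps_nth_0_decompose[of p] by (simp add: ps_z_def mult.commute)
  moreover
  let ?I = "Idl\<^bsub>hypersurface_ring\<^esub> {residue_class ps_x, residue_class (ps_y ^ 2), residue_class ps_z :: 'k fps fps fps set}"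
  have gens: "{residue_class ps_x, residue_class (ps_y ^ 2), residue_class ps_z} \<subseteq> ?I"
    by (rule R.genideal_self) auto
  have "is_type_ideal {p. residue_class p \<in> ?I}"
    by (intro hyp_ring_ideal_preimage R.genideal_ideal) auto
  then have "t\<^sub>1 * ps_x + t\<^sub>2 * ps_y ^ 2 + fps_shift 1 p * ps_z \<in> {p. residue_class p \<in> ?I}"
    using gens by (intro type_ideal_add type_ideal_mult) auto
  ultimately show ?thesis by simp
qed

lemma two_nonzero: "CHAR('k::field) \<noteq> 2 \<Longrightarrow> (2::'k) \<noteq> 0"
proof
  assume "CHAR('k) \<noteq> 2" "(2::'k) = 0"
  then have "CHAR('k) dvd 2" using of_nat_eq_0_iff_char_dvd[where 'a='k, of 2] by simp
  then have "CHAR('k) = 1 \<or> CHAR('k) = 2" using two_is_prime_nat prime_nat_iff by blast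
  then show False using \<open>CHAR('k) \<noteq> 2\<close> by simp
qed

theorem proposition6p9:
  assumes "CHAR('k::alg_closed_field) \<notin> {2, 3, 5}"
    and "carrier (hypersurface_ring :: 'k::alg_closed_field fps fps fps set ring) \<lesssim> (UNIV :: 'u set)"
  shows "MCM_test_ideal TYPE('u) (hypersurface_ring :: 'k::alg_closed_field fps fps fps set ring) =
    Idl\<^bsub>hypersurface_ring\<^esub> {residue_class ps_x, residue_class (ps_y ^ 2), residue_class ps_z}"
proof -
  interpret R: cring "hypersurface_ring :: 'k fps fps fps set ring" by (rule hyp_ring_cring)
  have two: "(2::'k) \<noteq> 0" using assms(1) by (intro two_nonzero) auto
  obtain im :: 'k where im: "im ^ 2 = - 1" using nth_root_exists[of 2 "-1 :: 'k"] by auto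
  obtain \<iota> :: "'k fps fps fps set \<Rightarrow> 'u" where inj: "inj_on \<iota> (carrier hypersurface_ring)"
    using assms(2) unfolding lepoll_def by blast
  let ?I = "Idl\<^bsub>hypersurface_ring\<^esub> {residue_class ps_x, residue_class (ps_y ^ 2), residue_class ps_z :: 'k fps fps fps set}"
  have "?I \<subseteq> MCM_test_ideal TYPE('u) hypersurface_ring"
  proof
    fix r assume r: "r \<in> ?I"
    have rR: "r \<in> carrier hypersurface_ring"
      using r R.genideal_ideal[of "{residue_class ps_x, residue_class (ps_y ^ 2), residue_class ps_z}"] ideal.Icarr by fastforce
    have "r \<in> test_ideal TYPE('u) hypersurface_ring M" if MCM: "MCM_module hypersurface_ring M" for M :: "('k fps fps fps set, 'u) module"
    proof -
      interpret hyp_module M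
        using MCM by (simp add: hyp_module_def MCM_module_def fin_gen_module_def)
      have "?I \<subseteq> test_ideal TYPE('u) hypersurface_ring M"
        using MCM_test_ideal_contains[OF MCM two, where 'v='u] krull_dim_hyp_ring[OF im inj]
        by (intro R.genideal_minimal test_ideal_ideal hyp_ring_cring) auto
      then show ?thesis using r by blast
    qed
    then show "r \<in> MCM_test_ideal TYPE('u) hypersurface_ring" using rR by (simp add: MCM_test_ideal_def)
  qed
  moreover have "MCM_test_ideal TYPE('u) hypersurface_ring \<subseteq> ?I"
  proof
    fix r assume r: "r \<in> MCM_test_ideal TYPE('u) (hypersurface_ring :: 'k fps fps fps set ring)"
    then obtain p where p: "r = residue_class p"
      using residue_class_surj unfolding MCM_test_ideal_def by blast
    let ?M = "renamed_ideal hypersurface_ring \<iota> (ideal_xw im)"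
    let ?B = "renamed_ideal hypersurface_ring \<iota> (carrier hypersurface_ring)"
    let ?J = "Idl\<^bsub>hypersurface_ring\<^esub> {residue_class ps_x, residue_class ps_z :: 'k fps fps fps set}"
    note simps = renamed_ideal_simps[OF hyp_ring_cring inj]
    have J: "ideal ?J hypersurface_ring" by (rule R.genideal_ideal) auto
    have JR: "?J \<subseteq> carrier hypersurface_ring" using J by (meson ideal.Icarr subsetI)
    have gens: "residue_class ps_x \<in> ?J" "residue_class ps_z \<in> ?J"
      using R.genideal_self[of "{residue_class ps_x, residue_class ps_z}"] by auto
    have M: "module hypersurface_ring ?M"
      by (rule renamed_ideal_module[OF hyp_ring_cring inj ideal_xw_ideal[OF im]])
    have B: "module hypersurface_ring ?B"
      by (rule renamed_ideal_module[OF hyp_ring_cring inj R.oneideal])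
    have A: "submodule (\<iota> ` ?J) hypersurface_ring ?B"
      by (rule renamed_ideal_submodule[OF hyp_ring_cring inj R.oneideal J JR])
    have smul1: "q \<odot>\<^bsub>?B\<^esub> \<iota> \<one>\<^bsub>hypersurface_ring\<^esub> = \<iota> q" if "q \<in> carrier hypersurface_ring" for q
      using that by (simp add: simps)
    have "residue_class (ps_y ^ 2) \<odot>\<^bsub>?B\<^esub> \<iota> \<one>\<^bsub>hypersurface_ring\<^esub> \<in> module_closure hypersurface_ring ?M (\<iota> ` ?J) ?B"
    proof (rule smult_mem_module_closure[OF M B A])
      show "\<iota> \<one>\<^bsub>hypersurface_ring\<^esub> \<in> carrier ?B" by (simp add: simps)
      show "residue_class ps_x \<odot>\<^bsub>?B\<^esub> \<iota> \<one>\<^bsub>hypersurface_ring\<^esub> \<in> \<iota> ` ?J" "residue_class ps_z \<odot>\<^bsub>?B\<^esub> \<iota> \<one>\<^bsub>hypersurface_ring\<^esub> \<in> \<iota> ` ?J"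
        using gens by (simp_all add: smul1)
    qed (use y_square_multiplies_xw[OF im inj] in auto)
    then have cl: "\<iota> (residue_class (ps_y ^ 2)) \<in> module_closure hypersurface_ring ?M (\<iota> ` ?J) ?B"
      by (simp add: smul1)
    have "r \<in> test_ideal TYPE('u) hypersurface_ring ?M"
      using r module_xw_MCM[OF im inj] by (simp add: MCM_test_ideal_def)
    then have "r \<odot>\<^bsub>?B\<^esub> \<iota> (residue_class (ps_y ^ 2)) \<in> \<iota> ` ?J"
      using B A cl unfolding test_ideal_def module_colon_def by blast
    then have "\<iota> (residue_class (p * ps_y ^ 2)) \<in> \<iota> ` ?J"
      by (simp add: simps p residue_class_mult)
    then have "residue_class (p * ps_y ^ 2) \<in> ?J"
      using inj_on_image_mem_iff[OF inj residue_class_closed JR] by blast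
    then show "r \<in> ?I" unfolding p by (rule y_square_mult_mem_xz)
  qed
  ultimately show ?thesis by (rule equalityI[rotated])
qed

end
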